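(* Let $\Gamma$ be a countable discrete group. If $\Gamma$ is nonexact (i.e. not exact), then there exists a sequence $(\rho_n)_{n\in\mathbb N}$ of finite invariant random equivalence relations on $\Gamma$ converging weakly to an invariant random equivalence relation $\rho$ on $\Gamma$ such that $\rho$ is not amenable.
   Context: Let $\Gamma$ be a countable discrete group. $\operatorname{Prob}(\Gamma)$ is the set of probability measures on $\Gamma$ with the topology (and Borel structure) inherited from $\ell^1(\Gamma)$; $\Gamma$ acts on it by $(g.\eta)(h)=\eta(g^{-1}h)$. Exactness: an action of $\Gamma$ by homeomorphisms on a topological space $X$ is topologically amenable if there are continuous maps $\eta_n\colon X\to \operatorname{Prob}(\Gamma)$, $x\mapsto \eta_n^x$ ($n\in\mathbb N$), such that for each $g\in\Gamma$, $\sup_{x\in X}\|g.\eta_n^x-\eta_n^{g.x}\|_1\to 0$ as $n\to\infty$. $\Gamma$ is exact if it admits a topologically amenable action on a (nonempty) compact metrizable space. Invariant random equivalence relations: $\mathcal E$ is the set of equivalence relations on $\Gamma$, with the topology inherited from $\{0,1\}^{\Gamma\times\Gamma}$ (a compact metrizable space). $\Gamma$ acts on $\mathcal E$ by left shift: $(h,h')\in g.r$ iff $(g^{-1}h,g^{-1}h')\in r$. For $r\in\mathcal E$, $[g]_r$ is the $r$-class of $g$; $e$ is the identity. An invariant random equivalence relation (IRE) on $\Gamma$ is a $\Gamma$-invariant Borel probability measure on $\mathcal E$. An IRE $\rho$ is finite if $\rho$-almost every $r$ has only finite classes. An IRE $\rho$ is amenable if there are Borel maps $\lambda_n\colon\mathcal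 E\to\operatorname{Prob}(\Gamma)$, $r\mapsto\lambda_n^r$ ($n\in\mathbb N$), such that for $\rho$-almost every $r\in\mathcal E$ and every $g\in[e]_r$, $\|g^{-1}.\lambda_n^r-\lambda_n^{g^{-1}.r}\|_1\to0$ as $n\to\infty$. Weak convergence refers to the weak topology on $\operatorname{Prob}(\mathcal E)$ (testing against continuous functions on $\mathcal E$). *)

theory Defs
  imports "HOL-Probability.Probability" "HOL-Algebra.Group_Action"
begin

section \<open>Probability measures on a discrete group\<close>

text \<open>
  A probability measure on \<open>\<Gamma>\<close> is given by its density \<open>\<eta> :: 'g \<Rightarrow> real\<close>. Densities vanish outside
  the carrier, so that a measure has exactly one density.
\<close>

definition Prob :: "('g, 'b) monoid_scheme \<Rightarrow> ('g \<Rightarrow> real) set" where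
  "Prob G = {\<eta>. (\<forall>h\<in>carrier G. 0 \<le> \<eta> h) \<and> (\<forall>h. h \<notin> carrier G \<longrightarrow> \<eta> h = 0) \<and>
                 (\<eta> has_sum 1) (carrier G)}"

definition l1_norm :: "('g, 'b) monoid_scheme \<Rightarrow> ('g \<Rightarrow> real) \<Rightarrow> real" where
  "l1_norm G f = (\<Sum>\<^sub>\<infinity>h\<in>carrier G. \<bar>f h\<bar>)"

definition l1_dist :: "('g, 'b) monoid_scheme \<Rightarrow> ('g \<Rightarrow> real) \<Rightarrow> ('g \<Rightarrow> real) \<Rightarrow> real" where
  "l1_dist G \<eta> \<theta> = l1_norm G (\<lambda>h. \<eta> h - \<theta> h)"

definition Prob_topology :: "('g, 'b) monoid_scheme \<Rightarrow> ('g \<Rightarrow> real) topology" where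
  "Prob_topology G = Metric_space.mtopology (Prob G) (l1_dist G)"

definition translate :: "('g, 'b) monoid_scheme \<Rightarrow> 'g \<Rightarrow> ('g \<Rightarrow> real) \<Rightarrow> 'g \<Rightarrow> real" where
  "translate G g \<eta> = (\<lambda>h. if h \<in> carrier G then \<eta> (inv\<^bsub>G\<^esub> g \<otimes>\<^bsub>G\<^esub> h) else 0)"


section \<open>Topologically amenable actions and exactness\<close>

definition topologically_amenable ::
  "('g, 'b) monoid_scheme \<Rightarrow> 'x topology \<Rightarrow> ('g \<Rightarrow> 'x \<Rightarrow> 'x) \<Rightarrow> bool" where
  "topologically_amenable G X \<phi> \<longleftrightarrow>
     group_action G (topspace X) \<phi> \<and> (\<forall>g\<in>carrier G. homeomorphic_map X X (\<phi> g)) \<and>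
     (\<exists>\<eta> :: nat \<Rightarrow> 'x \<Rightarrow> 'g \<Rightarrow> real.
        (\<forall>n. continuous_map X (Prob_topology G) (\<eta> n)) \<and>
        (\<forall>g\<in>carrier G.
           (\<lambda>n. SUP x\<in>topspace X. l1_dist G (translate G g (\<eta> n x)) (\<eta> n (\<phi> g x)))
             \<longlonglongrightarrow> 0))"

text \<open>
  HOL does not allow quantification over the type of the points of the space. Every compact
  metrizable space has at most as many points as \<open>nat \<Rightarrow> real\<close>, so it is homeomorphic to a topology
  (not necessarily the product one) on a subset of that type. Lemma \<open>exact_groupI\<close> below shows that
  an action on a space of any type witnesses exactness.
\<close>

definition exact_group :: "('g, 'b) monoid_scheme \<Rightarrow> bool" where
  "exact_group G \<longleftrightarrow>
     (\<exists>(X :: (nat \<Rightarrow> real) topology) \<phi>.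
        compact_space X \<and> metrizable_space X \<and> topspace X \<noteq> {} \<and> topologically_amenable G X \<phi>)"


section \<open>Invariant random equivalence relations\<close>

definition borel_of :: "'x topology \<Rightarrow> 'x measure" where
  "borel_of X = sigma (topspace X) {U. openin X U}"

definition eqrels :: "('g, 'b) monoid_scheme \<Rightarrow> ('g \<times> 'g) set set" where
  "eqrels G = {r. equiv (carrier G) r}"

text \<open>
  The topology inherited from \<open>{0,1}\<^bsup>\<Gamma>\<times>\<Gamma>\<^esup>\<close>: a relation is identified with its indicator function,
  restricted because the points of a \<open>product_topology\<close> are extensional functions.
\<close>

definition eqrel_topology :: "('g, 'b) monoid_scheme \<Rightarrow> ('g \<times> 'g) set topology" where
  "eqrel_topology G =
     pullback_topology (eqrels G) (\<lambda>r. restrict (\<lambda>p. p \<in> r) (carrier G \<times> carrier G))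
       (product_topology (\<lambda>_. discrete_topology (UNIV :: bool set)) (carrier G \<times> carrier G))"

definition shift :: "('g, 'b) monoid_scheme \<Rightarrow> 'g \<Rightarrow> ('g \<times> 'g) set \<Rightarrow> ('g \<times> 'g) set" where
  "shift G g r = {(h, h') \<in> carrier G \<times> carrier G.
                    (inv\<^bsub>G\<^esub> g \<otimes>\<^bsub>G\<^esub> h, inv\<^bsub>G\<^esub> g \<otimes>\<^bsub>G\<^esub> h') \<in> r}"

definition IRE :: "('g, 'b) monoid_scheme \<Rightarrow> ('g \<times> 'g) set measure \<Rightarrow> bool" where
  "IRE G \<rho> \<longleftrightarrow>
     prob_space \<rho> \<and> sets \<rho> = sets (borel_of (eqrel_topology G)) \<and>
     (\<forall>g\<in>carrier G. distr \<rho> \<rho> (shift G g) = \<rho>)"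

definition finite_IRE :: "('g, 'b) monoid_scheme \<Rightarrow> ('g \<times> 'g) set measure \<Rightarrow> bool" where
  "finite_IRE G \<rho> \<longleftrightarrow> IRE G \<rho> \<and> (AE r in \<rho>. \<forall>g\<in>carrier G. finite (r `` {g}))"

definition amenable_IRE :: "('g, 'b) monoid_scheme \<Rightarrow> ('g \<times> 'g) set measure \<Rightarrow> bool" where
  "amenable_IRE G \<rho> \<longleftrightarrow> IRE G \<rho> \<and>
     (\<exists>l :: nat \<Rightarrow> ('g \<times> 'g) set \<Rightarrow> 'g \<Rightarrow> real.
        (\<forall>n. l n \<in> borel_of (eqrel_topology G) \<rightarrow>\<^sub>M borel_of (Prob_topology G)) \<and>
        (AE r in \<rho>. \<forall>g \<in> r `` {\<one>\<^bsub>G\<^esub>}.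
           (\<lambda>n. l1_dist G (translate G (inv\<^bsub>G\<^esub> g) (l n r)) (l n (shift G (inv\<^bsub>G\<^esub> g) r)))
             \<longlonglongrightarrow> 0))"

text \<open>Continuous test functions are automatically bounded, since \<open>eqrel_topology G\<close> is compact.\<close>

definition weakly_converges ::
  "('g, 'b) monoid_scheme \<Rightarrow> (nat \<Rightarrow> ('g \<times> 'g) set measure) \<Rightarrow> ('g \<times> 'g) set measure \<Rightarrow> bool"
where
  "weakly_converges G \<rho> \<rho>' \<longleftrightarrow>
     (\<forall>f :: ('g \<times> 'g) set \<Rightarrow> real. continuous_map (eqrel_topology G) euclideanreal f \<longrightarrow>
        (\<lambda>n. \<integral>r. f r \<partial>\<rho> n) \<longlonglongrightarrow> (\<integral>r. f r \<partial>\<rho>'))"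


section \<open>Basic facts\<close>

lemma topspace_eqrel_topology: "topspace (eqrel_topology G) = eqrels G"
  by (auto simp: eqrel_topology_def topspace_pullback_topology)

lemma space_borel_of: "space (borel_of X) = topspace X"
  unfolding borel_of_def by (rule space_measure_of) (auto dest: openin_subset)

lemma sets_borel_of: "sets (borel_of X) = sigma_sets (topspace X) {U. openin X U}"
  unfolding borel_of_def by (rule sets_measure_of) (auto dest: openin_subset)

lemma Prob_summable:
  assumes "\<eta> \<in> Prob G"
  shows "(\<lambda>h. \<bar>\<eta> h\<bar>) summable_on carrier G"
proof -
  have "\<eta> summable_on carrier G"
    using assms by (auto simp: Prob_def summable_on_def)
  then show ?thesis
    by (rule summable_on_cong[THEN iffD1, rotated]) (use assms in \<open>auto simp: Prob_def\<close>)
qed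

lemma Prob_diff_summable:
  assumes "\<eta> \<in> Prob G" "\<theta> \<in> Prob G"
  shows "(\<lambda>h. \<bar>\<eta> h - \<theta> h\<bar>) summable_on carrier G"
proof -
  have "(\<lambda>h. \<bar>\<eta> h\<bar> + \<bar>\<theta> h\<bar>) summable_on carrier G"
    by (intro summable_on_add Prob_summable assms)
  then show ?thesis
    by (rule summable_on_comparison_test) auto
qed

lemma Metric_space_Prob: "Metric_space (Prob G) (l1_dist G)"
proof
  fix \<eta> \<theta> :: "'a \<Rightarrow> real"
  show "0 \<le> l1_dist G \<eta> \<theta>"
    by (auto simp: l1_dist_def l1_norm_def intro: infsum_nonneg)
  show "l1_dist G \<eta> \<theta> = l1_dist G \<theta> \<eta>"
    by (simp add: l1_dist_def l1_norm_def abs_minus_commute)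
next
  fix \<eta> \<theta> assume *: "\<eta> \<in> Prob G" "\<theta> \<in> Prob G"
  have "\<eta> = \<theta>" if "l1_dist G \<eta> \<theta> = 0"
  proof
    fix h
    have "h \<in> carrier G \<Longrightarrow> \<bar>\<eta> h - \<theta> h\<bar> = 0"
      using that Prob_diff_summable[OF *]
      by (intro nonneg_infsum_le_0D[where A = "carrier G" and f = "\<lambda>h. \<bar>\<eta> h - \<theta> h\<bar>"])
         (auto simp: l1_dist_def l1_norm_def)
    then show "\<eta> h = \<theta> h"
      using * by (cases "h \<in> carrier G") (auto simp: Prob_def)
  qed
  then show "l1_dist G \<eta> \<theta> = 0 \<longleftrightarrow> \<eta> = \<theta>"
    by (auto simp: l1_dist_def l1_norm_def)
next
  fix \<eta> \<theta> \<zeta> assume *: "\<eta> \<in> Prob G" "\<theta> \<in> Prob G" "\<zeta> \<in> Prob G"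
  have "(\<Sum>\<^sub>\<infinity>h\<in>carrier G. \<bar>\<eta> h - \<zeta> h\<bar>) \<le> (\<Sum>\<^sub>\<infinity>h\<in>carrier G. \<bar>\<eta> h - \<theta> h\<bar> + \<bar>\<theta> h - \<zeta> h\<bar>)"
    by (intro infsum_mono summable_on_add Prob_diff_summable *) auto
  also have "\<dots> = (\<Sum>\<^sub>\<infinity>h\<in>carrier G. \<bar>\<eta> h - \<theta> h\<bar>) + (\<Sum>\<^sub>\<infinity>h\<in>carrier G. \<bar>\<theta> h - \<zeta> h\<bar>)"
    by (intro infsum_add Prob_diff_summable *)
  finally show "l1_dist G \<eta> \<zeta> \<le> l1_dist G \<eta> \<theta> + l1_dist G \<theta> \<zeta>"
    by (simp add: l1_dist_def l1_norm_def)
qed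

lemma topspace_Prob_topology: "topspace (Prob_topology G) = Prob G"
  unfolding Prob_topology_def
  by (rule Metric_space.topspace_mtopology[OF Metric_space_Prob])

lemma shift_eqrels:
  assumes "group G" "g \<in> carrier G" "r \<in> eqrels G"
  shows "shift G g r \<in> eqrels G"
proof -
  interpret group G by fact
  from assms have r: "equiv (carrier G) r" by (simp add: eqrels_def)
  have "equiv (carrier G) (shift G g r)"
  proof (rule equivI)
    show "refl_on (carrier G) (shift G g r)"
      using r assms by (auto simp: refl_on_def shift_def equiv_def)
    show "sym (shift G g r)"
      using r by (auto simp: sym_def shift_def equiv_def)
    show "trans (shift G g r)"
      using r unfolding equiv_def trans_def shift_def by blast
  qed (auto simp: shift_def)
  then show ?thesis by (simp add: eqrels_def)
qed

lemma compact_metrizable_inj: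
  fixes X :: "'x topology"
  assumes "compact_space X" "metrizable_space X"
  obtains f :: "'x \<Rightarrow> nat \<Rightarrow> real" where "inj_on f (topspace X)"
proof -
  obtain M d where M: "Metric_space M d" and X: "X = Metric_space.mtopology M d"
    using assms(2) by (auto simp: metrizable_space_def)
  interpret Metric_space M d by fact
  have "mtotally_bounded M"
    using assms(1) compact_space_eq_mcomplete_mtotally_bounded by (simp add: X)
  then have "\<forall>n::nat. \<exists>K. finite K \<and> K \<subseteq> M \<and> M \<subseteq> (\<Union>x\<in>K. mball x (1 / Suc n))"
    unfolding mtotally_bounded_def by auto
  then obtain K where K: "\<And>n::nat. finite (K n)" "\<And>n. K n \<subseteq> M"
      "\<And>n. M \<subseteq> (\<Union>x\<in>K n. mball x (1 / Suc n))"
    by metis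
  define D where "D = (\<Union>n. K n)"
  have D: "countable D" unfolding D_def by (auto intro: countable_finite K)
  have "inj_on (\<lambda>x k. d x (from_nat_into D k)) M"
  proof (rule inj_onI, rule ccontr)
    fix x y assume xy: "x \<in> M" "y \<in> M" "x \<noteq> y"
      and eq: "(\<lambda>k. d x (from_nat_into D k)) = (\<lambda>k. d y (from_nat_into D k))"
    then have pos: "d x y / 2 > 0" by (simp add: less_le)
    then obtain n :: nat where n: "1 / Suc n < d x y / 2"
      using nat_approx_posE by metis
    obtain c where c: "c \<in> K n" "x \<in> mball c (1 / Suc n)"
      using K(3)[of n] xy by auto
    then have "c \<in> D" by (auto simp: D_def)
    then obtain k where "from_nat_into D k = c"
      using from_nat_into_surj[OF D] by blast
    with eq have "d x c = d y c" by metis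
    moreover have "d x c < d x y / 2" using c n by (auto simp: commute)
    moreover have "d x y \<le> d x c + d y c"
      using triangle[of x c y] xy c K(2)[of n] by (auto simp: commute)
    ultimately show False by linarith
  qed
  then have "inj_on (\<lambda>x k. d x (from_nat_into D k)) (topspace X)"
    by (simp add: X)
  then show ?thesis by (rule that)
qed

lemma translate_Prob:
  assumes "group G" "g \<in> carrier G" "\<eta> \<in> Prob G"
  shows "translate G g \<eta> \<in> Prob G"
proof -
  interpret group G by fact
  have "bij_betw (\<lambda>h. inv\<^bsub>G\<^esub> g \<otimes>\<^bsub>G\<^esub> h) (carrier G) (carrier G)"
    by (rule bij_betw_byWitness[where f' = "\<lambda>h. g \<otimes>\<^bsub>G\<^esub> h"])
       (use assms(2) in \<open>auto simp: m_assoc[symmetric]\<close>)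
  from has_sum_reindex_bij_betw[OF this, of \<eta> 1]
  have "((\<lambda>h. \<eta> (inv\<^bsub>G\<^esub> g \<otimes>\<^bsub>G\<^esub> h)) has_sum 1) (carrier G)"
    using assms(3) by (simp add: Prob_def)
  then have "(translate G g \<eta> has_sum 1) (carrier G)"
    by (rule has_sum_cong[THEN iffD1, rotated]) (simp add: translate_def)
  then show ?thesis
    using assms(2,3) by (auto simp: Prob_def translate_def)
qed

lemma topologically_amenable_homeomorphic:
  fixes G :: "('g, 'b) monoid_scheme" and X :: "'x topology" and Y :: "'y topology"
  assumes am: "topologically_amenable G X \<phi>" and hom: "homeomorphic_maps X Y f k"
  shows "topologically_amenable G Y (\<lambda>a. \<lambda>y\<in>topspace Y. f (\<phi> a (k y)))"
proof -
  define \<psi> where "\<psi> = (\<lambda>a. \<lambda>y\<in>topspace Y. f (\<phi> a (k y)))"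
  have f: "continuous_map X Y f" and k: "continuous_map Y X k"
    and kf: "\<And>x. x \<in> topspace X \<Longrightarrow> k (f x) = x" and fk: "\<And>y. y \<in> topspace Y \<Longrightarrow> f (k y) = y"
    using hom by (auto simp: homeomorphic_maps_def)
  have fX: "\<And>x. x \<in> topspace X \<Longrightarrow> f x \<in> topspace Y" and kY: "\<And>y. y \<in> topspace Y \<Longrightarrow> k y \<in> topspace X"
    using f k by (auto simp: continuous_map_def)
  obtain \<eta> :: "nat \<Rightarrow> 'x \<Rightarrow> 'g \<Rightarrow> real" where
    act: "group_action G (topspace X) \<phi>" and
    homeo: "\<And>g. g \<in> carrier G \<Longrightarrow> homeomorphic_map X X (\<phi> g)" and
    cont: "\<And>n. continuous_map X (Prob_topology G) (\<eta> n)" and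
    lim: "\<And>g. g \<in> carrier G \<Longrightarrow>
           (\<lambda>n. SUP x\<in>topspace X. l1_dist G (translate G g (\<eta> n x)) (\<eta> n (\<phi> g x))) \<longlonglongrightarrow> 0"
    using am unfolding topologically_amenable_def by blast
  interpret A: group_action G "topspace X" \<phi> by (fact act)
  have grp: "group G"
    using A.group_hom by (simp add: group_hom_def)
  have phiX: "\<phi> g x \<in> topspace X" if "g \<in> carrier G" "x \<in> topspace X" for g x
    using A.element_image[OF that refl] .
  have kpsi: "k (\<psi> g y) = \<phi> g (k y)" if "g \<in> carrier G" "y \<in> topspace Y" for g y
    using that kY phiX by (simp add: \<psi>_def kf)
  have homeo': "homeomorphic_map Y Y (\<psi> g)" if g: "g \<in> carrier G" for g
  proof -
    have "homeomorphic_map X Y f"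
      using hom by (rule homeomorphic_maps_imp_map)
    moreover have "homeomorphic_map Y X k"
      using hom[THEN homeomorphic_maps_sym[THEN iffD1]] by (rule homeomorphic_maps_imp_map)
    ultimately have "homeomorphic_map Y Y (f \<circ> (\<phi> g \<circ> k))"
      using homeo[OF g] by (intro homeomorphic_map_compose[of Y X _ Y] homeomorphic_map_compose[of Y X _ X])
    then show ?thesis
      by (rule homeomorphic_map_eq) (simp add: \<psi>_def)
  qed
  have bij: "\<psi> g \<in> Bij (topspace Y)" if "g \<in> carrier G" for g
  proof -
    have "bij_betw (\<psi> g) (topspace Y) (topspace Y)"
      using homeomorphic_imp_injective_map[OF homeo'[OF that]]
        homeomorphic_imp_surjective_map[OF homeo'[OF that]] by (simp add: bij_betw_def)
    moreover have "\<psi> g \<in> extensional (topspace Y)" by (simp add: \<psi>_def)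
    ultimately show ?thesis by (simp add: Bij_def)
  qed
  have mult: "\<psi> (g \<otimes>\<^bsub>G\<^esub> h) = compose (topspace Y) (\<psi> g) (\<psi> h)"
    if "g \<in> carrier G" "h \<in> carrier G" for g h
  proof
    fix y
    show "\<psi> (g \<otimes>\<^bsub>G\<^esub> h) y = compose (topspace Y) (\<psi> g) (\<psi> h) y"
    proof (cases "y \<in> topspace Y")
      case True
      have *: "\<psi> h y \<in> topspace Y"
        using that True fX kY phiX by (simp add: \<psi>_def)
      have "\<psi> (g \<otimes>\<^bsub>G\<^esub> h) y = f (\<phi> (g \<otimes>\<^bsub>G\<^esub> h) (k y))"
        using True by (simp add: \<psi>_def)
      also have "\<phi> (g \<otimes>\<^bsub>G\<^esub> h) (k y) = \<phi> g (\<phi> h (k y))"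
        by (rule A.composition_rule[OF kY[OF True] that])
      also have "\<phi> h (k y) = k (\<psi> h y)"
        by (rule kpsi[OF that(2) True, symmetric])
      also have "f (\<phi> g (k (\<psi> h y))) = \<psi> g (\<psi> h y)"
        using * by (subst (2) \<psi>_def) simp
      finally show ?thesis using True by (simp only: compose_eq)
    qed (simp add: compose_def \<psi>_def)
  qed
  have act': "group_action G (topspace Y) \<psi>"
    unfolding group_action_def group_hom_def group_hom_axioms_def
  proof (intro conjI grp group_BijGroup homI)
    fix g h assume g: "g \<in> carrier G"
    show "\<psi> g \<in> carrier (BijGroup (topspace Y))"
      using bij[OF g] by (simp add: BijGroup_def)
    assume h: "h \<in> carrier G"
    show "\<psi> (g \<otimes>\<^bsub>G\<^esub> h) = \<psi> g \<otimes>\<^bsub>BijGroup (topspace Y)\<^esub> \<psi> h"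
      using bij[OF g] bij[OF h] mult[OF g h] by (simp add: BijGroup_def)
  qed
  have img: "k ` topspace Y = topspace X"
    using kY fX kf by (auto simp: image_iff) metis
  have "(\<lambda>n. SUP y\<in>topspace Y. l1_dist G (translate G g (\<eta> n (k y))) (\<eta> n (k (\<psi> g y)))) \<longlonglongrightarrow> 0"
    if "g \<in> carrier G" for g
  proof -
    have "(SUP y\<in>topspace Y. l1_dist G (translate G g (\<eta> n (k y))) (\<eta> n (k (\<psi> g y)))) =
          (SUP x\<in>topspace X. l1_dist G (translate G g (\<eta> n x)) (\<eta> n (\<phi> g x)))" for n
      unfolding img[symmetric] image_image using kpsi[OF that] by (simp cong: image_cong)
    then show ?thesis using lim[OF that] by simp
  qed
  moreover have "continuous_map Y (Prob_topology G) (\<lambda>y. \<eta> n (k y))" for n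
    using continuous_map_compose[OF k cont[of n]] by (simp add: comp_def)
  ultimately have "topologically_amenable G Y \<psi>"
    unfolding topologically_amenable_def
    using act' homeo' by (intro conjI exI[where x = "\<lambda>n y. \<eta> n (k y)"]) auto
  then show ?thesis by (simp add: \<psi>_def)
qed

lemma exact_groupI:
  fixes G :: "('g, 'b) monoid_scheme" and X :: "'x topology"
  assumes "compact_space X" "metrizable_space X" "topspace X \<noteq> {}" "topologically_amenable G X \<phi>"
  shows "exact_group G"
proof -
  obtain f :: "'x \<Rightarrow> nat \<Rightarrow> real" where inj: "inj_on f (topspace X)"
    using compact_metrizable_inj assms(1,2) by blast
  define k where "k = inv_into (topspace X) f"
  define Y where "Y = pullback_topology (f ` topspace X) k X"
  have kf: "k (f x) = x" if "x \<in> topspace X" for x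
    using that inj by (simp add: k_def)
  have Y: "topspace Y = f ` topspace X"
    by (auto simp: Y_def topspace_pullback_topology kf)
  have "continuous_map X Y f"
    unfolding Y_def
    by (rule continuous_map_pullback')
       (auto simp: kf intro: continuous_map_eq[OF continuous_map_id])
  moreover have "continuous_map Y X k"
    using continuous_map_pullback[OF continuous_map_id[of X], of "f ` topspace X" k]
    by (simp add: Y_def)
  ultimately have hom: "homeomorphic_maps X Y f k"
    by (auto simp: homeomorphic_maps_def kf Y)
  then have "X homeomorphic_space Y"
    by (rule homeomorphic_maps_imp_homeomorphic_space)
  then have "compact_space Y" "metrizable_space Y"
    using assms(1,2) homeomorphic_compact_space homeomorphic_metrizable_space by blast+
  moreover have "topspace Y \<noteq> {}" using assms(3) by (simp add: Y)
  ultimately show ?thesis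
    unfolding exact_group_def
    using topologically_amenable_homeomorphic[OF assms(4) hom] by blast
qed

end

theory Submission
  imports Defs
begin

text \<open>Call a map \<open>\<lambda>\<close> assigning to each \<open>x \<in> \<Gamma>\<close> a probability measure on \<open>x K\<close>, for a finite set \<open>K\<close>,
  a field. If \<open>\<Gamma>\<close> is not exact, there are a finite set \<open>S\<close> and \<open>\<epsilon> > 0\<close> such that every finite \<open>K\<close>
  admits a finite \<open>F \<subseteq> \<Gamma>\<close> on which every field with values on the sets \<open>x K\<close> has variation
  \<open>\<Sum> \<parallel>\<lambda> x - \<lambda> (x s)\<parallel> > \<epsilon> |F|\<close>, the sum ranging over \<open>s \<in> S\<close> and \<open>x, x s \<in> F\<close>. Indeed, fields of small
  average variation on all finite sets give fields of small average variation for all finitely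
  supported weights (smooth the weight along \<open>S\<close> and cut \<open>\<Gamma>\<close> into bands on which it is roughly
  constant), hence by a minimax argument fields of uniformly small variation, and the compact space of
  sequences of such fields carries a topologically amenable action.

  Let \<open>F\<^sub>n\<close> be such sets for an exhaustion \<open>K\<^sub>n\<close> of \<open>\<Gamma>\<close>. Scatter translates of \<open>F\<^sub>n\<close> independently with
  density \<open>t / |F\<^sub>n|\<close> and let the points covered by exactly one translate be equivalent if that
  translate is the same. For small \<open>t\<close> most of a typical translate survives. Evaluating a local map
  \<open>\<Lambda>\<close> from equivalence relations to measures on \<open>K \<subseteq> K\<^sub>n\<close> along such a translate gives a field on
  \<open>F\<^sub>n\<close>, so the expected failure of invariance of \<open>\<Lambda>\<close> is bounded below by a constant depending on
  \<open>\<epsilon>\<close> and \<open>S\<close> only. This bound passes to weak limits. It contradicts amenability of the limit, because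
  Borel maps can be approximated in \<open>L\<^sup>1\<close> by local ones.\<close>

section \<open>Probability measures on a group\<close>

text \<open>The packing relations have finite classes and so are amenable themselves, by the uniform
  measures on classes. Non-amenability can appear only in the limit, and it has to be detected by
  kernels of a fixed finite support \<open>K\<close>: hence a lower bound valid for all large
  \<open>n\<close> with a constant free of \<open>K\<close>, and the order of choices
  \<open>S\<close>, \<open>\<epsilon>\<close>, then \<open>K\<close>, then \<open>F\<close>. Only
  pairs inside \<open>F\<close> may count, because a packing compares only points of one class. This
  makes the averaged bound weak: it gives no control across the boundary of a set, so that weights
  cannot simply be cut into level sets. Smoothing gives neighbours comparable weights, and then few
  pairs are separated by well-chosen bands. The constant comes from a second-order argument: a
  centre at \<one> has probability \<open>p = t / card F\<close> and contributes
  \<open>\<epsilon> * card F\<close>, while the loss comes from pairs of marked centres and is of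
  order \<open>p\<^sup>2\<close>. With \<open>N = card S\<close> this gives
  \<open>\<epsilon> * t - 4 * N * t\<^sup>2\<close>, independent of \<open>F\<close>. Passing from a
  centre at \<one> to an arbitrary position of \<one> in its translate is mass transport.\<close>

lemma l1_dist_finite:
  assumes "finite Q" "Q \<subseteq> carrier G" "\<And>h. h \<in> carrier G - Q \<Longrightarrow> \<eta> h = \<theta> h"
  shows "l1_dist G \<eta> \<theta> = (\<Sum>h\<in>Q. \<bar>\<eta> h - \<theta> h\<bar>)"
proof -
  have "l1_dist G \<eta> \<theta> = (\<Sum>\<^sub>\<infinity>h\<in>Q. \<bar>\<eta> h - \<theta> h\<bar>)"
    unfolding l1_dist_def l1_norm_def
    by (rule infsum_cong_neutral) (use assms in auto)
  then show ?thesis using assms(1) by simp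
qed

lemma l1_dist_nonneg: "0 \<le> l1_dist G \<eta> \<theta>"
  by (auto simp: l1_dist_def l1_norm_def intro: infsum_nonneg)

lemma Prob_infsum:
  assumes "\<eta> \<in> Prob G"
  shows "(\<Sum>\<^sub>\<infinity>h\<in>carrier G. \<bar>\<eta> h\<bar>) = 1"
proof -
  have "(\<Sum>\<^sub>\<infinity>h\<in>carrier G. \<bar>\<eta> h\<bar>) = (\<Sum>\<^sub>\<infinity>h\<in>carrier G. \<eta> h)"
    by (rule infsum_cong) (use assms in \<open>auto simp: Prob_def\<close>)
  then show ?thesis using assms by (auto simp: Prob_def infsumI)
qed

lemma l1_dist_le_2:
  assumes "\<eta> \<in> Prob G" "\<theta> \<in> Prob G"
  shows "l1_dist G \<eta> \<theta> \<le> 2"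
proof -
  have "l1_dist G \<eta> \<theta> \<le> (\<Sum>\<^sub>\<infinity>h\<in>carrier G. \<bar>\<eta> h\<bar> + \<bar>\<theta> h\<bar>)"
    unfolding l1_dist_def l1_norm_def
    by (intro infsum_mono summable_on_add Prob_diff_summable Prob_summable assms) auto
  also have "\<dots> = 2"
    using assms by (simp add: infsum_add Prob_summable Prob_infsum)
  finally show ?thesis .
qed

lemma sum_abs_diff_le_l1_dist:
  assumes "\<eta> \<in> Prob G" "\<theta> \<in> Prob G" "finite Q" "Q \<subseteq> carrier G"
  shows "(\<Sum>h\<in>Q. \<bar>\<eta> h - \<theta> h\<bar>) \<le> l1_dist G \<eta> \<theta>"
  unfolding l1_dist_def l1_norm_def
  by (rule finite_sum_le_infsum) (use assms Prob_diff_summable in auto)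

lemma Prob_sum_le_1:
  assumes "\<eta> \<in> Prob G" "finite Q" "Q \<subseteq> carrier G"
  shows "(\<Sum>h\<in>Q. \<eta> h) \<le> 1"
proof -
  have "(\<Sum>h\<in>Q. \<eta> h) \<le> (\<Sum>\<^sub>\<infinity>h\<in>carrier G. \<eta> h)"
    by (rule finite_sum_le_infsum) (use assms in \<open>auto simp: Prob_def summable_on_def\<close>)
  then show ?thesis using assms by (auto simp: Prob_def infsumI)
qed

lemma Prob_finiteI:
  assumes "finite Q" "Q \<subseteq> carrier G" "\<And>h. h \<in> Q \<Longrightarrow> 0 \<le> \<eta> h" "\<And>h. h \<notin> Q \<Longrightarrow> \<eta> h = 0"
    and "(\<Sum>h\<in>Q. \<eta> h) = 1"
  shows "\<eta> \<in> Prob G"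
proof -
  have "(\<eta> has_sum 1) (carrier G) \<longleftrightarrow> (\<eta> has_sum 1) Q"
    by (rule has_sum_cong_neutral) (use assms in auto)
  moreover have "(\<eta> has_sum 1) Q"
    using assms by (simp add: has_sum_finite_iff)
  moreover have "0 \<le> \<eta> h" for h using assms(3,4) by (cases "h \<in> Q") auto
  ultimately show ?thesis using assms(2,4) by (auto simp: Prob_def)
qed

lemma has_sum_sum_lessThan:
  fixes f :: "nat \<Rightarrow> 'a \<Rightarrow> real"
  assumes "\<And>t. t < T \<Longrightarrow> (f t has_sum a t) A"
  shows "((\<lambda>h. \<Sum>t<T. f t h) has_sum (\<Sum>t<T. a t)) A"
  using assms by (induction T) (auto intro!: has_sum_add)

lemma Prob_average:
  fixes \<eta> :: "nat \<Rightarrow> 'g \<Rightarrow> real"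
  assumes "T > 0" "\<And>t. t < T \<Longrightarrow> \<eta> t \<in> Prob G"
  shows "(\<lambda>h. (\<Sum>t<T. \<eta> t h) / real T) \<in> Prob G"
proof -
  have "((\<lambda>h. \<Sum>t<T. \<eta> t h) has_sum (\<Sum>t<T. 1)) (carrier G)"
    by (rule has_sum_sum_lessThan) (use assms in \<open>auto simp: Prob_def\<close>)
  then have "((\<lambda>h. (\<Sum>t<T. \<eta> t h) * (1 / real T)) has_sum (\<Sum>t<T. 1) * (1 / real T)) (carrier G)"
    by (rule has_sum_cmult_left)
  then show ?thesis using assms by (auto simp: Prob_def intro!: sum_nonneg divide_nonneg_nonneg)
qed

text \<open>Convexity of the norm, in the form in which the fields produced by
  \<open>multiplicative_weights\<close> are averaged.\<close>

lemma l1_dist_average: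
  fixes \<eta> \<theta> :: "nat \<Rightarrow> 'g \<Rightarrow> real"
  assumes "T > 0" "\<And>t. t < T \<Longrightarrow> \<eta> t \<in> Prob G" "\<And>t. t < T \<Longrightarrow> \<theta> t \<in> Prob G"
  shows "l1_dist G (\<lambda>h. (\<Sum>t<T. \<eta> t h) / real T) (\<lambda>h. (\<Sum>t<T. \<theta> t h) / real T)
          \<le> (\<Sum>t<T. l1_dist G (\<eta> t) (\<theta> t)) / real T"
proof -
  have s: "((\<lambda>h. \<bar>\<eta> t h - \<theta> t h\<bar>) has_sum l1_dist G (\<eta> t) (\<theta> t)) (carrier G)" if "t < T" for t
    unfolding l1_dist_def l1_norm_def
    using Prob_diff_summable[OF assms(2,3)[OF that]] by simp
  have "((\<lambda>h. \<Sum>t<T. \<bar>\<eta> t h - \<theta> t h\<bar>) has_sum (\<Sum>t<T. l1_dist G (\<eta> t) (\<theta> t))) (carrier G)"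
    by (rule has_sum_sum_lessThan) (use s in auto)
  then have *: "((\<lambda>h. (\<Sum>t<T. \<bar>\<eta> t h - \<theta> t h\<bar>) * (1 / real T)) has_sum
              (\<Sum>t<T. l1_dist G (\<eta> t) (\<theta> t)) * (1 / real T)) (carrier G)"
    by (rule has_sum_cmult_left)
  have "\<bar>(\<Sum>t<T. \<eta> t h) / real T - (\<Sum>t<T. \<theta> t h) / real T\<bar> \<le> (\<Sum>t<T. \<bar>\<eta> t h - \<theta> t h\<bar>) * (1 / real T)"
    for h
  proof -
    have "\<bar>(\<Sum>t<T. \<eta> t h) / real T - (\<Sum>t<T. \<theta> t h) / real T\<bar> = \<bar>\<Sum>t<T. \<eta> t h - \<theta> t h\<bar> * (1 / real T)"
      using assms(1) by (simp add: sum_subtractf diff_divide_distrib[symmetric] abs_divide)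
    also have "\<dots> \<le> (\<Sum>t<T. \<bar>\<eta> t h - \<theta> t h\<bar>) * (1 / real T)"
      by (rule mult_right_mono) auto
    finally show ?thesis .
  qed
  then have "l1_dist G (\<lambda>h. (\<Sum>t<T. \<eta> t h) / real T) (\<lambda>h. (\<Sum>t<T. \<theta> t h) / real T)
     \<le> (\<Sum>\<^sub>\<infinity>h\<in>carrier G. (\<Sum>t<T. \<bar>\<eta> t h - \<theta> t h\<bar>) * (1 / real T))"
    unfolding l1_dist_def l1_norm_def
    using Prob_diff_summable[OF Prob_average Prob_average, OF assms(1,2) assms(1,3)] *
    by (intro infsum_mono) (auto simp: summable_on_def)
  also have "\<dots> = (\<Sum>t<T. l1_dist G (\<eta> t) (\<theta> t)) * (1 / real T)"
    by (rule infsumI[OF *])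
  finally show ?thesis by simp
qed

context group
begin

lemma bij_betw_mult_left:
  assumes "g \<in> carrier G"
  shows "bij_betw (\<lambda>h. g \<otimes> h) (carrier G) (carrier G)"
  by (rule bij_betw_byWitness[where f' = "\<lambda>h. inv g \<otimes> h"])
     (use assms in \<open>auto simp: m_assoc[symmetric]\<close>)

lemma l1_dist_translate:
  assumes "g \<in> carrier G"
  shows "l1_dist G (translate G g \<eta>) (translate G g \<theta>) = l1_dist G \<eta> \<theta>"
proof -
  have "l1_dist G (translate G g \<eta>) (translate G g \<theta>) =
        (\<Sum>\<^sub>\<infinity>h\<in>carrier G. \<bar>\<eta> (inv g \<otimes> h) - \<theta> (inv g \<otimes> h)\<bar>)"
    unfolding l1_dist_def l1_norm_def by (rule infsum_cong) (simp add: translate_def)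
  also have "\<dots> = l1_dist G \<eta> \<theta>"
    unfolding l1_dist_def l1_norm_def
    by (rule infsum_reindex_bij_betw[OF bij_betw_mult_left]) (use assms in simp)
  finally show ?thesis .
qed

lemma translate_translate:
  assumes "g \<in> carrier G" "h \<in> carrier G"
  shows "translate G g (translate G h \<eta>) = translate G (g \<otimes> h) \<eta>"
  using assms by (auto simp: translate_def fun_eq_iff inv_mult_group m_assoc)

lemma translate_one:
  assumes "\<And>h. h \<notin> carrier G \<Longrightarrow> \<eta> h = 0"
  shows "translate G \<one> \<eta> = \<eta>"
  using assms by (auto simp: translate_def fun_eq_iff)

end

section \<open>Fields of small average and of small uniform variation\<close>

text \<open>A minimax theorem in constructive form: the weights record the accumulated cost at each
  point, so the answer to the current weights must be cheap where the previous ones were expensive.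
  The total weight grows by at most the factor \<open>1 + \<epsilon>\<close> per round, while the
  weight at a point is at least exponential in half its accumulated cost; comparing the two after
  about \<open>ln (card A) / \<epsilon>\<close> rounds bounds the cost at every point.\<close>

lemma multiplicative_weights:
  fixes c :: "'s \<Rightarrow> 'a \<Rightarrow> real"
  assumes A: "finite A" and \<epsilon>: "\<epsilon> > 0"
    and c: "\<And>l x. l \<in> L \<Longrightarrow> x \<in> A \<Longrightarrow> 0 \<le> c l x \<and> c l x \<le> 1"
    and best: "\<And>w. (\<And>x. x \<in> A \<Longrightarrow> 0 < w x) \<Longrightarrow> \<exists>l\<in>L. (\<Sum>x\<in>A. w x * c l x) \<le> \<epsilon> * (\<Sum>x\<in>A. w x)"
  obtains T :: nat and l where "T > 0" "\<And>t. t < T \<Longrightarrow> l t \<in> L"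
    "\<And>x. x \<in> A \<Longrightarrow> (\<Sum>t<T. c (l t) x) \<le> 4 * \<epsilon> * real T"
proof -
  obtain pick where pick: "\<And>w. (\<And>x. x \<in> A \<Longrightarrow> 0 < w x) \<Longrightarrow>
      pick w \<in> L \<and> (\<Sum>x\<in>A. w x * c (pick w) x) \<le> \<epsilon> * (\<Sum>x\<in>A. w x)"
    using best by metis
  define W where "W = rec_nat (\<lambda>_. 1) (\<lambda>_ w x. w x * (1 + c (pick w) x))"
  have W0: "W 0 = (\<lambda>_. 1)" and WS: "\<And>t. W (Suc t) = (\<lambda>x. W t x * (1 + c (pick (W t)) x))"
    by (simp_all add: W_def)
  have pos: "\<forall>x\<in>A. 0 < W t x" for t
  proof (induction t)
    case (Suc t)
    then have "pick (W t) \<in> L" using pick by blast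
    then have "0 < 1 + c (pick (W t)) x" if "x \<in> A" for x using c[OF _ that] by force
    then show ?case using Suc by (simp add: WS)
  qed (simp add: W0)
  define l where "l = (\<lambda>t. pick (W t))"
  have l: "l t \<in> L" "(\<Sum>x\<in>A. W t x * c (l t) x) \<le> \<epsilon> * (\<Sum>x\<in>A. W t x)" for t
    unfolding l_def using pick pos by blast+
  have total: "(\<Sum>x\<in>A. W t x) \<le> real (card A) * exp (\<epsilon> * real t)" for t
  proof (induction t)
    case (Suc t)
    have "(\<Sum>x\<in>A. W (Suc t) x) = (\<Sum>x\<in>A. W t x) + (\<Sum>x\<in>A. W t x * c (l t) x)"
      by (simp add: WS l_def algebra_simps sum.distrib)
    also have "\<dots> \<le> (\<Sum>x\<in>A. W t x) * (1 + \<epsilon>)"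
      using l(2)[of t] by (simp add: algebra_simps)
    also have "\<dots> \<le> (\<Sum>x\<in>A. W t x) * exp \<epsilon>"
      by (rule mult_left_mono) (use pos in \<open>auto intro!: sum_nonneg simp: less_imp_le\<close>)
    also have "\<dots> \<le> real (card A) * exp (\<epsilon> * real t) * exp \<epsilon>"
      using Suc by (intro mult_right_mono) auto
    finally show ?case by (simp add: algebra_simps exp_add)
  qed (simp add: W0)
  have lower: "exp ((\<Sum>i<t. c (l i) x) / 2) \<le> W t x" if x: "x \<in> A" for t x
  proof (induction t)
    case (Suc t)
    \<comment> \<open>This is where costs have to be at most 1: the factor 1/2 in the exponent makes
      the exponential stay below the linear update.\<close>
    have b: "exp (c (l t) x / 2) \<le> 1 + c (l t) x"
    proof -
      have c1: "0 \<le> c (l t) x" "c (l t) x \<le> 1" using c[OF l(1) x] by auto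
      have "exp (c (l t) x / 2) \<le> 1 + c (l t) x / 2 + (c (l t) x / 2)\<^sup>2"
        by (rule exp_bound) (use c1 in auto)
      also have "(c (l t) x / 2)\<^sup>2 \<le> c (l t) x / 2"
        using c1 by (simp add: power2_eq_square field_simps) (smt (verit) mult_left_le)
      finally show ?thesis by simp
    qed
    have "exp ((\<Sum>i<Suc t. c (l i) x) / 2) = exp ((\<Sum>i<t. c (l i) x) / 2) * exp (c (l t) x / 2)"
      by (simp add: exp_add[symmetric] add_divide_distrib)
    also have "\<dots> \<le> W t x * (1 + c (l t) x)"
      using Suc b pos x by (intro mult_mono) (auto simp: less_imp_le)
    finally show ?case by (simp add: WS l_def)
  qed (simp add: W0)
  \<comment> \<open>Both terms in the exponent are then at most \<open>\<epsilon> * T\<close>, and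
    undoing the factor 1/2 gives the constant 4. The \<open>+ 1\<close> keeps the argument of the
    logarithm positive for empty \<open>A\<close>.\<close>
  obtain T :: nat where T: "T > 0" "ln (real (card A) + 1) \<le> \<epsilon> * real T"
  proof -
    obtain n :: nat where n: "ln (real (card A) + 1) / \<epsilon> < real n"
      using reals_Archimedean2 by blast
    have "ln (real (card A) + 1) \<le> \<epsilon> * real (Suc n)"
      using n \<epsilon> by (simp add: field_simps)
    then show ?thesis using that[of "Suc n"] by simp
  qed
  have "(\<Sum>t<T. c (l t) x) \<le> 4 * \<epsilon> * real T" if x: "x \<in> A" for x
  proof -
    have "exp ((\<Sum>i<T. c (l i) x) / 2) \<le> W T x" by (rule lower[OF x])
    also have "\<dots> \<le> (\<Sum>x\<in>A. W T x)"
      by (rule member_le_sum) (use x A pos in \<open>auto simp: less_imp_le\<close>)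
    also have "\<dots> \<le> (real (card A) + 1) * exp (\<epsilon> * real T)"
      using total[of T] by (smt (verit) exp_gt_zero mult_right_mono)
    also have "\<dots> = exp (ln (real (card A) + 1) + \<epsilon> * real T)"
      by (simp add: exp_add)
    finally have "(\<Sum>i<T. c (l i) x) / 2 \<le> ln (real (card A) + 1) + \<epsilon> * real T" by simp
    then show ?thesis using T by simp
  qed
  then show ?thesis using that[of T l] T l(1) by blast
qed

section \<open>Cutting the integers into bands\<close>

lemma dvd_if_div_pred_neq:
  fixes m J :: int
  assumes "J > 0" "(m - 1) div J \<noteq> m div J"
  shows "J dvd m"
proof (rule ccontr)
  assume "\<not> J dvd m"
  then have "m mod J \<noteq> 0" by (simp add: dvd_eq_mod_eq_0)
  moreover have "0 \<le> m mod J" by (rule pos_mod_sign[OF assms(1)])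
  moreover have "m mod J < J" by (rule pos_mod_bound[OF assms(1)])
  moreover have "m - 1 = J * (m div J) + (m mod J - 1)"
    using mult_div_mod_eq[of J m] by (simp only: algebra_simps)
  ultimately have "(m - 1) div J = m div J"
    by (intro int_div_pos_eq[where r = "m mod J - 1"]) simp_all
  with assms(2) show False by simp
qed

text \<open>A band boundary falls between \<open>a\<close> and \<open>b\<close> only if the larger
  of them plus \<open>j\<close> is a multiple of \<open>J\<close>, and this determines
  \<open>j\<close> modulo \<open>J\<close>.\<close>

lemma div_shift_neq_count:
  fixes a b :: int
  assumes "\<bar>a - b\<bar> \<le> 1" "J > 0"
  shows "(\<Sum>j<J. if (a + int j) div int J \<noteq> (b + int j) div int J then 1 else 0 :: real) \<le> 1"
proof -
  define D where "D = {j\<in>{..<J}. (a + int j) div int J \<noteq> (b + int j) div int J}"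
  define M where "M = max a b"
  have dvd: "int J dvd M + int j" if "j \<in> D" for j
  proof (rule dvd_if_div_pred_neq)
    consider "a = b" | "b = M" "a = M - 1" | "a = M" "b = M - 1" using assms(1) unfolding M_def by linarith
    then show "(M + int j - 1) div int J \<noteq> (M + int j) div int J"
      by cases (use that in \<open>auto simp: D_def algebra_simps\<close>)
  qed (use assms(2) in simp)
  have "i = j" if "i \<in> D" "j \<in> D" for i j
  proof (rule ccontr)
    assume "i \<noteq> j"
    have "int J dvd int i - int j"
      using dvd_diff[OF dvd[OF that(1)] dvd[OF that(2)]] by simp
    then have "\<bar>int J\<bar> \<le> \<bar>int i - int j\<bar>"
      by (rule dvd_imp_le_int[rotated]) (use \<open>i \<noteq> j\<close> in simp)
    then show False using that by (auto simp: D_def)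
  qed
  then have "card D \<le> Suc 0"
    by (subst card_le_Suc0_iff_eq) (auto simp: D_def)
  then show ?thesis by (simp add: sum.inter_filter[symmetric] D_def)
qed

section \<open>Fields on a group and their variation\<close>

context group
begin

text \<open>The support condition reads \<open>h \<in> x K\<close>; stated through
  \<open>inv x \<otimes> h\<close> it is visibly invariant under left translation. Values at
  \<open>x\<close> outside the carrier are left free, hence \<open>prob_fields_cong\<close>.\<close>

definition prob_fields :: "'a set \<Rightarrow> ('a \<Rightarrow> 'a \<Rightarrow> real) set" where
  "prob_fields K = {\<xi>. \<forall>x\<in>carrier G. \<xi> x \<in> Prob G \<and> (\<forall>h\<in>carrier G. \<xi> x h \<noteq> 0 \<longrightarrow> inv x \<otimes> h \<in> K)}"

lemma prob_fieldsD:
  assumes "\<xi> \<in> prob_fields K" "x \<in> carrier G"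
  shows "\<xi> x \<in> Prob G" "\<And>h. h \<in> carrier G \<Longrightarrow> \<xi> x h \<noteq> 0 \<Longrightarrow> inv x \<otimes> h \<in> K"
  using assms by (auto simp: prob_fields_def)

lemma prob_fields_mono: "K \<subseteq> K' \<Longrightarrow> prob_fields K \<subseteq> prob_fields K'"
  by (auto simp: prob_fields_def)

lemma prob_fields_nonempty:
  assumes "\<one> \<in> K"
  shows "(\<lambda>x h. if h = x then 1 else 0) \<in> prob_fields K"
  unfolding prob_fields_def
proof safe
  fix x assume x: "x \<in> carrier G"
  show "(\<lambda>h. if h = x then 1 else 0) \<in> Prob G"
    by (rule Prob_finiteI[of "{x}"]) (use x in auto)
qed (use assms in \<open>auto split: if_splits\<close>)

lemma prob_fields_average:
  assumes "T > 0" "\<And>t. t < T \<Longrightarrow> \<xi> t \<in> prob_fields K"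
  shows "(\<lambda>x h. (\<Sum>t<T. \<xi> t x h) / real T) \<in> prob_fields K"
  unfolding prob_fields_def
proof safe
  fix x assume x: "x \<in> carrier G"
  show "(\<lambda>h. (\<Sum>t<T. \<xi> t x h) / real T) \<in> Prob G"
    by (rule Prob_average) (use assms x prob_fieldsD in auto)
  fix h assume h: "h \<in> carrier G" "(\<Sum>t<T. \<xi> t x h) / real T \<noteq> 0"
  then obtain t where "t < T" "\<xi> t x h \<noteq> 0"
    by (metis (no_types, lifting) div_0 lessThan_iff sum.neutral)
  then show "inv x \<otimes> h \<in> K" using assms x h prob_fieldsD by blast
qed

text \<open>Neighbours are taken on the right, so that left translation, which acts on the fields,
  preserves this cost.\<close>

definition site_cost :: "'a set \<Rightarrow> ('a \<Rightarrow> 'a \<Rightarrow> real) \<Rightarrow> 'a \<Rightarrow> real" where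
  "site_cost S \<xi> x = (\<Sum>s\<in>S. l1_dist G (\<xi> x) (\<xi> (x \<otimes> s)))"

lemma site_cost_bounds:
  assumes "\<xi> \<in> prob_fields K" "x \<in> carrier G" "S \<subseteq> carrier G"
  shows "0 \<le> site_cost S \<xi> x" "site_cost S \<xi> x \<le> 2 * real (card S)"
proof -
  show "0 \<le> site_cost S \<xi> x"
    unfolding site_cost_def by (intro sum_nonneg l1_dist_nonneg)
  have "site_cost S \<xi> x \<le> (\<Sum>s\<in>S. 2)"
    unfolding site_cost_def
    by (intro sum_mono l1_dist_le_2 prob_fieldsD[OF assms(1)]) (use assms in auto)
  then show "site_cost S \<xi> x \<le> 2 * real (card S)" by simp
qed

text \<open>Pairs leaving \<open>A\<close> are ignored. Failure for one \<open>A\<close> therefore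
  means that every field varies along pairs inside \<open>A\<close>, the only pairs that a packing
  by translates of \<open>A\<close> can see. The price is the gluing in
  \<open>averaged_imp_weighted\<close>.\<close>

definition averaged_bound :: "'a set \<Rightarrow> real \<Rightarrow> 'a set \<Rightarrow> bool" where
  "averaged_bound S \<epsilon> K \<longleftrightarrow> (\<forall>A. finite A \<longrightarrow> A \<subseteq> carrier G \<longrightarrow>
     (\<exists>\<xi>\<in>prob_fields K. (\<Sum>x\<in>A. site_cost {s\<in>S. x \<otimes> s \<in> A} \<xi> x) \<le> \<epsilon> * real (card A)))"

text \<open>In contrast to \<open>averaged_bound\<close>, pairs leaving \<open>A\<close> count. One
  \<open>K\<close> serves all finite \<open>A\<close>, which is what compactness needs to reach the
  whole group.\<close>

definition uniform_bound :: "'a set \<Rightarrow> real \<Rightarrow> 'a set \<Rightarrow> bool" where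
  "uniform_bound S \<epsilon> K \<longleftrightarrow> (\<forall>A. finite A \<longrightarrow> A \<subseteq> carrier G \<longrightarrow>
     (\<exists>\<xi>\<in>prob_fields K. \<forall>x\<in>A. site_cost S \<xi> x \<le> \<epsilon>))"

text \<open>\<open>\<mu>\<close> is the sum of the \<open>n\<close>-fold convolutions of \<open>w\<close> by \<open>S\<close>, damped by the factor
  \<open>(2 * card S) ^ n\<close>.\<close>

lemma smoothed_weight:
  fixes w :: "'a \<Rightarrow> real"
  assumes S: "finite S" "S \<subseteq> carrier G" "S \<noteq> {}" "\<And>s. s \<in> S \<Longrightarrow> inv s \<in> S"
    and w: "\<And>x. 0 \<le> w x" "\<And>B. finite B \<Longrightarrow> B \<subseteq> carrier G \<Longrightarrow> (\<Sum>x\<in>B. w x) \<le> W"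
  obtains \<mu> :: "'a \<Rightarrow> real" where
    "\<And>x. x \<in> carrier G \<Longrightarrow> w x \<le> \<mu> x"
    "\<And>x s. x \<in> carrier G \<Longrightarrow> s \<in> S \<Longrightarrow> \<mu> (x \<otimes> s) \<le> 2 * real (card S) * \<mu> x"
    "\<And>B. finite B \<Longrightarrow> B \<subseteq> carrier G \<Longrightarrow> (\<Sum>x\<in>B. \<mu> x) \<le> 2 * W"
proof -
  define N where "N = real (card S)"
  have N: "N \<ge> 1" using S by (simp add: N_def card_gt_0_iff Suc_leI)
  define P where "P = (\<lambda>(f :: 'a \<Rightarrow> real) x. \<Sum>s\<in>S. f (x \<otimes> s))"
  define p where "p = (\<lambda>n. (P ^^ n) w)"
  have p0: "p 0 = w" and pS: "p (Suc n) = P (p n)" for n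
    by (simp_all add: p_def)
  have pnn: "0 \<le> p n x" for n x
    by (induction n arbitrary: x) (auto simp: p0 pS P_def w intro!: sum_nonneg)
  have psum: "(\<Sum>x\<in>B. p n x) \<le> N ^ n * W" if "finite B" "B \<subseteq> carrier G" for n B
    using that
  proof (induction n arbitrary: B)
    case (Suc n)
    have "(\<Sum>x\<in>B. p (Suc n) x) = (\<Sum>s\<in>S. \<Sum>x\<in>B. p n (x \<otimes> s))"
      unfolding pS P_def by (rule sum.swap)
    also have "\<dots> \<le> (\<Sum>s\<in>S. N ^ n * W)"
    proof (rule sum_mono)
      fix s assume s: "s \<in> S"
      have "inj_on (\<lambda>x. x \<otimes> s) B"
        using s S Suc.prems by (intro inj_onI) (metis right_cancel subsetD)
      then have "(\<Sum>x\<in>B. p n (x \<otimes> s)) = (\<Sum>y\<in>(\<lambda>x. x \<otimes> s) ` B. p n y)"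
        by (simp add: sum.reindex)
      also have "\<dots> \<le> N ^ n * W"
        by (rule Suc.IH) (use s S Suc.prems in auto)
      finally show "(\<Sum>x\<in>B. p n (x \<otimes> s)) \<le> N ^ n * W" .
    qed
    finally show ?case by (simp add: N_def algebra_simps)
  qed (simp add: p0 w)
  have W: "0 \<le> W" using w(2)[of "{}"] by simp
  \<comment> \<open>With this damping the \<open>n\<close>-th term has mass at most
    \<open>W / 2 ^ n\<close>, which gives the total \<open>2 * W\<close>, and raising the index by
    one costs the factor \<open>2 * N\<close>.\<close>
  define a where "a = (\<lambda>n x. p n x / (2 * N) ^ n)"
  have a0: "0 \<le> a n x" for n x using pnn N by (simp add: a_def)
  have asum: "(\<Sum>x\<in>B. a n x) \<le> W * (1 / 2) ^ n" if "finite B" "B \<subseteq> carrier G" for n B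
  proof -
    have "(\<Sum>x\<in>B. a n x) = (\<Sum>x\<in>B. p n x) / (2 * N) ^ n"
      by (simp add: a_def sum_divide_distrib)
    also have "\<dots> \<le> N ^ n * W / (2 * N) ^ n"
      by (rule divide_right_mono[OF psum[OF that]]) (use N in simp)
    also have "\<dots> = W * (1 / 2) ^ n" using N by (simp add: power_mult_distrib power_divide field_simps)
    finally show ?thesis .
  qed
  have sm: "summable (\<lambda>n. a n x)" if "x \<in> carrier G" for x
  proof (rule summable_comparison_test')
    show "summable (\<lambda>n. W * (1 / 2) ^ n)" by (intro summable_mult summable_geometric) simp
    show "norm (a n x) \<le> W * (1 / 2) ^ n" for n
      using asum[of "{x}" n] that a0[of n x] by simp
  qed
  have smS: "summable (\<lambda>n. a (Suc n) x)" if "x \<in> carrier G" for x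
    using summable_ignore_initial_segment[OF sm[OF that], of 1] by simp
  define \<mu> where "\<mu> = (\<lambda>x. \<Sum>n. a n x)"
  show ?thesis
  proof (rule that[of \<mu>])
    fix x assume x: "x \<in> carrier G"
    have "(\<Sum>n\<in>{0}. a n x) \<le> \<mu> x"
      unfolding \<mu>_def by (rule sum_le_suminf[OF sm[OF x]]) (auto simp: a0)
    then show "w x \<le> \<mu> x" by (simp add: a_def p0)
    fix s assume s: "s \<in> S"
    have xs: "x \<otimes> s \<in> carrier G" using x s S by auto
    have "a n (x \<otimes> s) \<le> 2 * N * a (Suc n) x" for n
    proof -
      have "p n (x \<otimes> s) \<le> p (Suc n) x"
        unfolding pS P_def by (rule member_le_sum) (use s S pnn in auto)
      then have "a n (x \<otimes> s) \<le> p (Suc n) x / (2 * N) ^ n"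
        unfolding a_def by (rule divide_right_mono) (use N in simp)
      also have "\<dots> = 2 * N * a (Suc n) x" using N by (simp add: a_def)
      finally show ?thesis .
    qed
    then have "\<mu> (x \<otimes> s) \<le> (\<Sum>n. 2 * N * a (Suc n) x)"
      unfolding \<mu>_def
      by (intro suminf_le sm[OF xs] summable_mult smS[OF x])
    also have "\<dots> = 2 * N * (\<Sum>n. a (Suc n) x)"
      by (rule suminf_mult[OF smS[OF x]])
    also have "(\<Sum>n. a (Suc n) x) \<le> \<mu> x"
      unfolding \<mu>_def using suminf_split_head[OF sm[OF x]] a0[of 0 x] by simp
    finally show "\<mu> (x \<otimes> s) \<le> 2 * real (card S) * \<mu> x"
      using N by (simp add: N_def)
  next
    fix B assume B: "finite B" "B \<subseteq> carrier G"
    have "(\<Sum>x\<in>B. \<mu> x) = (\<Sum>n. \<Sum>x\<in>B. a n x)"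
      unfolding \<mu>_def by (rule suminf_sum[symmetric]) (use B sm in auto)
    also have "\<dots> \<le> (\<Sum>n. W * (1 / 2) ^ n)"
      by (intro suminf_le asum B summable_sum sm summable_mult summable_geometric) (use B in auto)
    also have "\<dots> = 2 * W"
      by (subst suminf_mult) (auto simp: suminf_geometric intro: summable_geometric)
    finally show "(\<Sum>x\<in>B. \<mu> x) \<le> 2 * W" .
  qed
qed


text \<open>The smoothed weight \<open>\<mu>\<close> changes by a factor of at most \<open>q\<close> along \<open>S\<close>, so its logarithmic level
  \<open>lev\<close> changes by at most 1. Grouping \<open>J\<close> consecutive levels into a band, some offset \<open>j\<close> separates
  few neighbours; within a band \<open>\<mu>\<close> is constant up to the factor \<open>q ^ J\<close> and the unweighted bound
  applies.\<close>

lemma averaged_imp_weighted: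
  assumes S: "finite S" "S \<subseteq> carrier G" "S \<noteq> {}" "\<And>s. s \<in> S \<Longrightarrow> inv s \<in> S"
    and avg: "\<And>\<epsilon>. \<epsilon> > 0 \<Longrightarrow> \<exists>K. finite K \<and> K \<subseteq> carrier G \<and> averaged_bound S \<epsilon> K"
    and "\<epsilon> > 0"
  shows "\<exists>K. finite K \<and> K \<subseteq> carrier G \<and>
    (\<forall>A w. finite A \<longrightarrow> A \<subseteq> carrier G \<longrightarrow> (\<forall>x\<in>A. 0 < (w x :: real)) \<longrightarrow>
       (\<exists>\<xi>\<in>prob_fields K. (\<Sum>x\<in>A. w x * site_cost S \<xi> x) \<le> \<epsilon> * (\<Sum>x\<in>A. w x)))"
proof -
  define N where "N = real (card S)"
  have N: "N \<ge> 1" using S by (simp add: N_def card_gt_0_iff Suc_leI)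
  define q where "q = 2 * N"
  have q: "q > 1" using N by (simp add: q_def)
  \<comment> \<open>A good offset cuts pairs of weight at most \<open>N * W / J\<close>, and a cut
    pair costs at most 2; this \<open>J\<close> makes their share at most
    \<open>\<epsilon> / 2\<close>.\<close>
  obtain J :: nat where J: "J > 0" "4 * N \<le> \<epsilon> * real J"
  proof -
    obtain n :: nat where n: "4 * N / \<epsilon> < real n" using reals_Archimedean2 by blast
    have "4 * N \<le> \<epsilon> * real (Suc n)" using n \<open>\<epsilon> > 0\<close> by (simp add: field_simps)
    then show ?thesis using that[of "Suc n"] by simp
  qed
  \<comment> \<open>Inside a band \<open>\<mu>\<close> varies by at most the factor
    \<open>q ^ J\<close>, and its total mass is at most \<open>2 * W\<close>: the bands contribute
    \<open>q ^ J * \<epsilon>' * 2 * W\<close>, which is \<open>\<epsilon> / 2 * W\<close>.\<close>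
  define \<epsilon>' where "\<epsilon>' = \<epsilon> / (4 * q ^ J)"
  have \<epsilon>': "\<epsilon>' > 0" using \<open>\<epsilon> > 0\<close> q by (simp add: \<epsilon>'_def)
  obtain K where K: "finite K" "K \<subseteq> carrier G" "averaged_bound S \<epsilon>' K"
    using avg[OF \<epsilon>'] by blast
  have "\<exists>\<xi>\<in>prob_fields K. (\<Sum>x\<in>A. w x * site_cost S \<xi> x) \<le> \<epsilon> * (\<Sum>x\<in>A. w x)"
    if A: "finite A" "A \<subseteq> carrier G" and w: "\<forall>x\<in>A. 0 < w x" for A and w :: "'a \<Rightarrow> real"
  proof -
    define W where "W = (\<Sum>x\<in>A. w x)"
    \<comment> \<open>The weight is extended by 0 and then spread by smoothing beyond
      \<open>A\<close>; the bands below are level sets of \<open>\<mu>\<close> in the whole group,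
      not only in \<open>A\<close>.\<close>
    obtain \<mu> :: "'a \<Rightarrow> real" where
      \<mu>_ge: "\<And>x. x \<in> carrier G \<Longrightarrow> (if x \<in> A then w x else 0) \<le> \<mu> x" and
      \<mu>_mult: "\<And>x s. x \<in> carrier G \<Longrightarrow> s \<in> S \<Longrightarrow> \<mu> (x \<otimes> s) \<le> 2 * real (card S) * \<mu> x" and
      \<mu>_sum: "\<And>B. finite B \<Longrightarrow> B \<subseteq> carrier G \<Longrightarrow> (\<Sum>x\<in>B. \<mu> x) \<le> 2 * W"
    proof (rule smoothed_weight[OF S, of "\<lambda>x. if x \<in> A then w x else 0" W])
      fix B :: "'a set" assume B: "finite B"
      have "(\<Sum>x\<in>B. if x \<in> A then w x else 0) = (\<Sum>x\<in>B \<inter> A. w x)"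
        by (rule sum.inter_restrict[OF B, symmetric])
      also have "\<dots> \<le> W" unfolding W_def
        by (rule sum_mono2) (use A w in \<open>auto simp: less_imp_le\<close>)
      finally show "(\<Sum>x\<in>B. if x \<in> A then w x else 0) \<le> W" .
    qed (use w in \<open>auto simp: less_imp_le\<close>)
    have \<mu>0: "0 \<le> \<mu> x" if "x \<in> carrier G" for x
      using \<mu>_ge[OF that] w by (cases "x \<in> A") (auto intro: order_trans[OF less_imp_le])
    have \<mu>A: "w x \<le> \<mu> x" "0 < \<mu> x" if "x \<in> A" for x
      using \<mu>_ge[of x] w A that by (force+)
    define lev where "lev = (\<lambda>x. \<lfloor>log q (\<mu> x)\<rfloor>)"
    \<comment> \<open>Closure of \<open>S\<close> under inverses turns the one-sided estimate of
      \<open>smoothed_weight\<close> into a two-sided one.\<close>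
    have ratio: "0 < \<mu> (x \<otimes> s) \<and> \<bar>lev x - lev (x \<otimes> s)\<bar> \<le> 1" if x: "x \<in> carrier G" "0 < \<mu> x" and s: "s \<in> S" for x s
    proof -
      have xs: "x \<otimes> s \<in> carrier G" "inv s \<in> S" using x s S by auto
      have 1: "\<mu> (x \<otimes> s) \<le> q * \<mu> x" using \<mu>_mult[OF x(1) s] by (simp add: q_def N_def)
      have "(x \<otimes> s) \<otimes> inv s = x" using x s S by (simp add: m_assoc subsetD)
      then have 2: "\<mu> x \<le> q * \<mu> (x \<otimes> s)" using \<mu>_mult[OF xs] by (simp add: q_def N_def)
      have pos: "0 < \<mu> (x \<otimes> s)"
        using 2 x(2) q by (smt (verit) mult_nonneg_nonpos)
      have "log q (\<mu> (x \<otimes> s)) \<le> log q (q * \<mu> x)" "log q (\<mu> x) \<le> log q (q * \<mu> (x \<otimes> s))"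
        using 1 2 pos x(2) q by simp_all
      then have "log q (\<mu> (x \<otimes> s)) \<le> 1 + log q (\<mu> x)" "log q (\<mu> x) \<le> 1 + log q (\<mu> (x \<otimes> s))"
        using q pos x(2) by (simp_all add: log_mult)
      then have "\<bar>lev x - lev (x \<otimes> s)\<bar> \<le> 1" unfolding lev_def by linarith
      then show ?thesis using pos by blast
    qed
    define b where "b = (\<lambda>j x. (lev x + int j) div int J)"
    define F where "F = (\<lambda>j k. {x\<in>carrier G. 0 < \<mu> x \<and> b j x = k})"
    \<comment> \<open>The lower end of band \<open>k\<close>: there \<open>lev x + j\<close> lies
      between \<open>k * J\<close> and \<open>k * J + J - 1\<close>, hence \<open>\<mu> x\<close>
      between \<open>c j k\<close> and \<open>q ^ J\<close> times it.\<close>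
    define c where "c = (\<lambda>j k. q powr (real_of_int k * real J - real j))"
    have c0: "c j k > 0" for j k using q by (simp add: c_def)
    have F_bounds: "c j k \<le> \<mu> x" "\<mu> x \<le> c j k * q ^ J" if x: "x \<in> F j k" for j k x
    proof -
      have \<mu>x: "0 < \<mu> x" and k: "b j x = k" using x by (auto simp: F_def)
      define r where "r = (lev x + int j) mod int J"
      have r: "0 \<le> r" "r < int J" using J by (simp_all add: r_def)
      have "lev x + int j = int J * k + r" unfolding r_def k[symmetric] b_def by simp
      then have *: "real_of_int (lev x) = real J * real_of_int k + real_of_int r - real j"
        by (metis add_diff_cancel_right' of_int_add of_int_mult of_int_of_nat_eq)
      have "real_of_int k * real J - real j \<le> log q (\<mu> x)"
        using * r(1) by (simp add: lev_def algebra_simps) linarith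
      then show "c j k \<le> \<mu> x"
        unfolding c_def using q \<mu>x by (simp add: le_log_iff)
      have "log q (\<mu> x) \<le> real_of_int (lev x) + 1" by (simp add: lev_def)
      also have "\<dots> \<le> (real_of_int k * real J - real j) + real J"
        using * r(2) by (simp add: algebra_simps)
      finally have "\<mu> x \<le> q powr ((real_of_int k * real J - real j) + real J)"
        using q \<mu>x by (simp add: log_le_iff)
      then show "\<mu> x \<le> c j k * q ^ J"
        using q by (simp add: c_def powr_add powr_realpow)
    qed
    have F_carrier: "F j k \<subseteq> carrier G" for j k by (auto simp: F_def)
    \<comment> \<open>Markov's inequality: every point of the band carries mass at least
      \<open>c j k\<close>, and the total mass is bounded.\<close>
    have F_fin: "finite (F j k)" for j k
    proof (rule ccontr)
      assume inf: "infinite (F j k)"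
      obtain n :: nat where n: "2 * W / c j k < real n" using reals_Archimedean2 by blast
      obtain B where B: "B \<subseteq> F j k" "finite B" "card B = n"
        using infinite_arbitrarily_large[OF inf, of n] by blast
      have "real n * c j k = (\<Sum>x\<in>B. c j k)" using B by simp
      also have "\<dots> \<le> (\<Sum>x\<in>B. \<mu> x)" by (rule sum_mono) (use B F_bounds in auto)
      also have "\<dots> \<le> 2 * W" by (rule \<mu>_sum) (use B F_carrier in auto)
      finally show False using n c0[of j k] by (simp add: field_simps)
    qed
    define good where "good = (\<lambda>j k \<xi>. \<xi> \<in> prob_fields K \<and>
        (\<Sum>x\<in>F j k. site_cost {s\<in>S. x \<otimes> s \<in> F j k} \<xi> x) \<le> \<epsilon>' * real (card (F j k)))"
    have "\<exists>\<xi>. good j k \<xi>" for j k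
      using K(3)[unfolded averaged_bound_def, rule_format, OF F_fin F_carrier] by (auto simp: good_def)
    then obtain \<xi>' where "\<And>j k. good j k (\<xi>' j k)" by metis
    then have \<xi>'_field: "\<And>j k. \<xi>' j k \<in> prob_fields K" and
      \<xi>'_cost: "\<And>j k. (\<Sum>x\<in>F j k. site_cost {s\<in>S. x \<otimes> s \<in> F j k} (\<xi>' j k) x) \<le> \<epsilon>' * real (card (F j k))"
      by (simp_all add: good_def)
    \<comment> \<open>The weight of the pairs separated by offset \<open>j\<close>. Each pair is
      separated by at most one offset, so the sum over all offsets is at most \<open>N * W\<close>,
      and some offset is no worse than the average.\<close>
    define cut where "cut = (\<lambda>j. \<Sum>x\<in>A. w x * (\<Sum>s\<in>S. if b j x \<noteq> b j (x \<otimes> s) then 1 else 0))"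
    have "(\<Sum>j<J. cut j) = (\<Sum>x\<in>A. \<Sum>j<J. w x * (\<Sum>s\<in>S. if b j x \<noteq> b j (x \<otimes> s) then 1 else 0))"
      unfolding cut_def by (rule sum.swap)
    also have "\<dots> = (\<Sum>x\<in>A. w x * (\<Sum>j<J. \<Sum>s\<in>S. if b j x \<noteq> b j (x \<otimes> s) then 1 else 0))"
      by (simp only: sum_distrib_left)
    also have "\<dots> = (\<Sum>x\<in>A. w x * (\<Sum>s\<in>S. \<Sum>j<J. if b j x \<noteq> b j (x \<otimes> s) then 1 else 0))"
      by (intro sum.cong refl arg_cong2[where f = "(*)"] sum.swap)
    also have "\<dots> \<le> (\<Sum>x\<in>A. w x * (\<Sum>s\<in>S. 1))"
    proof (intro sum_mono mult_left_mono)
      fix x s assume xs: "x \<in> A" "s \<in> S"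
      then have "\<bar>lev x - lev (x \<otimes> s)\<bar> \<le> 1" using ratio[of x s] A \<mu>A by blast
      then show "(\<Sum>j<J. if b j x \<noteq> b j (x \<otimes> s) then 1 else 0 :: real) \<le> 1"
        unfolding b_def by (rule div_shift_neq_count) (rule J)
    qed (use w in \<open>auto simp: less_imp_le\<close>)
    also have "\<dots> = N * W" by (simp add: N_def W_def sum_distrib_right mult.commute[of "real (card S)"])
    finally have cuts: "(\<Sum>j<J. cut j) \<le> N * W" .
    obtain j where j: "j < J" "cut j \<le> N * W / real J"
    proof (rule ccontr)
      assume "\<not> thesis"
      then have "N * W / real J < cut j" if "j < J" for j using that \<open>\<And>j. j < J \<Longrightarrow> cut j \<le> N * W / real J \<Longrightarrow> thesis\<close>
        by (meson not_le)
      then have "(\<Sum>j<J. N * W / real J) < (\<Sum>j<J. cut j)"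
        using J by (intro sum_strict_mono) auto
      then show False using cuts J by simp
    qed
    have W0: "0 \<le> W" unfolding W_def using w by (auto intro!: sum_nonneg simp: less_imp_le)
    have cut_le: "2 * cut j \<le> \<epsilon> / 2 * W"
    proof -
      have "2 * cut j * real J \<le> 2 * N * W" using j J by (simp add: field_simps)
      also have "\<dots> \<le> (\<epsilon> * real J / 2) * W" using J W0 by (intro mult_right_mono) auto
      finally have "2 * cut j * real J \<le> (\<epsilon> / 2 * W) * real J" by (simp add: algebra_simps)
      then show ?thesis using J by simp
    qed
    \<comment> \<open>Gluing along the bands: neighbours in different bands use unrelated fields,
      which is harmless because these pairs are counted by \<open>cut j\<close>.\<close>
    define \<xi> where "\<xi> = (\<lambda>x. \<xi>' j (b j x) x)"
    have \<xi>: "\<xi> \<in> prob_fields K"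
      using \<xi>'_field by (auto simp: prob_fields_def \<xi>_def)
    define inner where "inner = (\<lambda>x. site_cost {s\<in>S. x \<otimes> s \<in> F j (b j x)} (\<xi>' j (b j x)) x)"
    have inner0: "0 \<le> inner x" for x
      unfolding inner_def site_cost_def by (intro sum_nonneg l1_dist_nonneg)
    have site: "site_cost S \<xi> x \<le> 2 * (\<Sum>s\<in>S. if b j x \<noteq> b j (x \<otimes> s) then 1 else 0) + inner x"
      if x: "x \<in> A" for x
    proof -
      have xc: "x \<in> carrier G" "0 < \<mu> x" using x A \<mu>A by auto
      have "site_cost S \<xi> x \<le> (\<Sum>s\<in>S. 2 * (if b j x \<noteq> b j (x \<otimes> s) then 1 else 0) +
          (if x \<otimes> s \<in> F j (b j x) then l1_dist G (\<xi>' j (b j x) x) (\<xi>' j (b j x) (x \<otimes> s)) else 0))"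
        unfolding site_cost_def
      proof (rule sum_mono)
        fix s assume s: "s \<in> S"
        have xs: "x \<otimes> s \<in> carrier G" "0 < \<mu> (x \<otimes> s)" using xc s S ratio by auto
        have "l1_dist G (\<xi> x) (\<xi> (x \<otimes> s)) \<le> 2"
          by (intro l1_dist_le_2 prob_fieldsD[OF \<xi>] xc xs)
        then show "l1_dist G (\<xi> x) (\<xi> (x \<otimes> s)) \<le> 2 * (if b j x \<noteq> b j (x \<otimes> s) then 1 else 0) +
          (if x \<otimes> s \<in> F j (b j x) then l1_dist G (\<xi>' j (b j x) x) (\<xi>' j (b j x) (x \<otimes> s)) else 0)"
          using xs by (auto simp: F_def \<xi>_def l1_dist_nonneg)
      qed
      also have "\<dots> = 2 * (\<Sum>s\<in>S. if b j x \<noteq> b j (x \<otimes> s) then 1 else 0) + inner x"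
        using S(1) by (simp add: sum.distrib sum_distrib_left inner_def site_cost_def sum.inter_filter)
      finally show ?thesis .
    qed
    \<comment> \<open>The averaged bound concerns whole bands, so the sum over \<open>A\<close> is
      first enlarged to all bands that meet \<open>A\<close>. This is affordable for
      \<open>\<mu>\<close>, whose mass outside \<open>A\<close> is controlled.\<close>
    have "(\<Sum>x\<in>A. \<mu> x * inner x) \<le> (\<Sum>x\<in>(\<Union>k\<in>b j ` A. F j k). \<mu> x * inner x)"
    proof (rule sum_mono2)
      show "A \<subseteq> (\<Union>k\<in>b j ` A. F j k)" using A \<mu>A by (auto simp: F_def)
    qed (use A F_fin in \<open>auto intro!: mult_nonneg_nonneg \<mu>0 inner0 dest: subsetD[OF F_carrier]\<close>)
    also have "\<dots> = (\<Sum>k\<in>b j ` A. \<Sum>x\<in>F j k. \<mu> x * inner x)"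
      by (rule sum.UNION_disjoint) (use A F_fin in \<open>auto simp: F_def\<close>)
    also have "\<dots> \<le> (\<Sum>k\<in>b j ` A. q ^ J * \<epsilon>' * (\<Sum>x\<in>F j k. \<mu> x))"
    proof (rule sum_mono)
      fix k
      have "(\<Sum>x\<in>F j k. \<mu> x * inner x) \<le> (\<Sum>x\<in>F j k. c j k * q ^ J * inner x)"
        by (intro sum_mono mult_right_mono F_bounds inner0)
      also have "\<dots> = c j k * q ^ J * (\<Sum>x\<in>F j k. inner x)" by (simp add: sum_distrib_left)
      also have "(\<Sum>x\<in>F j k. inner x) = (\<Sum>x\<in>F j k. site_cost {s\<in>S. x \<otimes> s \<in> F j k} (\<xi>' j k) x)"
        by (rule sum.cong) (auto simp: inner_def F_def)
      also have "c j k * q ^ J * \<dots> \<le> c j k * q ^ J * (\<epsilon>' * real (card (F j k)))"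
        using c0[of j k] q by (intro mult_left_mono \<xi>'_cost) auto
      also have "\<dots> = q ^ J * \<epsilon>' * (\<Sum>x\<in>F j k. c j k)" by simp
      also have "\<dots> \<le> q ^ J * \<epsilon>' * (\<Sum>x\<in>F j k. \<mu> x)"
        using q \<epsilon>' by (intro mult_left_mono sum_mono F_bounds) auto
      finally show "(\<Sum>x\<in>F j k. \<mu> x * inner x) \<le> q ^ J * \<epsilon>' * (\<Sum>x\<in>F j k. \<mu> x)" .
    qed
    also have "\<dots> = q ^ J * \<epsilon>' * (\<Sum>k\<in>b j ` A. \<Sum>x\<in>F j k. \<mu> x)"
      by (simp add: sum_distrib_left)
    also have "(\<Sum>k\<in>b j ` A. \<Sum>x\<in>F j k. \<mu> x) = (\<Sum>x\<in>(\<Union>k\<in>b j ` A. F j k). \<mu> x)"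
      by (rule sum.UNION_disjoint[symmetric]) (use A F_fin in \<open>auto simp: F_def\<close>)
    also have "q ^ J * \<epsilon>' * \<dots> \<le> q ^ J * \<epsilon>' * (2 * W)"
      using q \<epsilon>' A F_fin by (intro mult_left_mono \<mu>_sum) (auto dest: subsetD[OF F_carrier])
    also have "\<dots> = \<epsilon> / 2 * W" using q by (simp add: \<epsilon>'_def)
    finally have inner_le: "(\<Sum>x\<in>A. \<mu> x * inner x) \<le> \<epsilon> / 2 * W" .
    have "(\<Sum>x\<in>A. w x * site_cost S \<xi> x) \<le>
        (\<Sum>x\<in>A. 2 * (w x * (\<Sum>s\<in>S. if b j x \<noteq> b j (x \<otimes> s) then 1 else 0)) + \<mu> x * inner x)"
    proof (rule sum_mono)
      fix x assume x: "x \<in> A"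
      have "w x * site_cost S \<xi> x \<le> w x * (2 * (\<Sum>s\<in>S. if b j x \<noteq> b j (x \<otimes> s) then 1 else 0) + inner x)"
        using w x by (intro mult_left_mono site) (auto simp: less_imp_le)
      moreover have "w x * inner x \<le> \<mu> x * inner x"
        by (intro mult_right_mono \<mu>A x inner0)
      ultimately show "w x * site_cost S \<xi> x \<le>
          2 * (w x * (\<Sum>s\<in>S. if b j x \<noteq> b j (x \<otimes> s) then 1 else 0)) + \<mu> x * inner x"
        by (simp add: algebra_simps)
    qed
    also have "\<dots> = 2 * cut j + (\<Sum>x\<in>A. \<mu> x * inner x)"
      by (simp add: sum.distrib cut_def sum_distrib_left)
    also have "\<dots> \<le> \<epsilon> * W" using cut_le inner_le by simp
    finally show ?thesis using \<xi> unfolding W_def by blast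
  qed
  then show ?thesis using K by blast
qed

text \<open>Costs are divided by \<open>2 * N\<close> to lie in the unit interval; the weighted
  bound \<open>\<epsilon> / 4\<close> becomes \<open>\<epsilon> / (8 * N)\<close>, and the factor 4
  of \<open>multiplicative_weights\<close> restores \<open>\<epsilon>\<close>. Averaging the answers
  stays inside \<open>prob_fields K\<close> because \<open>K\<close> is fixed before
  \<open>A\<close> and the weights.\<close>

lemma averaged_imp_uniform:
  assumes S: "finite S" "S \<subseteq> carrier G" "S \<noteq> {}" "\<And>s. s \<in> S \<Longrightarrow> inv s \<in> S"
    and avg: "\<And>\<epsilon>. \<epsilon> > 0 \<Longrightarrow> \<exists>K. finite K \<and> K \<subseteq> carrier G \<and> averaged_bound S \<epsilon> K"
    and "\<epsilon> > 0"
  shows "\<exists>K. finite K \<and> K \<subseteq> carrier G \<and> uniform_bound S \<epsilon> K"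
proof -
  define N where "N = real (card S)"
  have N: "N \<ge> 1" using S by (simp add: N_def card_gt_0_iff Suc_leI)
  have "\<epsilon> / 4 > 0" using \<open>\<epsilon> > 0\<close> by simp
  from averaged_imp_weighted[OF S avg this] obtain K where
    K: "finite K" "K \<subseteq> carrier G" and
    weighted: "\<And>A w. finite A \<Longrightarrow> A \<subseteq> carrier G \<Longrightarrow> \<forall>x\<in>A. 0 < (w x :: real) \<Longrightarrow>
       \<exists>\<xi>\<in>prob_fields K. (\<Sum>x\<in>A. w x * site_cost S \<xi> x) \<le> \<epsilon> / 4 * (\<Sum>x\<in>A. w x)"
    by metis
  have "\<exists>\<xi>\<in>prob_fields K. \<forall>x\<in>A. site_cost S \<xi> x \<le> \<epsilon>" if A: "finite A" "A \<subseteq> carrier G" for A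
  proof -
    have 1: "0 < \<epsilon> / (8 * N)" using N \<open>\<epsilon> > 0\<close> by simp
    have 2: "0 \<le> site_cost S \<xi> x / (2 * N) \<and> site_cost S \<xi> x / (2 * N) \<le> 1"
      if "\<xi> \<in> prob_fields K" "x \<in> A" for \<xi> x
      using site_cost_bounds[of \<xi> K x S] that A S(2) N by (auto simp: N_def field_simps)
    have 3: "\<exists>\<xi>\<in>prob_fields K. (\<Sum>x\<in>A. w x * (site_cost S \<xi> x / (2 * N))) \<le> \<epsilon> / (8 * N) * (\<Sum>x\<in>A. w x)"
      if "\<And>x. x \<in> A \<Longrightarrow> 0 < w x" for w :: "'a \<Rightarrow> real"
    proof -
      obtain \<xi> where \<xi>: "\<xi> \<in> prob_fields K" "(\<Sum>x\<in>A. w x * site_cost S \<xi> x) \<le> \<epsilon> / 4 * (\<Sum>x\<in>A. w x)"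
        using weighted[OF A] \<open>\<And>x. x \<in> A \<Longrightarrow> 0 < w x\<close> by blast
      have "(\<Sum>x\<in>A. w x * (site_cost S \<xi> x / (2 * N))) = (\<Sum>x\<in>A. w x * site_cost S \<xi> x) / (2 * N)"
        by (simp add: sum_divide_distrib)
      also have "\<dots> \<le> \<epsilon> / 4 * (\<Sum>x\<in>A. w x) / (2 * N)"
        by (rule divide_right_mono[OF \<xi>(2)]) (use N in simp)
      finally have "(\<Sum>x\<in>A. w x * (site_cost S \<xi> x / (2 * N))) \<le> \<epsilon> / (8 * N) * (\<Sum>x\<in>A. w x)"
        by (simp add: mult.commute)
      then show ?thesis using \<xi>(1) by blast
    qed
    from multiplicative_weights[OF A(1) 1 2 3]
    obtain T :: nat and l where T: "T > 0" and l: "\<And>t. t < T \<Longrightarrow> l t \<in> prob_fields K"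
      and cost: "\<And>x. x \<in> A \<Longrightarrow> (\<Sum>t<T. site_cost S (l t) x / (2 * N)) \<le> 4 * (\<epsilon> / (8 * N)) * real T"
      by blast
    define \<xi> where "\<xi> = (\<lambda>x h. (\<Sum>t<T. l t x h) / real T)"
    have "site_cost S \<xi> x \<le> \<epsilon>" if x: "x \<in> A" for x
    proof -
      have "site_cost S \<xi> x \<le> (\<Sum>s\<in>S. (\<Sum>t<T. l1_dist G (l t x) (l t (x \<otimes> s))) / real T)"
        unfolding site_cost_def \<xi>_def
        by (intro sum_mono l1_dist_average T prob_fieldsD[OF l]) (use x A S in auto)
      also have "\<dots> = (\<Sum>t<T. site_cost S (l t) x) / real T"
        unfolding site_cost_def sum_divide_distrib[symmetric] by (subst sum.swap) simp
      also have "(\<Sum>t<T. site_cost S (l t) x) = (\<Sum>t<T. site_cost S (l t) x / (2 * N)) * (2 * N)"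
        using N by (simp add: sum_divide_distrib[symmetric])
      also have "\<dots> \<le> 4 * (\<epsilon> / (8 * N)) * real T * (2 * N)"
        by (rule mult_right_mono[OF cost[OF x]]) (use N in simp)
      also have "\<dots> = \<epsilon> * real T" using N by simp
      finally show ?thesis using T by (simp add: divide_right_mono)
    qed
    moreover have "\<xi> \<in> prob_fields K"
      unfolding \<xi>_def by (rule prob_fields_average[OF T l])
    ultimately show ?thesis by blast
  qed
  then show ?thesis using K unfolding uniform_bound_def by blast
qed

end

section \<open>Compact spaces of fields\<close>

lemma closedin_Collect_ball:
  assumes "\<And>i. i \<in> J \<Longrightarrow> closedin Y {f \<in> topspace Y. P i f}"
  shows "closedin Y {f \<in> topspace Y. \<forall>i\<in>J. P i f}"
proof (cases "J = {}")
  case False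
  then have "{f \<in> topspace Y. \<forall>i\<in>J. P i f} = (\<Inter>i\<in>J. {f \<in> topspace Y. P i f})" by auto
  then show ?thesis using assms False by (auto intro: closedin_INT)
qed simp

lemma closedin_Collect_conj:
  assumes "closedin Y {f \<in> topspace Y. P f}" "closedin Y {f \<in> topspace Y. Q f}"
  shows "closedin Y {f \<in> topspace Y. P f \<and> Q f}"
proof -
  have "{f \<in> topspace Y. P f \<and> Q f} = {f \<in> topspace Y. P f} \<inter> {f \<in> topspace Y. Q f}" by auto
  then show ?thesis using assms by (simp add: closedin_Int)
qed

lemma closedin_Collect_real:
  assumes "continuous_map Y euclideanreal g"
  shows "closedin Y {f \<in> topspace Y. g f \<le> c}" "closedin Y {f \<in> topspace Y. g f = c}"
  using closedin_continuous_map_preimage[OF assms, of "{..c}"]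
    closedin_continuous_map_preimage[OF assms, of "{c}"] by simp_all

section \<open>The group action on fields and its amenability\<close>

context group
begin

lemma prob_fields_cong:
  assumes "\<xi> \<in> prob_fields K" "\<And>x. x \<in> carrier G \<Longrightarrow> \<xi> x = \<xi>' x"
  shows "\<xi>' \<in> prob_fields K"
  using assms by (simp add: prob_fields_def)

lemma site_cost_cong:
  assumes "x \<in> carrier G" "S \<subseteq> carrier G" "\<And>y. y \<in> carrier G \<Longrightarrow> \<xi> y = \<xi>' y"
  shows "site_cost S \<xi> x = site_cost S \<xi>' x"
  unfolding site_cost_def by (rule sum.cong) (use assms in auto)

text \<open>Translating argument and values together leaves \<open>inv x \<otimes> h\<close>, and
  with it the support condition, unchanged.\<close>

lemma translate_field:
  assumes "g \<in> carrier G" "\<xi> \<in> prob_fields K"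
  shows "(\<lambda>x. translate G g (\<xi> (inv g \<otimes> x))) \<in> prob_fields K"
  unfolding prob_fields_def
proof safe
  fix x assume x: "x \<in> carrier G"
  show "translate G g (\<xi> (inv g \<otimes> x)) \<in> Prob G"
    by (rule translate_Prob[OF is_group]) (use assms x prob_fieldsD in auto)
  fix h assume h: "h \<in> carrier G" "translate G g (\<xi> (inv g \<otimes> x)) h \<noteq> 0"
  then have "inv (inv g \<otimes> x) \<otimes> (inv g \<otimes> h) \<in> K"
    using assms x by (intro prob_fieldsD(2)[OF assms(2)]) (auto simp: translate_def)
  moreover have "inv (inv g \<otimes> x) \<otimes> (inv g \<otimes> h) = inv x \<otimes> h"
    using assms(1) x h by (simp add: inv_mult_group m_assoc) (simp add: m_assoc[symmetric])
  ultimately show "inv x \<otimes> h \<in> K" by simp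
qed

lemma site_cost_translate:
  assumes "g \<in> carrier G" "x \<in> carrier G" "S \<subseteq> carrier G"
  shows "site_cost S (\<lambda>x. translate G g (\<xi> (inv g \<otimes> x))) x = site_cost S \<xi> (inv g \<otimes> x)"
  unfolding site_cost_def
  by (rule sum.cong) (use assms in \<open>auto simp: l1_dist_translate m_assoc subset_iff\<close>)

text \<open>Costs have to be continuous in the coordinates of the product space below, and a finite
  sum of coordinates is.\<close>

lemma field_l1_dist_finite:
  assumes "\<xi> \<in> prob_fields K" "finite K" "K \<subseteq> carrier G" "x \<in> carrier G" "y \<in> carrier G"
  shows "l1_dist G (\<xi> x) (\<xi> y) = (\<Sum>h\<in>(\<lambda>k. x \<otimes> k) ` K \<union> (\<lambda>k. y \<otimes> k) ` K. \<bar>\<xi> x h - \<xi> y h\<bar>)"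
proof (rule l1_dist_finite)
  fix h assume h: "h \<in> carrier G - ((\<lambda>k. x \<otimes> k) ` K \<union> (\<lambda>k. y \<otimes> k) ` K)"
  have "h = z \<otimes> (inv z \<otimes> h)" if "z \<in> carrier G" for z
    using that h by (simp add: m_assoc[symmetric])
  then have "inv x \<otimes> h \<notin> K" "inv y \<otimes> h \<notin> K" using h assms by blast+
  then have "\<xi> x h = 0" "\<xi> y h = 0"
    using prob_fieldsD(2)[OF assms(1,4), of h] prob_fieldsD(2)[OF assms(1,5), of h] h by blast+
  then show "\<xi> x h = \<xi> y h" by simp
qed (use assms in auto)

text \<open>The group acts on the compact space of all sequences of fields which are supported near the
  diagonal and whose variation tends to 0; evaluating them at \<open>\<one>\<close> shows that this action is
  topologically amenable.\<close>

theorem uniform_imp_exact: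
  assumes countable: "countable (carrier G)"
    and uni: "\<And>S \<epsilon>. finite S \<Longrightarrow> S \<subseteq> carrier G \<Longrightarrow> \<epsilon> > 0 \<Longrightarrow>
          \<exists>K. finite K \<and> K \<subseteq> carrier G \<and> uniform_bound S \<epsilon> K"
  shows "exact_group G"
proof -
  define e where "e = from_nat_into (carrier G)"
  have e: "range e = carrier G"
    unfolding e_def by (rule range_from_nat_into) (use countable in auto)
  define B where "B = (\<lambda>n. e ` {..n::nat})"
  have B: "finite (B n)" "B n \<subseteq> carrier G" for n using e by (auto simp: B_def)
  have B_mono: "B m \<subseteq> B n" if "m \<le> n" for m n using that by (auto simp: B_def)
  have B_ex: "\<exists>n. x \<in> B n" if "x \<in> carrier G" for x using that unfolding e[symmetric] B_def by auto
  have "\<exists>K. finite K \<and> K \<subseteq> carrier G \<and> uniform_bound (B n) (1 / real (Suc n)) K" for n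
    by (rule uni) (use B in auto)
  then obtain K where K: "\<And>n. finite (K n)" "\<And>n. K n \<subseteq> carrier G"
    and unif: "\<And>n. uniform_bound (B n) (1 / real (Suc n)) (K n)" by metis
  \<comment> \<open>The coordinate \<open>(n, x, h)\<close> is the mass at \<open>h\<close> of the
    \<open>n\<close>-th field at \<open>x\<close>; all \<open>n\<close> are treated at once so that
    one compact space carries the whole sequence of maps.\<close>
  define I where "I = (UNIV :: nat set) \<times> carrier G \<times> carrier G"
  define Y :: "(nat \<times> 'a \<times> 'a \<Rightarrow> real) topology" where
    "Y = product_topology (\<lambda>_. subtopology euclideanreal {0..1}) I"
  have topY: "topspace Y = (\<Pi>\<^sub>E i\<in>I. {0..1})" by (simp add: Y_def)
  have I_countable: "countable I" using countable by (simp add: I_def)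
  have Y_compact: "compact_space Y"
    unfolding Y_def by (simp add: compact_space_product_topology compact_space_subtopology)
  have Y_metr: "metrizable_space Y"
  proof -
    have "countable {i \<in> I. \<not> (\<exists>a. topspace (subtopology euclideanreal {0..1}) \<subseteq> {a})}"
      by (rule countable_subset[OF _ I_countable]) auto
    moreover have "metrizable_space (subtopology euclideanreal {0..1})"
      by (rule metrizable_space_subtopology[OF metrizable_space_euclidean])
    ultimately show ?thesis unfolding Y_def metrizable_space_product_topology by blast
  qed
  have coord: "continuous_map Y euclideanreal (\<lambda>f. f i)" if "i \<in> I" for i
  proof -
    have "continuous_map Y (subtopology euclideanreal {0..1}) (\<lambda>f. f i)"
      unfolding Y_def by (rule continuous_map_product_projection[OF that])
    then show ?thesis by (rule continuous_map_into_fulltopology)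
  qed
  \<comment> \<open>Points of the product are \<open>undefined\<close> off \<open>I\<close>, whereas
    densities must vanish off the carrier.\<close>
  define V where "V = (\<lambda>(f :: nat \<times> 'a \<times> 'a \<Rightarrow> real) n x h. if h \<in> carrier G then f (n, x, h) else 0)"
  define good where "good = (\<lambda>f n. V f n \<in> prob_fields (K n))"
  define Q where "Q = (\<lambda>n x s. (\<lambda>k. x \<otimes> k) ` K n \<union> (\<lambda>k. x \<otimes> s \<otimes> k) ` K n)"
  have Q: "finite (Q n x s)" "Q n x s \<subseteq> carrier G" if "x \<in> carrier G" "s \<in> carrier G" for n x s
    using that K by (auto simp: Q_def)
  have V_cost: "site_cost (B n) (V f n) x =
      (\<Sum>s\<in>B n. \<Sum>h\<in>Q n x s. \<bar>f (n, x, h) - f (n, x \<otimes> s, h)\<bar>)" if "good f n" "x \<in> carrier G" for f n x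
    unfolding site_cost_def
  proof (rule sum.cong[OF refl])
    fix s assume "s \<in> B n"
    then have s: "s \<in> carrier G" using B by auto
    show "l1_dist G (V f n x) (V f n (x \<otimes> s)) = (\<Sum>h\<in>Q n x s. \<bar>f (n, x, h) - f (n, x \<otimes> s, h)\<bar>)"
    proof -
      have "l1_dist G (V f n x) (V f n (x \<otimes> s)) = (\<Sum>h\<in>Q n x s. \<bar>V f n x h - V f n (x \<otimes> s) h\<bar>)"
        unfolding Q_def using that s by (intro field_l1_dist_finite[of _ "K n"] K) (auto simp: good_def)
      also have "\<dots> = (\<Sum>h\<in>Q n x s. \<bar>f (n, x, h) - f (n, x \<otimes> s, h)\<bar>)"
      proof (rule sum.cong[OF refl])
        fix h assume "h \<in> Q n x s"
        then have "h \<in> carrier G" using Q(2)[OF that(2) s] by blast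
        then show "\<bar>V f n x h - V f n (x \<otimes> s) h\<bar> = \<bar>f (n, x, h) - f (n, x \<otimes> s, h)\<bar>"
          by (simp add: V_def)
      qed
      finally show ?thesis .
    qed
  qed
  \<comment> \<open>As supports lie in the finite sets \<open>x K n\<close>, total mass 1 is an
    equation between finitely many coordinates. No mass can escape in a limit, and the condition is
    closed.\<close>
  have good_iff: "good f n \<longleftrightarrow> (\<forall>x\<in>carrier G. (\<forall>h\<in>carrier G. inv x \<otimes> h \<notin> K n \<longrightarrow> f (n, x, h) = 0) \<and>
      (\<Sum>k\<in>K n. f (n, x, x \<otimes> k)) = 1)" (is "_ \<longleftrightarrow> ?R") if f: "f \<in> topspace Y" for f n
  proof -
    have f01: "0 \<le> f (n, x, h)" if "x \<in> carrier G" "h \<in> carrier G" for x h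
      using f that by (auto simp: topY I_def PiE_iff)
    have sum_eq: "(\<Sum>h\<in>(\<lambda>k. x \<otimes> k) ` K n. V f n x h) = (\<Sum>k\<in>K n. f (n, x, x \<otimes> k))"
      if "x \<in> carrier G" for x
    proof -
      have "inj_on (\<lambda>k. x \<otimes> k) (K n)" by (rule inj_on_subset[OF bij_betw_imp_inj_on[OF bij_betw_mult_left[OF that]] K(2)])
      then show ?thesis using that K(2)[of n] by (auto simp: sum.reindex V_def intro!: sum.cong)
    qed
    have decomp: "h = x \<otimes> (inv x \<otimes> h)" if "x \<in> carrier G" "h \<in> carrier G" for x h
      using that by (simp add: m_assoc[symmetric])
    show ?thesis
    proof
      assume g: "good f n"
      show ?R
      proof (intro ballI conjI impI)
        fix x h assume "x \<in> carrier G" "h \<in> carrier G" "inv x \<otimes> h \<notin> K n"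
        then show "f (n, x, h) = 0"
          using prob_fieldsD(2)[OF g[unfolded good_def]] by (force simp: V_def)
      next
        fix x assume x: "x \<in> carrier G"
        have P: "V f n x \<in> Prob G" using prob_fieldsD(1)[OF g[unfolded good_def] x] .
        have "(V f n x has_sum 1) ((\<lambda>k. x \<otimes> k) ` K n)"
        proof (rule has_sum_cong_neutral[THEN iffD1])
          show "(V f n x has_sum 1) (carrier G)" using P by (simp add: Prob_def)
          fix h assume "h \<in> carrier G - (\<lambda>k. x \<otimes> k) ` K n"
          then have "h \<in> carrier G" "inv x \<otimes> h \<notin> K n" using decomp[OF x, of h] by auto
          then show "V f n x h = 0" using prob_fieldsD(2)[OF g[unfolded good_def] x] by blast
        qed (use x K in auto)
        then show "(\<Sum>k\<in>K n. f (n, x, x \<otimes> k)) = 1"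
          using K(1)[of n] sum_eq[OF x] by (simp add: has_sum_finite_iff)
      qed
    next
      assume R: ?R
      show "good f n"
        unfolding good_def prob_fields_def
      proof (safe)
        fix x assume x: "x \<in> carrier G"
        show "V f n x \<in> Prob G"
        proof (rule Prob_finiteI[of "(\<lambda>k. x \<otimes> k) ` K n"])
          show "(\<lambda>k. x \<otimes> k) ` K n \<subseteq> carrier G" using x K by auto
          show "(\<Sum>h\<in>(\<lambda>k. x \<otimes> k) ` K n. V f n x h) = 1" using R x sum_eq by simp
          fix h
          show "0 \<le> V f n x h" using f01 x by (simp add: V_def)
          assume "h \<notin> (\<lambda>k. x \<otimes> k) ` K n"
          then show "V f n x h = 0" using R x decomp[OF x, of h] by (auto simp: V_def)
        qed (use K in simp)
        fix h assume "h \<in> carrier G" "V f n x h \<noteq> 0"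
        then show "inv x \<otimes> h \<in> K n" using R x by (auto simp: V_def)
      qed
    qed
  qed
  have inI: "(n, x, h) \<in> I \<longleftrightarrow> x \<in> carrier G \<and> h \<in> carrier G" for n x h by (auto simp: I_def)
  have good_closed: "closedin Y {f \<in> topspace Y. good f n}" for n
  proof -
    have "{f \<in> topspace Y. good f n} = {f \<in> topspace Y. \<forall>x\<in>carrier G.
        (\<forall>h\<in>{h\<in>carrier G. inv x \<otimes> h \<notin> K n}. f (n, x, h) = 0) \<and> (\<Sum>k\<in>K n. f (n, x, x \<otimes> k)) = 1}"
      by (rule Collect_cong) (auto simp: good_iff)
    also have "closedin Y \<dots>"
    proof (intro closedin_Collect_ball closedin_Collect_conj)
      fix x h assume x: "x \<in> carrier G"
      show "closedin Y {f \<in> topspace Y. (\<Sum>k\<in>K n. f (n, x, x \<otimes> k)) = 1}"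
        by (intro closedin_Collect_real continuous_map_sum coord K(1)) (use x K(2) in \<open>auto simp: inI\<close>)
      assume "h \<in> {h\<in>carrier G. inv x \<otimes> h \<notin> K n}"
      then show "closedin Y {f \<in> topspace Y. f (n, x, h) = 0}"
        by (intro closedin_Collect_real coord) (use x in \<open>auto simp: inI\<close>)
    qed
    finally show ?thesis .
  qed
  have cost_closed: "closedin Y {f \<in> topspace Y. good f n \<and> site_cost (B n) (V f n) x \<le> c}"
    if x: "x \<in> carrier G" for n x c
  proof -
    have xs: "x \<otimes> s \<in> carrier G" "Q n x s \<subseteq> carrier G" "finite (Q n x s)" if "s \<in> B n" for s
      using that x B(2)[of n] Q[OF x, of s n] by auto
    have "{f \<in> topspace Y. good f n \<and> site_cost (B n) (V f n) x \<le> c} = {f \<in> topspace Y. good f n \<and>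
        (\<Sum>s\<in>B n. \<Sum>h\<in>Q n x s. \<bar>f (n, x, h) - f (n, x \<otimes> s, h)\<bar>) \<le> c}"
      by (rule Collect_cong) (use V_cost x in auto)
    also have "closedin Y \<dots>"
      by (intro closedin_Collect_conj good_closed closedin_Collect_real continuous_map_sum
        continuous_map_real_abs continuous_map_diff coord B(1) xs(3)) (use xs x in \<open>auto simp: inI\<close>)
    finally show ?thesis .
  qed
  \<comment> \<open>Control of the variation on \<open>B m\<close> alone is a closed condition,
    satisfiable by \<open>uniform_bound\<close>; the sets decrease in \<open>m\<close>, so
    compactness gives control on the whole group.\<close>
  define C where "C = (\<lambda>m. {f \<in> topspace Y. \<forall>n\<in>UNIV. \<forall>x\<in>B m.
      good f n \<and> site_cost (B n) (V f n) x \<le> 1 / real (Suc n)})"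
  have C_closed: "closedin Y (C m)" for m
    unfolding C_def by (intro closedin_Collect_ball cost_closed) (use B(2) in auto)
  have C_ne: "C m \<noteq> {}" for m
  proof -
    have "\<exists>\<xi>\<in>prob_fields (K n). \<forall>x\<in>B m. site_cost (B n) \<xi> x \<le> 1 / real (Suc n)" for n
      using unif[of n] B[of m] unfolding uniform_bound_def by blast
    then obtain \<xi> where \<xi>: "\<And>n. \<xi> n \<in> prob_fields (K n)"
      "\<And>n x. x \<in> B m \<Longrightarrow> site_cost (B n) (\<xi> n) x \<le> 1 / real (Suc n)" by metis
    define f where "f = restrict (\<lambda>(n, x, h). \<xi> n x h) I"
    have V: "V f n x = \<xi> n x" if "x \<in> carrier G" for n x
      using prob_fieldsD(1)[OF \<xi>(1) that, of n] that by (auto simp: V_def f_def I_def Prob_def fun_eq_iff)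
    have "0 \<le> \<xi> n x h \<and> \<xi> n x h \<le> 1" if "x \<in> carrier G" "h \<in> carrier G" for n x h
      using prob_fieldsD(1)[OF \<xi>(1) that(1), of n] Prob_sum_le_1[of "\<xi> n x" G "{h}"] that
      by (auto simp: Prob_def)
    then have "f \<in> topspace Y" by (auto simp: topY f_def I_def)
    moreover have "good f n" for n
      unfolding good_def by (rule prob_fields_cong[OF \<xi>(1)]) (simp add: V)
    moreover have "site_cost (B n) (V f n) x \<le> 1 / real (Suc n)" if "x \<in> B m" for n x
      using \<xi>(2)[OF that, of n] site_cost_cong[of x "B n" "V f n" "\<xi> n"] that B V by (auto simp: subset_iff)
    ultimately have "f \<in> C m" by (simp add: C_def)
    then show ?thesis by blast
  qed
  have "decseq C"
    unfolding decseq_def C_def using B_mono by blast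
  define M where "M = (\<Inter>m. C m)"
  have M_ne: "M \<noteq> {}"
    unfolding M_def by (rule compact_space_imp_nest[OF Y_compact C_closed C_ne \<open>decseq C\<close>])
  have M_iff: "f \<in> M \<longleftrightarrow> f \<in> topspace Y \<and> (\<forall>n. good f n) \<and>
      (\<forall>n. \<forall>x\<in>carrier G. site_cost (B n) (V f n) x \<le> 1 / real (Suc n))" for f
  proof
    assume f: "f \<in> M"
    have "good f n \<and> site_cost (B n) (V f n) x \<le> 1 / real (Suc n)" if x: "x \<in> carrier G" for n x
    proof -
      obtain m where "x \<in> B m" using B_ex[OF x] by blast
      moreover have "f \<in> C m" using f by (simp add: M_def)
      ultimately show ?thesis by (simp add: C_def)
    qed
    moreover have "f \<in> topspace Y" using f by (auto simp: M_def C_def)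
    ultimately show "f \<in> topspace Y \<and> (\<forall>n. good f n) \<and>
      (\<forall>n. \<forall>x\<in>carrier G. site_cost (B n) (V f n) x \<le> 1 / real (Suc n))" using one_closed by blast
  next
    assume "f \<in> topspace Y \<and> (\<forall>n. good f n) \<and>
      (\<forall>n. \<forall>x\<in>carrier G. site_cost (B n) (V f n) x \<le> 1 / real (Suc n))"
    then show "f \<in> M" using B(2) unfolding M_def C_def by blast
  qed
  have M_closed: "closedin Y M" unfolding M_def by (rule closedin_INT) (use C_closed in auto)
  have M_sub: "M \<subseteq> topspace Y" by (rule closedin_subset[OF M_closed])
  define X where "X = subtopology Y M"
  have topX: "topspace X = M" using M_sub by (auto simp: X_def)
  have X_compact: "compact_space X"
    unfolding X_def by (rule compact_space_subtopology[OF closedin_compact_space[OF Y_compact M_closed]])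
  have X_metr: "metrizable_space X"
    unfolding X_def by (rule metrizable_space_subtopology[OF Y_metr])
  define act where "act = (\<lambda>g f. restrict (\<lambda>(n, x, h). f (n, inv g \<otimes> x, inv g \<otimes> h) :: real) I)"
  have V_act: "V (act g f) n x = translate G g (V f n (inv g \<otimes> x))"
    if "g \<in> carrier G" "x \<in> carrier G" for g f n x
    using that by (auto simp: V_def act_def translate_def I_def fun_eq_iff)
  have act_M: "act g f \<in> M" if g: "g \<in> carrier G" and f: "f \<in> M" for g f
    unfolding M_iff
  proof (intro conjI allI ballI)
    show "act g f \<in> topspace Y"
      using f g M_sub unfolding topY act_def by (force simp: I_def PiE_iff)
    show "good (act g f) n" for n
      unfolding good_def
    proof (rule prob_fields_cong[OF translate_field[OF g]])
      show "V f n \<in> prob_fields (K n)" using f by (simp add: M_iff good_def)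
    qed (simp add: V_act g)
    fix n x assume x: "x \<in> carrier G"
    have "site_cost (B n) (V (act g f) n) x = site_cost (B n) (\<lambda>x. translate G g (V f n (inv g \<otimes> x))) x"
      by (rule site_cost_cong) (use x B V_act g in auto)
    also have "\<dots> = site_cost (B n) (V f n) (inv g \<otimes> x)"
      by (rule site_cost_translate) (use x B g in auto)
    also have "\<dots> \<le> 1 / real (Suc n)" using f x g by (simp add: M_iff)
    finally show "site_cost (B n) (V (act g f) n) x \<le> 1 / real (Suc n)" .
  qed
  have act_act: "act (g \<otimes> h) f = act g (act h f)" if "g \<in> carrier G" "h \<in> carrier G" for g h f
    using that by (auto simp: act_def I_def fun_eq_iff inv_mult_group m_assoc)
  have act_one: "act \<one> f = f" if "f \<in> M" for f
  proof -
    have "f \<in> extensional I" using that M_sub by (auto simp: topY PiE_def)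
    then show ?thesis by (auto simp: act_def I_def fun_eq_iff extensional_def)
  qed
  have act_inv: "act (inv g) (act g f) = f" "act g (act (inv g) f) = f" if "g \<in> carrier G" "f \<in> M" for g f
    using act_act[of "inv g" g f] act_act[of g "inv g" f] act_one that by simp_all
  define \<phi> where "\<phi> = (\<lambda>g. restrict (act g) M)"
  have \<phi>_cont: "continuous_map X X (\<phi> g)" if g: "g \<in> carrier G" for g
  proof -
    have "continuous_map Y Y (act g)"
      unfolding Y_def act_def
    proof (rule continuous_map_componentwise[THEN iffD2], intro conjI ballI)
      fix i assume i: "i \<in> I"
      obtain n x h where nxh: "i = (n, x, h)" "x \<in> carrier G" "h \<in> carrier G" using i by (auto simp: I_def)
      have "continuous_map (product_topology (\<lambda>_. subtopology euclideanreal {0..1}) I)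
          (subtopology euclideanreal {0..1}) (\<lambda>f. f (n, inv g \<otimes> x, inv g \<otimes> h))"
        by (rule continuous_map_product_projection) (use nxh g in \<open>auto simp: I_def\<close>)
      then show "continuous_map (product_topology (\<lambda>_. subtopology euclideanreal {0..1}) I)
          (subtopology euclideanreal {0..1}) (\<lambda>f. restrict (\<lambda>(n, x, h). f (n, inv g \<otimes> x, inv g \<otimes> h) :: real) I i)"
        using i nxh by simp
    qed auto
    then have "continuous_map X X (act g)"
      unfolding X_def
      by (intro continuous_map_into_subtopology continuous_map_from_subtopology) (use act_M g in auto)
    then show ?thesis
      by (rule continuous_map_eq) (simp add: \<phi>_def topX)
  qed
  have hom: "homeomorphic_maps X X (\<phi> g) (\<phi> (inv g))" if g: "g \<in> carrier G" for g
    unfolding homeomorphic_maps_def topX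
    using \<phi>_cont[OF g] \<phi>_cont[OF inv_closed[OF g]] act_inv[OF g] act_M g by (simp add: \<phi>_def)
  have bij: "\<phi> g \<in> Bij M" if "g \<in> carrier G" for g
  proof -
    have "bij_betw (\<phi> g) M M"
      by (rule bij_betw_byWitness[where f' = "\<phi> (inv g)"])
         (use act_inv[OF that] act_M that in \<open>auto simp: \<phi>_def\<close>)
    then show ?thesis by (simp add: Bij_def \<phi>_def)
  qed
  have action: "group_action G M \<phi>"
    unfolding group_action_def group_hom_def group_hom_axioms_def
  proof (intro conjI is_group group_BijGroup homI)
    fix g h assume g: "g \<in> carrier G"
    show "\<phi> g \<in> carrier (BijGroup M)" using bij[OF g] by (simp add: BijGroup_def)
    assume h: "h \<in> carrier G"
    have "\<phi> (g \<otimes> h) = compose M (\<phi> g) (\<phi> h)"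
      using act_M[OF h] act_act[OF g h] by (auto simp: \<phi>_def compose_def fun_eq_iff)
    then show "\<phi> (g \<otimes> h) = \<phi> g \<otimes>\<^bsub>BijGroup M\<^esub> \<phi> h"
      using bij[OF g] bij[OF h] by (simp add: BijGroup_def)
  qed
  define \<eta> where "\<eta> = (\<lambda>n f. V f n \<one>)"
  have \<eta>_Prob: "\<eta> n f \<in> Prob G" if "f \<in> M" for n f
    unfolding \<eta>_def using that prob_fieldsD(1)[of "V f n" "K n" \<one>] by (simp add: M_iff good_def)
  have \<eta>_cont: "continuous_map X (Prob_topology G) (\<eta> n)" for n
  proof -
    interpret MS: Metric_space "Prob G" "l1_dist G" by (rule Metric_space_Prob)
    show ?thesis
      unfolding Prob_topology_def MS.continuous_map_to_metric
    proof (intro ballI allI impI)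
      fix f and \<epsilon> :: real assume f: "f \<in> topspace X" and \<epsilon>: "\<epsilon> > 0"
      \<comment> \<open>All measures \<open>\<eta> n f'\<close> live on the same finite set
        \<open>K n\<close>, so that closeness in norm is closeness of finitely many
        coordinates.\<close>
      define d where "d = (\<lambda>f'. \<Sum>k\<in>K n. \<bar>f (n, \<one>, k) - f' (n, \<one>, k)\<bar> :: real)"
      have "continuous_map X euclideanreal d"
        unfolding d_def X_def
        by (intro continuous_map_from_subtopology continuous_map_sum continuous_map_real_abs
            continuous_map_diff coord K) (use K(2) in \<open>auto simp: I_def\<close>)
      then have "openin X {f' \<in> topspace X. d f' \<in> {..<\<epsilon>}}"
        by (rule openin_continuous_map_preimage) simp
      moreover have "f \<in> {f' \<in> topspace X. d f' \<in> {..<\<epsilon>}}" using f \<epsilon> by (simp add: d_def)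
      moreover have "\<eta> n f' \<in> MS.mball (\<eta> n f) \<epsilon>" if "f' \<in> {f' \<in> topspace X. d f' \<in> {..<\<epsilon>}}" for f'
      proof -
        have M: "f \<in> M" "f' \<in> M" using f that by (auto simp: topX)
        have "V f'' n \<one> h = 0" if "f'' \<in> M" "h \<in> carrier G - K n" for f'' h
          using prob_fieldsD(2)[of "V f'' n" "K n" \<one> h] that by (auto simp: M_iff good_def)
        then have "l1_dist G (\<eta> n f) (\<eta> n f') = (\<Sum>h\<in>K n. \<bar>V f n \<one> h - V f' n \<one> h\<bar>)"
          unfolding \<eta>_def using M by (intro l1_dist_finite K) auto
        also have "\<dots> = d f'" unfolding d_def by (rule sum.cong) (use K(2)[of n] in \<open>auto simp: V_def\<close>)
        finally show ?thesis using that M \<eta>_Prob by simp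
      qed
      ultimately show "\<exists>U. openin X U \<and> f \<in> U \<and> (\<forall>y\<in>U. \<eta> n y \<in> MS.mball (\<eta> n f) \<epsilon>)" by blast
    qed
  qed
  \<comment> \<open>Equivariance of \<open>V\<close> turns left translation by \<open>g\<close> into
    the right neighbour \<open>\<one> \<otimes> inv g\<close>, which the cost at \<one> controls
    once \<open>inv g\<close> belongs to \<open>B n\<close>.\<close>
  have \<eta>_dist: "l1_dist G (translate G g (\<eta> n f)) (\<eta> n (\<phi> g f)) \<le> 1 / real (Suc n)"
    if g: "g \<in> carrier G" and f: "f \<in> M" and n: "inv g \<in> B n" for g f n
  proof -
    have "\<eta> n (\<phi> g f) = translate G g (V f n (\<one> \<otimes> inv g))"
      using f g by (simp add: \<eta>_def \<phi>_def V_act)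
    then have "l1_dist G (translate G g (\<eta> n f)) (\<eta> n (\<phi> g f)) = l1_dist G (V f n \<one>) (V f n (\<one> \<otimes> inv g))"
      using g by (simp add: \<eta>_def l1_dist_translate)
    also have "\<dots> \<le> site_cost (B n) (V f n) \<one>"
      unfolding site_cost_def
      by (rule member_le_sum[of "inv g" "B n" "\<lambda>s. l1_dist G (V f n \<one>) (V f n (\<one> \<otimes> s))"])
         (use n B l1_dist_nonneg in auto)
    also have "\<dots> \<le> 1 / real (Suc n)" using f by (simp add: M_iff)
    finally show ?thesis .
  qed
  have lim: "(\<lambda>n. SUP f\<in>topspace X. l1_dist G (translate G g (\<eta> n f)) (\<eta> n (\<phi> g f))) \<longlonglongrightarrow> 0"
    if g: "g \<in> carrier G" for g
  proof -
    obtain n0 where n0: "inv g \<in> B n0" using B_ex g by blast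
    have bound: "0 \<le> (SUP f\<in>M. l1_dist G (translate G g (\<eta> n f)) (\<eta> n (\<phi> g f))) \<and>
       (SUP f\<in>M. l1_dist G (translate G g (\<eta> n f)) (\<eta> n (\<phi> g f))) \<le> 1 / real (Suc n)" if "n \<ge> n0" for n
    proof -
      have gn: "inv g \<in> B n" using n0 B_mono[OF that] by blast
      obtain f where f: "f \<in> M" using M_ne by blast
      have "bdd_above ((\<lambda>f. l1_dist G (translate G g (\<eta> n f)) (\<eta> n (\<phi> g f))) ` M)"
        by (rule bdd_aboveI2[of _ _ "1 / real (Suc n)"]) (rule \<eta>_dist[OF g _ gn])
      then have "l1_dist G (translate G g (\<eta> n f)) (\<eta> n (\<phi> g f)) \<le> (SUP f\<in>M. l1_dist G (translate G g (\<eta> n f)) (\<eta> n (\<phi> g f)))"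
        by (rule cSUP_upper[OF f])
      then show ?thesis
        using M_ne \<eta>_dist[OF g _ gn] l1_dist_nonneg
        by (intro conjI cSUP_least) (auto intro: order_trans[OF l1_dist_nonneg])
    qed
    show ?thesis unfolding topX
    proof (rule tendsto_sandwich[of "\<lambda>_. 0" _ _ "\<lambda>n. 1 / real (Suc n)"])
      show "(\<lambda>n. 1 / real (Suc n)) \<longlonglongrightarrow> 0" using LIMSEQ_inverse_real_of_nat by (simp add: inverse_eq_divide)
    qed (use bound in \<open>auto simp: eventually_sequentially intro!: exI[of _ n0]\<close>)
  qed
  have "topologically_amenable G X \<phi>"
    unfolding topologically_amenable_def topX[symmetric]
    using action hom[THEN homeomorphic_maps_imp_map] \<eta>_cont lim topX by auto
  then show ?thesis
    using exact_groupI[OF X_compact X_metr] M_ne topX by simp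
qed

text \<open>Contraposition of the chain averaged, weighted, uniform, exact. The set obtained is a
  symmetrised one, because the band argument needs inverses; enlarging \<open>S\<close> only
  increases site costs.\<close>

lemma nonexact_imp_not_averaged:
  assumes "countable (carrier G)" "\<not> exact_group G"
  obtains S \<epsilon> where "finite S" "S \<subseteq> carrier G" "S \<noteq> {}" "\<epsilon> > 0"
    "\<And>K. finite K \<Longrightarrow> K \<subseteq> carrier G \<Longrightarrow> \<not> averaged_bound S \<epsilon> K"
proof (rule ccontr)
  assume no: "\<not> thesis"
  note obt = that
  have "exact_group G"
  proof (rule uniform_imp_exact[OF assms(1)])
    fix S :: "'a set" and \<epsilon> :: real assume S: "finite S" "S \<subseteq> carrier G" and \<epsilon>: "\<epsilon> > 0"
    define S' where "S' = insert \<one> (S \<union> m_inv G ` S)"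
    have S': "finite S'" "S' \<subseteq> carrier G" "S' \<noteq> {}" "\<And>s. s \<in> S' \<Longrightarrow> inv s \<in> S'"
      using S by (auto simp: S'_def)
    have "\<exists>K. finite K \<and> K \<subseteq> carrier G \<and> averaged_bound S' \<epsilon>' K" if "\<epsilon>' > 0" for \<epsilon>'
    proof (rule ccontr)
      assume "\<not> ?thesis"
      then have thesis by (intro obt[OF S'(1,2,3) \<open>\<epsilon>' > 0\<close>]) blast
      then show False using no by blast
    qed
    from averaged_imp_uniform[OF S' this \<epsilon>]
    obtain K where K: "finite K" "K \<subseteq> carrier G" "uniform_bound S' \<epsilon> K" by blast
    have "site_cost S \<xi> x \<le> site_cost S' \<xi> x" for \<xi> x
      unfolding site_cost_def by (rule sum_mono2) (use S' l1_dist_nonneg in \<open>auto simp: S'_def\<close>)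
    then have "uniform_bound S \<epsilon> K" using K(3) unfolding uniform_bound_def by (meson order_trans)
    then show "\<exists>K. finite K \<and> K \<subseteq> carrier G \<and> uniform_bound S \<epsilon> K" using K by blast
  qed
  then show False using assms(2) by blast
qed

end

section \<open>Local functions of an equivalence relation\<close>

definition determined_by ::
  "('g, 'b) monoid_scheme \<Rightarrow> ('g \<times> 'g) set \<Rightarrow> (('g \<times> 'g) set \<Rightarrow> 'c) \<Rightarrow> bool" where
  "determined_by G W f \<longleftrightarrow>
     (\<forall>r\<in>eqrels G. \<forall>r'\<in>eqrels G. r \<inter> W = r' \<inter> W \<longrightarrow> f r = f r')"

text \<open>These maps see only finitely many coordinates of \<open>{0,1}\<close> to the power of
  all pairs, so they are continuous into any topology. Their values at relations outside
  \<open>eqrels G\<close> are unconstrained.\<close>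

definition local_map :: "('g, 'b) monoid_scheme \<Rightarrow> (('g \<times> 'g) set \<Rightarrow> 'c) \<Rightarrow> bool" where
  "local_map G f \<longleftrightarrow> (\<exists>W. finite W \<and> W \<subseteq> carrier G \<times> carrier G \<and> determined_by G W f)"

lemma determined_byD:
  "determined_by G W f \<Longrightarrow> r \<in> eqrels G \<Longrightarrow> r' \<in> eqrels G \<Longrightarrow> r \<inter> W = r' \<inter> W \<Longrightarrow> f r = f r'"
  unfolding determined_by_def by blast

lemma local_mapI:
  assumes "finite W" "W \<subseteq> carrier G \<times> carrier G"
    "\<And>r r'. r \<in> eqrels G \<Longrightarrow> r' \<in> eqrels G \<Longrightarrow> r \<inter> W = r' \<inter> W \<Longrightarrow> f r = f r'"
  shows "local_map G f"
  unfolding local_map_def determined_by_def by (intro exI[of _ W] conjI ballI impI assms)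

lemma local_mapE:
  assumes "local_map G f"
  obtains W where "finite W" "W \<subseteq> carrier G \<times> carrier G" "determined_by G W f"
  using assms unfolding local_map_def by blast

lemma local_const: "local_map G (\<lambda>_. c)"
  by (rule local_mapI[of "{}"]) auto

lemma local_mem:
  assumes "a \<in> carrier G" "b \<in> carrier G"
  shows "local_map G (\<lambda>r. (a, b) \<in> r)"
  by (rule local_mapI[of "{(a, b)}"]) (use assms in auto)

lemma local_compose:
  assumes "local_map G f"
  shows "local_map G (\<lambda>r. F (f r))"
proof -
  obtain W where W: "finite W" "W \<subseteq> carrier G \<times> carrier G"
    "determined_by G W f"
    by (rule local_mapE[OF assms]) blast
  show ?thesis by (rule local_mapI[OF W(1,2)]) (rule arg_cong[where f = F], rule determined_byD[OF W(3)])
qed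

lemma local_compose2:
  assumes "local_map G f" "local_map G g"
  shows "local_map G (\<lambda>r. F (f r) (g r))"
proof -
  obtain W where W: "finite W" "W \<subseteq> carrier G \<times> carrier G"
    "determined_by G W f"
    by (rule local_mapE[OF assms(1)]) blast
  obtain W' where W': "finite W'" "W' \<subseteq> carrier G \<times> carrier G"
    "determined_by G W' g"
    by (rule local_mapE[OF assms(2)]) blast
  show ?thesis
  proof (rule local_mapI[of "W \<union> W'"])
    fix r r' assume r: "r \<in> eqrels G" "r' \<in> eqrels G" "r \<inter> (W \<union> W') = r' \<inter> (W \<union> W')"
    then have "r \<inter> W = r' \<inter> W" "r \<inter> W' = r' \<inter> W'" by blast+
    then show "F (f r) (g r) = F (f r') (g r')" using determined_byD[OF W(3) r(1,2)] determined_byD[OF W'(3) r(1,2)] by simp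
  qed (use W W' in auto)
qed

text \<open>Packs finitely many local maps into a single one, so that \<open>local_compose\<close>
  covers arbitrary functions of several local maps, such as sums and normalisations.\<close>

lemma local_fun:
  assumes "finite A" "\<And>i. i \<in> A \<Longrightarrow> local_map G (f i)"
  shows "local_map G (\<lambda>r. \<lambda>i\<in>A. f i r)"
  using assms
proof (induction A rule: finite_induct)
  case (insert a A)
  have "local_map G (\<lambda>r. (\<lambda>i\<in>A. f i r)(a := f a r))"
    using local_compose2[of G "\<lambda>r. \<lambda>i\<in>A. f i r" "f a" "\<lambda>u v. u(a := v)"] insert by simp
  moreover have "(\<lambda>r. (\<lambda>i\<in>A. f i r)(a := f a r)) = (\<lambda>r. \<lambda>i\<in>insert a A. f i r)"
    by (auto simp: fun_eq_iff)
  ultimately show ?case by (simp only:)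
qed (rule local_mapI[of "{}"], auto)

lemma local_sum:
  assumes "finite A" "\<And>i. i \<in> A \<Longrightarrow> local_map G (f i)"
  shows "local_map G (\<lambda>r. \<Sum>i\<in>A. f i r)"
proof -
  have "local_map G (\<lambda>r. \<Sum>i\<in>A. (\<lambda>i\<in>A. f i r) i)"
    by (rule local_compose[OF local_fun[OF assms]])
  then show ?thesis by simp
qed

text \<open>Basic open sets of the product fix finitely many truth values, that is, the trace of a
  relation on a finite set \<open>W\<close> of pairs. This form replaces the pullback definition in
  the continuity proofs below.\<close>

lemma openin_eqrel_topology:
  "openin (eqrel_topology G) U \<longleftrightarrow> U \<subseteq> eqrels G \<and>
     (\<forall>r\<in>U. \<exists>W. finite W \<and> W \<subseteq> carrier G \<times> carrier G \<and>
        (\<forall>r'\<in>eqrels G. r' \<inter> W = r \<inter> W \<longrightarrow> r' \<in> U))"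
proof -
  define P where "P = carrier G \<times> carrier G"
  define cf where "cf = (\<lambda>r :: ('a \<times> 'a) set. restrict (\<lambda>p. p \<in> r) P)"
  define T where "T = product_topology (\<lambda>_. discrete_topology (UNIV :: bool set)) P"
  have E: "eqrel_topology G = pullback_topology (eqrels G) cf T"
    by (simp add: eqrel_topology_def P_def cf_def T_def)
  show ?thesis
    unfolding P_def[symmetric]
  proof (intro iffI conjI ballI)
    assume U: "openin (eqrel_topology G) U"
    then show "U \<subseteq> eqrels G" using openin_subset topspace_eqrel_topology by blast
    fix r assume r: "r \<in> U"
    obtain V where V: "openin T V" "U = cf -` V \<inter> eqrels G"
      using U by (auto simp: E openin_pullback_topology)
    then have "cf r \<in> V" using r by auto
    then obtain B where B: "finite {i \<in> P. B i \<noteq> UNIV}" "cf r \<in> Pi\<^sub>E P B" "Pi\<^sub>E P B \<subseteq> V"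
      using V(1) unfolding T_def openin_product_topology_alt by auto
    define W where "W = {i \<in> P. B i \<noteq> UNIV}"
    have "r' \<in> U" if r': "r' \<in> eqrels G" "r' \<inter> W = r \<inter> W" for r'
    proof -
      have "cf r' \<in> Pi\<^sub>E P B"
      proof (rule PiE_I)
        fix i assume i: "i \<in> P"
        show "cf r' i \<in> B i"
        proof (cases "i \<in> W")
          case True
          then have "cf r' i = cf r i" using r'(2) by (auto simp: cf_def)
          then show ?thesis using B(2) i by auto
        qed (use i in \<open>auto simp: W_def\<close>)
      qed (simp add: cf_def)
      then show ?thesis using B(3) V(2) r' by auto
    qed
    then show "\<exists>W. finite W \<and> W \<subseteq> P \<and> (\<forall>r'\<in>eqrels G. r' \<inter> W = r \<inter> W \<longrightarrow> r' \<in> U)"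
      using B(1) by (intro exI[of _ W]) (auto simp: W_def)
  next
    assume U: "U \<subseteq> eqrels G \<and>
      (\<forall>r\<in>U. \<exists>W. finite W \<and> W \<subseteq> P \<and> (\<forall>r'\<in>eqrels G. r' \<inter> W = r \<inter> W \<longrightarrow> r' \<in> U))"
    show "openin (eqrel_topology G) U"
    proof (subst openin_subopen, intro ballI)
      fix r assume r: "r \<in> U"
      obtain W where W: "finite W" "W \<subseteq> P" "\<forall>r'\<in>eqrels G. r' \<inter> W = r \<inter> W \<longrightarrow> r' \<in> U"
        using bspec[OF conjunct2[OF U] r] by (elim exE conjE) (rule that)
      define B where "B = (\<lambda>i. if i \<in> W then {i \<in> r} else UNIV)"
      have "openin T (Pi\<^sub>E P B)"
        unfolding T_def
      proof (rule product_topology_basis)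
        show "finite {i. B i \<noteq> topspace (discrete_topology UNIV)}"
          by (rule finite_subset[OF _ W(1)]) (auto simp: B_def)
      qed simp
      then have "openin (eqrel_topology G) (cf -` (Pi\<^sub>E P B) \<inter> eqrels G)"
        unfolding E openin_pullback_topology by blast
      moreover have "cf -` (Pi\<^sub>E P B) \<inter> eqrels G = {r' \<in> eqrels G. r' \<inter> W = r \<inter> W}"
      proof -
        have "cf r' \<in> Pi\<^sub>E P B \<longleftrightarrow> (\<forall>i\<in>P. i \<in> W \<longrightarrow> (i \<in> r') = (i \<in> r))" for r'
          by (simp add: cf_def B_def PiE_iff)
        also have "\<dots> r' \<longleftrightarrow> r' \<inter> W = r \<inter> W" for r' using W(2) by blast
        finally show ?thesis by blast
      qed
      ultimately have "openin (eqrel_topology G) {r' \<in> eqrels G. r' \<inter> W = r \<inter> W}" by simp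
      then show "\<exists>T. openin (eqrel_topology G) T \<and> r \<in> T \<and> T \<subseteq> U"
        using W(3) r conjunct1[OF U] by (intro exI[of _ "{r' \<in> eqrels G. r' \<inter> W = r \<inter> W}"]) blast
    qed
  qed
qed

lemma local_continuous:
  fixes f :: "('g \<times> 'g) set \<Rightarrow> real"
  assumes "local_map G f"
  shows "continuous_map (eqrel_topology G) euclideanreal f"
proof -
  obtain W where W: "finite W" "W \<subseteq> carrier G \<times> carrier G"
    "determined_by G W f"
    by (rule local_mapE[OF assms]) blast
  have "openin (eqrel_topology G) {r \<in> eqrels G. f r \<in> U}" for U
    unfolding openin_eqrel_topology
  proof (intro conjI ballI exI[of _ W] impI W(1,2))
    fix r r' assume "r \<in> {r \<in> eqrels G. f r \<in> U}" "r' \<in> eqrels G" "r' \<inter> W = r \<inter> W"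
    then show "r' \<in> {r \<in> eqrels G. f r \<in> U}" using determined_byD[OF W(3), of r' r] by simp
  qed auto
  then show ?thesis
    by (simp add: continuous_map_def topspace_eqrel_topology)
qed

section \<open>Local sets and the Borel structure\<close>

definition local_sets :: "('g, 'b) monoid_scheme \<Rightarrow> ('g \<times> 'g) set set set" where
  "local_sets G = {B. B \<subseteq> eqrels G \<and> local_map G (\<lambda>r. r \<in> B)}"

lemma local_setsI:
  assumes "local_map G Q"
  shows "{r \<in> eqrels G. Q r} \<in> local_sets G"
proof -
  obtain W where W: "finite W" "W \<subseteq> carrier G \<times> carrier G" "determined_by G W Q"
    by (rule local_mapE[OF assms]) blast
  have "local_map G (\<lambda>r. r \<in> {r \<in> eqrels G. Q r})"
    by (rule local_mapI[OF W(1,2)]) (use determined_byD[OF W(3)] in blast)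
  then show ?thesis by (simp add: local_sets_def)
qed

lemma local_sets_openin:
  assumes "B \<in> local_sets G"
  shows "openin (eqrel_topology G) B"
proof -
  have B: "B \<subseteq> eqrels G" "local_map G (\<lambda>r. r \<in> B)" using assms by (auto simp: local_sets_def)
  obtain W where W: "finite W" "W \<subseteq> carrier G \<times> carrier G"
    "determined_by G W (\<lambda>r. r \<in> B)"
    by (rule local_mapE[OF B(2)]) blast
  show ?thesis
    unfolding openin_eqrel_topology
  proof (intro conjI ballI exI[of _ W] impI W(1,2) B(1))
    fix r r' assume "r \<in> B" "r' \<in> eqrels G" "r' \<inter> W = r \<inter> W"
    then show "r' \<in> B" using determined_byD[OF W(3), of r r'] B(1) by auto
  qed
qed

lemma local_sets_ring:
  assumes "A \<in> local_sets G" "B \<in> local_sets G"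
  shows "A \<inter> B \<in> local_sets G" "A \<union> B \<in> local_sets G" "eqrels G - A \<in> local_sets G"
proof -
  have A: "A \<subseteq> eqrels G" "local_map G (\<lambda>r. r \<in> A)" and B: "B \<subseteq> eqrels G" "local_map G (\<lambda>r. r \<in> B)"
    using assms by (auto simp: local_sets_def)
  have "A \<inter> B = {r \<in> eqrels G. r \<in> A \<and> r \<in> B}" "A \<union> B = {r \<in> eqrels G. r \<in> A \<or> r \<in> B}"
    "eqrels G - A = {r \<in> eqrels G. \<not> r \<in> A}" using A(1) B(1) by auto
  moreover have "{r \<in> eqrels G. r \<in> A \<and> r \<in> B} \<in> local_sets G"
    by (rule local_setsI[OF local_compose2[OF A(2) B(2), of "(\<and>)"]])
  moreover have "{r \<in> eqrels G. r \<in> A \<or> r \<in> B} \<in> local_sets G"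
    by (rule local_setsI[OF local_compose2[OF A(2) B(2), of "(\<or>)"]])
  moreover have "{r \<in> eqrels G. \<not> r \<in> A} \<in> local_sets G"
    by (rule local_setsI[OF local_compose[OF A(2), of Not]])
  ultimately show "A \<inter> B \<in> local_sets G" "A \<union> B \<in> local_sets G" "eqrels G - A \<in> local_sets G"
    by simp_all
qed

lemma local_sets_empty: "{} \<in> local_sets G"
  using local_setsI[OF local_const[of G False]] by simp

lemma space_borel_eqrel: "space (borel_of (eqrel_topology G)) = eqrels G"
  by (simp add: space_borel_of topspace_eqrel_topology)

text \<open>Countability of the group gives countably many pairs of a finite window and a trace on
  it, so every open set is a countable union of local sets. Being closed under intersections, local
  sets are then a generating pi-system on which measures can be compared.\<close>

lemma sets_borel_eqrel:
  assumes "countable (carrier G)"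
  shows "sets (borel_of (eqrel_topology G)) = sigma_sets (eqrels G) (local_sets G)"
proof -
  define P where "P = carrier G \<times> carrier G"
  have P: "countable P" using assms by (simp add: P_def)
  have "U \<in> sigma_sets (eqrels G) (local_sets G)" if U: "openin (eqrel_topology G) U" for U
  proof -
    define N where "N = (\<lambda>(W, V). {r \<in> eqrels G. r \<inter> W = V})"
    define D where "D = {W. finite W \<and> W \<subseteq> P} \<times> {V. finite V \<and> V \<subseteq> P}"
    have D: "countable D"
      unfolding D_def using P by (intro countable_SIGMA) (simp_all add: countable_Collect_finite_subset conj_commute)
    have loc: "N d \<in> local_sets G" if dD: "d \<in> D" for d
    proof -
      obtain W V where d: "d = (W, V)" "finite W" "W \<subseteq> P" using dD by (cases d) (auto simp: D_def)
      have "local_map G (\<lambda>r. r \<inter> W = V)"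
        by (rule local_mapI[of W]) (use d in \<open>auto simp: P_def\<close>)
      then show ?thesis unfolding d N_def by (auto intro: local_setsI)
    qed
    have "U = (\<Union>d\<in>{d\<in>D. N d \<subseteq> U}. N d)"
    proof
      show "U \<subseteq> (\<Union>d\<in>{d\<in>D. N d \<subseteq> U}. N d)"
      proof
        fix r assume r: "r \<in> U"
        obtain W where W: "finite W" "W \<subseteq> P" "\<forall>r'\<in>eqrels G. r' \<inter> W = r \<inter> W \<longrightarrow> r' \<in> U"
          using bspec[OF conjunct2[OF U[unfolded openin_eqrel_topology, folded P_def]] r]
          by (elim exE conjE) (rule that)
        have "(W, r \<inter> W) \<in> D" using W by (auto simp: D_def)
        moreover have "N (W, r \<inter> W) \<subseteq> U" using W(3) by (auto simp: N_def)
        moreover have "r \<in> N (W, r \<inter> W)" using r U by (auto simp: N_def openin_eqrel_topology)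
        ultimately show "r \<in> (\<Union>d\<in>{d\<in>D. N d \<subseteq> U}. N d)" by blast
      qed
    qed auto
    also have "\<dots> \<in> sigma_sets (eqrels G) (local_sets G)"
      by (rule sigma_sets_UNION) (use loc in \<open>auto intro: countable_subset[OF _ D]\<close>)
    finally show ?thesis .
  qed
  then show ?thesis
    unfolding sets_borel_of topspace_eqrel_topology
    by (intro sigma_sets_eqI) (auto intro: sigma_sets.Basic local_sets_openin)
qed

lemma local_sets_Int_stable: "Int_stable (local_sets G)"
  by (auto simp: Int_stable_def local_sets_ring)

lemma local_sets_sub: "local_sets G \<subseteq> Pow (eqrels G)"
  by (auto simp: local_sets_def)

lemma continuous_map_borel_eqrel:
  fixes f :: "('g \<times> 'g) set \<Rightarrow> real"
  assumes "continuous_map (eqrel_topology G) euclideanreal f"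
  shows "f \<in> borel_measurable (borel_of (eqrel_topology G))"
proof (rule borel_measurableI)
  fix S :: "real set" assume "open S"
  then have "openin (eqrel_topology G) {r \<in> topspace (eqrel_topology G). f r \<in> S}"
    by (intro openin_continuous_map_preimage[OF assms]) simp
  moreover have "f -` S \<inter> space (borel_of (eqrel_topology G)) = {r \<in> topspace (eqrel_topology G). f r \<in> S}"
    by (auto simp: space_borel_of)
  ultimately show "f -` S \<inter> space (borel_of (eqrel_topology G)) \<in> sets (borel_of (eqrel_topology G))"
    by (simp add: sets_borel_of sigma_sets.Basic)
qed

text \<open>The sets that can be approximated by local sets form a sigma-algebra.\<close>

lemma approx_local_set:
  assumes "countable (carrier G)" "prob_space \<rho>" "sets \<rho> = sets (borel_of (eqrel_topology G))"
    and "B \<in> sets \<rho>" "\<delta> > 0"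
  shows "\<exists>B'\<in>local_sets G. measure \<rho> ((B - B') \<union> (B' - B)) < \<delta>"
proof -
  interpret prob_space \<rho> by fact
  have sets: "sets \<rho> = sigma_sets (eqrels G) (local_sets G)"
    by (simp add: assms(3) sets_borel_eqrel[OF assms(1)])
  have loc: "B \<in> sets \<rho>" if "B \<in> local_sets G" for B
    using that by (simp add: sets sigma_sets.Basic)
  have "B \<in> sigma_sets (eqrels G) (local_sets G)" using assms(4) sets by simp
  then have "\<forall>\<delta>>0. \<exists>B'\<in>local_sets G. measure \<rho> ((B - B') \<union> (B' - B)) < \<delta>"
  proof (induction rule: sigma_sets.induct)
    case (Basic B)
    then show ?case by (auto intro!: bexI[of _ B])
  next
    case Empty
    show ?case using local_sets_empty by (auto intro!: bexI[of _ "{}"])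
  next
    case (Compl B)
    show ?case
    proof (intro allI impI)
      fix \<delta> :: real assume "\<delta> > 0"
      then obtain B' where B': "B' \<in> local_sets G" "measure \<rho> ((B - B') \<union> (B' - B)) < \<delta>"
        using Compl.IH by blast
      have "B \<subseteq> eqrels G" using Compl.hyps sigma_sets_into_sp[OF local_sets_sub] by blast
      moreover have "B' \<subseteq> eqrels G" using B'(1) by (auto simp: local_sets_def)
      ultimately have "(eqrels G - B) - (eqrels G - B') \<union> ((eqrels G - B') - (eqrels G - B)) = (B - B') \<union> (B' - B)"
        by blast
      then show "\<exists>B'\<in>local_sets G. measure \<rho> ((eqrels G - B) - B' \<union> (B' - (eqrels G - B))) < \<delta>"
        using B' local_sets_ring(3)[OF B'(1,1)] by (intro bexI[of _ "eqrels G - B'"]) auto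
    qed
  next
    case (Union A)
    show ?case
    proof (intro allI impI)
      fix \<delta> :: real assume \<delta>: "\<delta> > 0"
      have A: "A i \<in> sets \<rho>" for i using Union.hyps sets by blast
      have "(\<lambda>n. measure \<rho> (\<Union>i<n. A i)) \<longlonglongrightarrow> measure \<rho> (\<Union>n. \<Union>i<n. A i)"
      proof (rule finite_Lim_measure_incseq)
        show "incseq (\<lambda>n. \<Union>i<n. A i)" unfolding incseq_def by (intro allI impI UN_mono) auto
      qed (use A in auto)
      moreover have "(\<Union>n. \<Union>i<n. A i) = (\<Union>i. A i)" by auto
      ultimately have "eventually (\<lambda>n. measure \<rho> (\<Union>i<n. A i) > measure \<rho> (\<Union>i. A i) - \<delta> / 2) sequentially"
        using \<delta> by (intro order_tendstoD) auto
      then obtain n where n: "measure \<rho> (\<Union>i<n. A i) > measure \<rho> (\<Union>i. A i) - \<delta> / 2"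
        by (auto simp: eventually_sequentially)
      \<comment> \<open>Half of \<open>\<delta>\<close> pays for stopping the union at
        \<open>n\<close>, the other half for \<open>n\<close> approximations at this price
        each.\<close>
      have "\<exists>B'\<in>local_sets G. measure \<rho> ((A i - B') \<union> (B' - A i)) < \<delta> / (2 * real (Suc n))" for i
      proof -
        have "\<delta> / (2 * real (Suc n)) > 0" using \<delta> by simp
        then show ?thesis using Union.IH[of i] by blast
      qed
      then obtain B' where B': "\<And>i. B' i \<in> local_sets G"
          "\<And>i. measure \<rho> ((A i - B' i) \<union> (B' i - A i)) < \<delta> / (2 * real (Suc n))" by metis
      define C where "C = (\<Union>i<n. B' i)"
      have C: "(\<Union>i<m. B' i) \<in> local_sets G" for m
        by (induction m) (auto simp: local_sets_empty lessThan_Suc intro: local_sets_ring B')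
      have sub: "((\<Union>i. A i) - C) \<union> (C - (\<Union>i. A i)) \<subseteq>
          ((\<Union>i. A i) - (\<Union>i<n. A i)) \<union> (\<Union>i<n. (A i - B' i) \<union> (B' i - A i))"
        by (auto simp: C_def)
      have "measure \<rho> (((\<Union>i. A i) - C) \<union> (C - (\<Union>i. A i))) \<le>
          measure \<rho> (((\<Union>i. A i) - (\<Union>i<n. A i)) \<union> (\<Union>i<n. (A i - B' i) \<union> (B' i - A i)))"
        by (rule finite_measure_mono[OF sub]) (use A loc B' in auto)
      also have "\<dots> \<le> measure \<rho> ((\<Union>i. A i) - (\<Union>i<n. A i)) + measure \<rho> (\<Union>i<n. (A i - B' i) \<union> (B' i - A i))"
        by (rule measure_Un_le) (use A loc B' in auto)
      also have "measure \<rho> ((\<Union>i. A i) - (\<Union>i<n. A i)) = measure \<rho> (\<Union>i. A i) - measure \<rho> (\<Union>i<n. A i)"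
        by (rule finite_measure_Diff) (use A in auto)
      also have "measure \<rho> (\<Union>i<n. (A i - B' i) \<union> (B' i - A i)) \<le> (\<Sum>i<n. measure \<rho> ((A i - B' i) \<union> (B' i - A i)))"
        by (rule finite_measure_subadditive_finite) (use A loc B' in auto)
      also have "\<dots> \<le> (\<Sum>i<n. \<delta> / (2 * real (Suc n)))"
        by (rule sum_mono) (use B' in \<open>auto intro: less_imp_le\<close>)
      also have "\<dots> \<le> \<delta> / 2" using \<delta> by (simp add: field_simps)
      finally have "measure \<rho> (((\<Union>i. A i) - C) \<union> (C - (\<Union>i. A i))) < \<delta>"
        using n by simp
      then show "\<exists>B'\<in>local_sets G. measure \<rho> ((\<Union> (range A) - B') \<union> (B' - \<Union> (range A))) < \<delta>"
        using C[of n] by (auto simp: C_def)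
    qed
  qed
  then show ?thesis using assms(5) by blast
qed

text \<open>Layer cake: up to \<open>1 / n\<close>, \<open>f\<close> is the average of the
  indicators of its level sets. Each level set is replaced by a local set, and an average of
  indicators automatically has values between 0 and 1.\<close>

lemma approx_local_function:
  fixes f :: "('g \<times> 'g) set \<Rightarrow> real"
  assumes "countable (carrier G)" "prob_space \<rho>" "sets \<rho> = sets (borel_of (eqrel_topology G))"
    and f: "f \<in> borel_measurable \<rho>" "\<And>r. r \<in> space \<rho> \<Longrightarrow> 0 \<le> f r \<and> f r \<le> 1" and "\<delta> > 0"
  shows "\<exists>h. local_map G h \<and> (\<forall>r. 0 \<le> h r \<and> h r \<le> (1 :: real)) \<and> (\<integral>r. \<bar>f r - h r\<bar> \<partial>\<rho>) < \<delta>"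
proof -
  interpret prob_space \<rho> by fact
  have sp: "space \<rho> = eqrels G" using sets_eq_imp_space_eq[OF assms(3)] by (simp add: space_borel_eqrel)
  have locs: "B \<in> sets \<rho>" if "B \<in> local_sets G" for B
    using that assms(1,3) by (simp add: sets_borel_eqrel sigma_sets.Basic)
  obtain N :: nat where N: "1 / real (Suc N) < \<delta> / 2"
    using nat_approx_posE[of "\<delta> / 2"] \<open>\<delta> > 0\<close> by auto
  define n where "n = Suc N"
  have n: "n > 0" "1 / real n < \<delta> / 2" using N by (simp_all add: n_def)
  define A where "A = (\<lambda>i. {r \<in> space \<rho>. f r \<ge> real (Suc i) / real n})"
  have A: "A i \<in> sets \<rho>" for i unfolding A_def using f(1) by measurable
  have "\<exists>B\<in>local_sets G. measure \<rho> ((A i - B) \<union> (B - A i)) < \<delta> / 2" for i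
    by (rule approx_local_set[OF assms(1-3) A]) (use \<open>\<delta> > 0\<close> in simp)
  then obtain B where B: "\<And>i. B i \<in> local_sets G" "\<And>i. measure \<rho> ((A i - B i) \<union> (B i - A i)) < \<delta> / 2"
    by metis
  define h where "h = (\<lambda>r. (\<Sum>i<n. indicator (B i) r :: real) / real n)"
  have "local_map G (\<lambda>r. indicator (B i) r :: real)" for i
    unfolding indicator_def
    by (rule local_compose[of G "\<lambda>r. r \<in> B i" of_bool]) (use B(1)[of i] in \<open>simp add: local_sets_def\<close>)
  then have "local_map G h"
    unfolding h_def by (intro local_compose[of _ _ "\<lambda>x. x / real n"] local_sum) auto
  moreover have "0 \<le> h r \<and> h r \<le> 1" for r
  proof -
    have "(\<Sum>i<n. indicator (B i) r :: real) \<le> (\<Sum>i<n. 1)" by (rule sum_mono) (simp add: indicator_def)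
    then show ?thesis using n(1) unfolding h_def by (auto intro!: divide_nonneg_nonneg sum_nonneg simp: divide_le_eq)
  qed
  moreover have "(\<integral>r. \<bar>f r - h r\<bar> \<partial>\<rho>) < \<delta>"
  proof -
    have pt: "\<bar>f r - h r\<bar> \<le> 1 / real n + (\<Sum>i<n. indicator ((A i - B i) \<union> (B i - A i)) r) / real n"
      if r: "r \<in> space \<rho>" for r
    proof -
      \<comment> \<open>Exactly the level sets \<open>A i\<close> with \<open>i < k\<close> contain
        \<open>r\<close>; starting the levels at \<open>Suc i\<close> makes their number this
        floor.\<close>
      define k where "k = nat \<lfloor>f r * real n\<rfloor>"
      have fr: "0 \<le> f r" "f r \<le> 1" using f(2)[OF r] by auto
      have k: "real k \<le> f r * real n" "f r * real n < real k + 1"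
        using fr unfolding k_def by (simp_all add: of_nat_nat)
      have "k \<le> n" using k(1) fr(2) n(1) by (metis mult_left_le_one_le mult.commute of_nat_0_le_iff of_nat_le_iff order_trans fr(1))
      have "indicator (A i) r = (if i < k then 1 else 0 :: real)" if "i < n" for i
      proof -
        have "r \<in> A i \<longleftrightarrow> real (Suc i) \<le> f r * real n" using r n(1) by (simp add: A_def field_simps)
        also have "\<dots> \<longleftrightarrow> i < k" using k by linarith
        finally show ?thesis by (simp add: indicator_def)
      qed
      then have "(\<Sum>i<n. indicator (A i) r :: real) = (\<Sum>i<n. if i < k then 1 else 0)" by simp
      also have "\<dots> = real (card {i\<in>{..<n}. i < k})" by (simp add: sum.inter_filter[symmetric])
      also have "{i\<in>{..<n}. i < k} = {..<k}" using \<open>k \<le> n\<close> by auto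
      finally have sumA: "(\<Sum>i<n. indicator (A i) r :: real) = real k" by simp
      have "\<bar>f r - real k / real n\<bar> \<le> 1 / real n"
      proof -
        have "f r - real k / real n = (f r * real n - real k) / real n"
          using n(1) by (simp add: field_simps)
        then have "\<bar>f r - real k / real n\<bar> = \<bar>f r * real n - real k\<bar> / real n" by (simp add: abs_divide)
        also have "\<dots> \<le> 1 / real n" using k by (intro divide_right_mono) auto
        finally show ?thesis .
      qed
      moreover have "\<bar>real k / real n - h r\<bar> \<le> (\<Sum>i<n. indicator ((A i - B i) \<union> (B i - A i)) r) / real n"
      proof -
        have "\<bar>real k / real n - h r\<bar> = \<bar>\<Sum>i<n. indicator (A i) r - indicator (B i) r :: real\<bar> / real n"
          unfolding h_def sumA[symmetric] by (simp add: sum_subtractf diff_divide_distrib[symmetric] abs_divide)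
        also have "\<dots> \<le> (\<Sum>i<n. \<bar>indicator (A i) r - indicator (B i) r :: real\<bar>) / real n"
          by (intro divide_right_mono sum_abs) simp
        also have "\<dots> = (\<Sum>i<n. indicator ((A i - B i) \<union> (B i - A i)) r) / real n"
          by (intro arg_cong2[where f = "(/)"] sum.cong refl) (auto simp: indicator_def)
        finally show ?thesis .
      qed
      ultimately show ?thesis by linarith
    qed
    have D: "(A i - B i) \<union> (B i - A i) \<in> sets \<rho>" for i using A locs[OF B(1)] by auto
    have "h \<in> borel_measurable \<rho>"
      unfolding h_def using locs[OF B(1)] by measurable
    then have "(\<integral>r. \<bar>f r - h r\<bar> \<partial>\<rho>) \<le>
        (\<integral>r. 1 / real n + (\<Sum>i<n. indicator ((A i - B i) \<union> (B i - A i)) r) / real n \<partial>\<rho>)"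
      using f(1) D pt
      by (intro integral_mono_AE' Bochner_Integration.integrable_add integrable_divide Bochner_Integration.integrable_sum integrable_real_indicator)
         (auto simp: less_top[symmetric] emeasure_eq_measure intro!: AE_I2 add_nonneg_nonneg divide_nonneg_nonneg sum_nonneg)
    also have "\<dots> = 1 / real n + (\<Sum>i<n. measure \<rho> ((A i - B i) \<union> (B i - A i))) / real n"
      using D by (subst Bochner_Integration.integral_add) (auto simp: prob_space less_top[symmetric] emeasure_eq_measure)
    also have "\<dots> \<le> 1 / real n + (\<Sum>i<n. \<delta> / 2) / real n"
      by (intro add_left_mono divide_right_mono sum_mono) (use B(2) in \<open>auto intro: less_imp_le\<close>)
    also have "\<dots> < \<delta>" using n by simp
    finally show ?thesis .
  qed
  ultimately show ?thesis by blast
qed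

section \<open>Weak compactness\<close>

text \<open>Reflexivity, symmetry and transitivity are closed conditions on coordinates, so they cut
  a closed set \<open>S\<close> out of a compact product. As the topology is a pullback to relations
  and not a subspace of functions, compactness is carried over by \<open>dec\<close>, which is
  continuous and onto.\<close>

lemma compact_space_eqrel: "compact_space (eqrel_topology G)"
proof -
  define P where "P = carrier G \<times> carrier G"
  define cf where "cf = (\<lambda>r :: ('a \<times> 'a) set. restrict (\<lambda>p. p \<in> r) P)"
  define T where "T = product_topology (\<lambda>_. discrete_topology (UNIV :: bool set)) P"
  define dec where "dec = (\<lambda>f. {p \<in> P. f p})"
  have E: "eqrel_topology G = pullback_topology (eqrels G) cf T"
    by (simp add: eqrel_topology_def P_def cf_def T_def)
  have topT: "topspace T = extensional P" by (simp add: T_def PiE_def)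
  have T: "compact_space T"
    unfolding T_def by (simp add: compact_space_product_topology compact_space_discrete_topology)
  have coord: "continuous_map T (discrete_topology UNIV) (\<lambda>f. f i)" if "i \<in> P" for i
    unfolding T_def by (rule continuous_map_product_projection[OF that])
  have clopen: "closedin T {f \<in> topspace T. f i}" "closedin T {f \<in> topspace T. \<not> f i}" if "i \<in> P" for i
    using closedin_continuous_map_preimage[OF coord[OF that], of "{True}"]
      closedin_continuous_map_preimage[OF coord[OF that], of "{False}"] by simp_all
  have imp: "closedin T {f \<in> topspace T. f i \<longrightarrow> f j}" if "i \<in> P" "j \<in> P" for i j
  proof -
    have "{f \<in> topspace T. f i \<longrightarrow> f j} = {f \<in> topspace T. \<not> f i} \<union> {f \<in> topspace T. f j}" by auto
    then show ?thesis using clopen that by (simp add: closedin_Un)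
  qed
  have imp2: "closedin T {f \<in> topspace T. f i \<longrightarrow> f j \<longrightarrow> f k}" if "i \<in> P" "j \<in> P" "k \<in> P" for i j k
  proof -
    have "{f \<in> topspace T. f i \<longrightarrow> f j \<longrightarrow> f k} = {f \<in> topspace T. \<not> f i} \<union> {f \<in> topspace T. f j \<longrightarrow> f k}" by auto
    then show ?thesis using clopen imp that by (simp add: closedin_Un)
  qed
  define S where "S = {f \<in> topspace T. (\<forall>a\<in>carrier G. f (a, a)) \<and>
      (\<forall>a\<in>carrier G. \<forall>b\<in>carrier G. f (a, b) \<longrightarrow> f (b, a)) \<and>
      (\<forall>a\<in>carrier G. \<forall>b\<in>carrier G. \<forall>c\<in>carrier G. f (a, b) \<longrightarrow> f (b, c) \<longrightarrow> f (a, c))}"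
  have "closedin T S"
    unfolding S_def
    by (intro closedin_Collect_conj closedin_Collect_ball clopen imp imp2) (auto simp: P_def)
  then have S: "compact_space (subtopology T S)"
    using T closedin_compact_space compact_space_subtopology by blast
  have dec_eqrels: "dec f \<in> eqrels G" if "f \<in> S" for f
  proof -
    have "equiv (carrier G) (dec f)"
    proof (rule equivI)
      show "refl_on (carrier G) (dec f)" using that by (auto simp: refl_on_def S_def dec_def P_def)
      show "sym (dec f)" using that by (auto simp: sym_def S_def dec_def P_def)
      show "trans (dec f)" using that unfolding trans_def S_def dec_def P_def by blast
    qed (auto simp: dec_def P_def)
    then show ?thesis by (simp add: eqrels_def)
  qed
  have "continuous_map (subtopology T S) (eqrel_topology G) dec"
    unfolding E
  proof (rule continuous_map_pullback')
    show "continuous_map (subtopology T S) T (cf \<circ> dec)"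
    proof (rule continuous_map_eq[of _ _ id])
      show "continuous_map (subtopology T S) T id"
        by (rule continuous_map_from_subtopology) simp
      fix f assume "f \<in> topspace (subtopology T S)"
      then have "f \<in> extensional P" using topT by auto
      then show "id f = (cf \<circ> dec) f"
        by (auto simp: cf_def dec_def fun_eq_iff extensional_def)
    qed
    show "topspace (subtopology T S) \<subseteq> dec -` eqrels G"
      using dec_eqrels by auto
  qed
  then have "compactin (eqrel_topology G) (dec ` topspace (subtopology T S))"
    using S by (intro image_compactin) (auto simp: compact_space_def)
  moreover have "dec ` topspace (subtopology T S) = eqrels G"
  proof
    show "dec ` topspace (subtopology T S) \<subseteq> eqrels G" using dec_eqrels by auto
    show "eqrels G \<subseteq> dec ` topspace (subtopology T S)"
    proof
      fix r assume "r \<in> eqrels G"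
      then have r: "r \<subseteq> P" "refl_on (carrier G) r" "sym r" "trans r"
        by (auto simp: eqrels_def equiv_def P_def refl_on_def)
      have mem: "cf r (a, b) \<longleftrightarrow> (a, b) \<in> r" if "a \<in> carrier G" "b \<in> carrier G" for a b
        using that by (simp add: cf_def P_def)
      have "cf r \<in> topspace T" by (simp add: topT cf_def)
      then have "cf r \<in> S"
        unfolding S_def
      proof (intro CollectI conjI ballI impI)
        fix a assume a: "a \<in> carrier G"
        show "cf r (a, a)" using refl_onD[OF r(2) a] mem[OF a a] by blast
        fix b assume b: "b \<in> carrier G"
        show "cf r (b, a)" if "cf r (a, b)"
          using symD[OF r(3), of a b] that mem[OF a b] mem[OF b a] by blast
        fix c assume c: "c \<in> carrier G"
        show "cf r (a, c)" if "cf r (a, b)" "cf r (b, c)"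
          using transD[OF r(4), of a b c] that mem[OF a b] mem[OF b c] mem[OF a c] by blast
      qed
      moreover have "dec (cf r) = r" using r(1) by (auto simp: dec_def cf_def)
      ultimately show "r \<in> dec ` topspace (subtopology T S)"
        by (intro image_eqI[of _ _ "cf r"]) (auto simp: topT cf_def)
    qed
  qed
  ultimately show ?thesis by (simp add: compact_space_def topspace_eqrel_topology)
qed

lemma suminf_third_tail: "(\<Sum>k. (1 / 3) ^ (k + N)) = (1 / 3 :: real) ^ N * (3 / 2)"
proof -
  have "(\<Sum>k. (1 / 3 :: real) ^ (k + N)) = (\<Sum>k. (1 / 3) ^ N * (1 / 3) ^ k)"
    by (simp add: power_add mult.commute)
  also have "\<dots> = (1 / 3) ^ N * (\<Sum>k. (1 / 3) ^ k)"
    by (rule suminf_mult) (simp add: summable_geometric)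
  finally show ?thesis by (simp add: suminf_geometric)
qed

text \<open>Base 3 rather than 2 makes expansions with digits 0 and 1 unique.\<close>

lemma eqrel_real_embedding:
  assumes "countable (carrier G)" "carrier G \<noteq> {}"
  obtains code :: "('g \<times> 'g) set \<Rightarrow> real" where
    "continuous_map (eqrel_topology (G :: ('g, 'b) monoid_scheme)) euclideanreal code"
    "inj_on code (eqrels G)" "\<And>r. 0 \<le> code r \<and> code r \<le> 3 / 2"
proof -
  define P where "P = carrier G \<times> carrier G"
  define p where "p = from_nat_into P"
  have p: "range p = P"
    unfolding p_def by (rule range_from_nat_into) (use assms in \<open>auto simp: P_def\<close>)
  define code where "code = (\<lambda>r. \<Sum>k. (1 / 3 :: real) ^ k * of_bool (p k \<in> r))"
  have third: "summable (\<lambda>k. (1 / 3 :: real) ^ k)" by (simp add: summable_geometric)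
  have sm: "summable (\<lambda>k. (1 / 3 :: real) ^ k * of_bool (p k \<in> r))" for r
    by (rule summable_comparison_test'[OF third]) simp
  define d where "d = (\<lambda>r r' k. (1 / 3 :: real) ^ k * of_bool (p k \<in> r) - (1 / 3) ^ k * of_bool (p k \<in> r'))"
  have d_sm: "summable (d r r')" for r r' unfolding d_def by (intro summable_diff sm)
  have d_le: "\<bar>d r r' k\<bar> \<le> (1 / 3) ^ k" for r r' k by (simp add: d_def)
  have code_diff: "code r - code r' = (\<Sum>k. d r r' k)" for r r'
    unfolding code_def d_def by (rule suminf_diff[OF sm sm])
  have tail: "\<bar>\<Sum>k. d r r' (k + N)\<bar> \<le> (1 / 3) ^ N * (3 / 2)" for r r' N
  proof -
    have s3: "summable (\<lambda>k. (1 / 3 :: real) ^ (k + N))" using summable_ignore_initial_segment[OF third] .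
    have "norm (\<Sum>k. d r r' (k + N)) \<le> (\<Sum>k. (1 / 3) ^ (k + N))"
      by (rule norm_suminf_le[OF _ s3]) (use d_le in simp)
    then show ?thesis by (simp add: suminf_third_tail)
  qed
  show ?thesis
  proof (rule that[of code])
    show "continuous_map (eqrel_topology G) euclideanreal code"
    proof -
      have "openin (eqrel_topology G) {r \<in> eqrels G. code r \<in> U}" if U: "open U" for U
        unfolding openin_eqrel_topology
      proof (intro conjI ballI)
        fix r assume r: "r \<in> {r \<in> eqrels G. code r \<in> U}"
        then obtain e where e: "e > 0" "\<And>y. dist y (code r) < e \<Longrightarrow> y \<in> U"
          using U unfolding open_dist by blast
        obtain N where N: "(1 / 3 :: real) ^ N < e / (3 / 2)"
          using real_arch_pow_inv[of "e / (3 / 2)" "1 / 3"] e(1) by auto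
        have N': "(1 / 3 :: real) ^ N * (3 / 2) < e"
          using mult_strict_right_mono[OF N, of "3 / 2"] by simp
        define W where "W = p ` {..<N}"
        have "r' \<in> {r \<in> eqrels G. code r \<in> U}" if r': "r' \<in> eqrels G" "r' \<inter> W = r \<inter> W" for r'
        proof -
          have "d r' r k = 0" if "k < N" for k
          proof -
            have "p k \<in> W" using that by (auto simp: W_def)
            then have "p k \<in> r' \<longleftrightarrow> p k \<in> r" using r'(2) by blast
            then show ?thesis by (simp add: d_def)
          qed
          then have "code r' - code r = (\<Sum>k. d r' r (k + N))"
            using suminf_split_initial_segment[OF d_sm[of r' r], of N] by (simp add: code_diff)
          then have "\<bar>code r' - code r\<bar> < e" using tail[of r' r N] N' by linarith
          then show ?thesis using e(2) r' by (simp add: dist_real_def)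
        qed
        then show "\<exists>W. finite W \<and> W \<subseteq> carrier G \<times> carrier G \<and>
            (\<forall>r'\<in>eqrels G. r' \<inter> W = r \<inter> W \<longrightarrow> r' \<in> {r \<in> eqrels G. code r \<in> U})"
          using p by (intro exI[of _ W] conjI) (auto simp: W_def P_def)
      qed auto
      then show ?thesis by (simp add: continuous_map_def topspace_eqrel_topology)
    qed
    show "inj_on code (eqrels G)"
    proof (rule inj_onI, rule ccontr)
      fix r r' assume r: "r \<in> eqrels G" "r' \<in> eqrels G" "code r = code r'" "r \<noteq> r'"
      have "r \<subseteq> P" "r' \<subseteq> P" using r(1,2) by (auto simp: eqrels_def equiv_def P_def refl_on_def)
      then have "\<exists>k. (p k \<in> r) \<noteq> (p k \<in> r')" using r(4) p by blast
      \<comment> \<open>At the first differing digit the codes differ by \<open>(1 / 3) ^ N\<close>,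
        and all later digits together make up for at most half of that.\<close>
      define N where "N = (LEAST k. (p k \<in> r) \<noteq> (p k \<in> r'))"
      have N: "(p N \<in> r) \<noteq> (p N \<in> r')" unfolding N_def by (rule LeastI_ex) fact
      have "d r r' k = 0" if "k < N" for k
        using not_less_Least[of k "\<lambda>k. (p k \<in> r) \<noteq> (p k \<in> r')"] that by (auto simp: d_def N_def)
      then have "code r - code r' = d r r' N + (\<Sum>k. d r r' (k + Suc N))"
        using suminf_split_initial_segment[OF d_sm[of r r'], of "Suc N"] by (simp add: code_diff)
      moreover have "\<bar>d r r' N\<bar> = (1 / 3) ^ N" using N by (auto simp: d_def)
      moreover have "\<bar>\<Sum>k. d r r' (k + Suc N)\<bar> \<le> (1 / 3) ^ N / 2" using tail[of r r' "Suc N"] by simp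
      moreover have "(1 / 3 :: real) ^ N > 0" by simp
      ultimately show False using r(3) by linarith
    qed
    fix r
    have "code r \<le> (\<Sum>k. (1 / 3) ^ k)"
      unfolding code_def by (rule suminf_le[OF _ sm third]) simp
    moreover have "0 \<le> code r" unfolding code_def by (rule suminf_nonneg[OF sm]) simp
    ultimately show "0 \<le> code r \<and> code r \<le> 3 / 2" by (simp add: suminf_geometric)
  qed
qed

text \<open>Prokhorov's theorem for this compact space, reduced to the real line: push the measures
  forward along the embedding \<open>code\<close>, extract a weak limit there by tightness, and pull
  it back along the inverse. Compactness makes the image closed, so the limit is still carried by
  it.\<close>

theorem weakly_convergent_subsequence:
  fixes G :: "('g, 'b) monoid_scheme" and \<rho> :: "nat \<Rightarrow> ('g \<times> 'g) set measure"
  assumes "countable (carrier G)" "carrier G \<noteq> {}"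
    and \<rho>: "\<And>n. prob_space (\<rho> n)" "\<And>n. sets (\<rho> n) = sets (borel_of (eqrel_topology G))"
  obtains s :: "nat \<Rightarrow> nat" and \<rho>' where "strict_mono s" "prob_space \<rho>'"
    "sets \<rho>' = sets (borel_of (eqrel_topology G))" "weakly_converges G (\<lambda>n. \<rho> (s n)) \<rho>'"
proof -
  define E where "E = eqrel_topology G"
  have topE: "topspace E = eqrels G" by (simp add: E_def topspace_eqrel_topology)
  have space_\<rho>: "space (\<rho> n) = eqrels G" for n
    using sets_eq_imp_space_eq[OF \<rho>(2)] by (simp add: space_borel_eqrel)
  have E_compact: "compact_space E" unfolding E_def by (rule compact_space_eqrel)
  obtain code :: "('g \<times> 'g) set \<Rightarrow> real" where code: "continuous_map E euclideanreal code"
    "inj_on code (eqrels G)" "\<And>r. 0 \<le> code r \<and> code r \<le> 3 / 2"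
    using eqrel_real_embedding[OF assms(1,2)] unfolding E_def by metis
  have image_closed: "closed (code ` C)" if "closedin E C" for C
  proof -
    have "compactin euclideanreal (code ` C)"
      by (rule image_compactin[OF closedin_compact_space[OF E_compact that] code(1)])
    then show ?thesis by (simp add: compact_imp_closed)
  qed
  define Z where "Z = code ` eqrels G"
  have Z: "closed Z" unfolding Z_def using image_closed[OF closedin_topspace] by (simp add: topE)
  define r0 where "r0 = carrier G \<times> carrier G"
  have r0: "r0 \<in> eqrels G" by (auto simp: r0_def eqrels_def equiv_def refl_on_def sym_def trans_def)
  have Z_ne: "Z \<noteq> {}" using r0 by (auto simp: Z_def)
  \<comment> \<open>Off the image \<open>Z\<close> the inverse takes the default value
    \<open>r0\<close>; the limit measure does not see it, but \<open>dec\<close> has to be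
    measurable on the whole line.\<close>
  define dec where "dec = (\<lambda>t. if t \<in> Z then inv_into (eqrels G) code t else r0)"
  have dec_code: "dec (code r) = r" if "r \<in> eqrels G" for r
    using that code(2) by (simp add: dec_def Z_def)
  have dec_in: "dec t \<in> eqrels G" for t
    using r0 by (auto simp: dec_def Z_def inv_into_into)
  have dec_meas: "dec \<in> borel \<rightarrow>\<^sub>M borel_of E"
  proof (rule measurable_sigma_sets[OF sets_borel_of])
    show "{U. openin E U} \<subseteq> Pow (topspace E)" using openin_subset by blast
    show "dec \<in> space borel \<rightarrow> topspace E" using dec_in topE by auto
    fix U assume "U \<in> {U. openin E U}"
    then have U: "openin E U" "U \<subseteq> eqrels G" using openin_subset topE by blast+
    have "dec -` U \<inter> space borel = (Z - code ` (eqrels G - U)) \<union> (if r0 \<in> U then - Z else {})"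
    proof (rule Set.set_eqI)
      fix t
      show "t \<in> dec -` U \<inter> space borel \<longleftrightarrow> t \<in> (Z - code ` (eqrels G - U)) \<union> (if r0 \<in> U then - Z else {})"
      proof (cases "t \<in> Z")
        case True
        then obtain r where r: "r \<in> eqrels G" "t = code r" by (auto simp: Z_def)
        have "t \<in> code ` (eqrels G - U) \<longleftrightarrow> r \<notin> U"
          using r code(2) by (auto dest: inj_onD)
        then show ?thesis using True dec_code[OF r(1)] r(2) by auto
      qed (auto simp: dec_def)
    qed
    moreover have "closed (code ` (eqrels G - U))"
      using image_closed[OF closedin_diff[OF closedin_topspace U(1)]] by (simp add: topE)
    ultimately show "dec -` U \<inter> space borel \<in> sets borel" using Z by auto
  qed
  have code_meas: "code \<in> borel_measurable (\<rho> n)" for n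
    using continuous_map_borel_eqrel[OF code(1)[unfolded E_def]] measurable_cong_sets[OF \<rho>(2) refl] by blast
  define \<nu> where "\<nu> = (\<lambda>n. distr (\<rho> n) borel code)"
  have \<nu>: "real_distribution (\<nu> n)" for n
    unfolding \<nu>_def by (rule prob_space.real_distribution_distr[OF \<rho>(1) code_meas])
  have "tight \<nu>"
    unfolding tight_def
  proof (intro conjI allI impI)
    fix \<epsilon> :: real assume "\<epsilon> > 0"
    have "measure (\<nu> n) {-1<..2} = 1" for n
    proof -
      interpret prob_space "\<rho> n" by (rule \<rho>(1))
      have "-1 < code r \<and> code r \<le> 2" for r using code(3)[of r] by simp
      then have "code -` {-1<..2} \<inter> space (\<rho> n) = space (\<rho> n)" by auto
      then show ?thesis unfolding \<nu>_def
        by (subst measure_distr[OF code_meas]) (auto simp: prob_space)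
    qed
    then show "\<exists>a b. a < b \<and> (\<forall>n. 1 - \<epsilon> < measure (\<nu> n) {a<..b})"
      using \<open>\<epsilon> > 0\<close> by (intro exI[of _ "-1"] exI[of _ 2]) auto
  qed (rule \<nu>)
  from tight_imp_convergent_subsubsequence[OF this strict_mono_id]
  obtain s :: "nat \<Rightarrow> nat" and M where s: "strict_mono s" and M: "real_distribution M"
    and conv: "weak_conv_m (\<nu> \<circ> id \<circ> s) M" by blast
  interpret M: real_distribution M by (rule M)
  have conv_int: "(\<lambda>n. \<integral>r. g (code r) \<partial>\<rho> (s n)) \<longlonglongrightarrow> (\<integral>t. g t \<partial>M)"
    if g: "continuous_on UNIV g" "\<And>t. norm (g t) \<le> B" for g :: "real \<Rightarrow> real" and B
  proof -
    have "(\<lambda>n. \<integral>t. g t \<partial>((\<nu> \<circ> id \<circ> s) n)) \<longlonglongrightarrow> (\<integral>t. g t \<partial>M)"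
      by (rule weak_conv_imp_integral_bdd_continuous_conv[OF _ M conv _ g(2)])
         (use \<nu> g(1) in \<open>auto simp: continuous_on_eq_continuous_at\<close>)
    moreover have "(\<integral>t. g t \<partial>((\<nu> \<circ> id \<circ> s) n)) = (\<integral>r. g (code r) \<partial>\<rho> (s n))" for n
      unfolding \<nu>_def comp_def id_def
      by (rule integral_distr[OF code_meas]) (use g(1) in \<open>auto intro: borel_measurable_continuous_onI\<close>)
    ultimately show ?thesis by simp
  qed
  \<comment> \<open>The distance to \<open>Z\<close>, truncated at 1, is a bounded continuous test
    function with integral 0 for all pushed-forward measures, hence for the limit; as
    \<open>Z\<close> is closed, its zeros lie in \<open>Z\<close>.\<close>
  have AE_Z: "AE t in M. t \<in> Z"
  proof -
    define g where "g = (\<lambda>t. min 1 (infdist t Z))"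
    have g: "continuous_on UNIV g" "\<And>t. norm (g t) \<le> 1" "\<And>t. 0 \<le> g t"
      unfolding g_def by (auto intro!: continuous_intros simp: infdist_nonneg)
    have "(\<integral>r. g (code r) \<partial>\<rho> (s n)) = 0" for n
    proof -
      have "(\<integral>r. g (code r) \<partial>\<rho> (s n)) = (\<integral>r. 0 \<partial>\<rho> (s n))"
        by (rule Bochner_Integration.integral_cong) (auto simp: g_def space_\<rho> Z_def)
      then show ?thesis by simp
    qed
    then have "(\<integral>t. g t \<partial>M) = 0"
      using conv_int[OF g(1,2)] by (simp add: LIMSEQ_const_iff)
    moreover have "integrable M g"
    proof (rule M.integrable_const_bound[of _ 1])
      show "g \<in> borel_measurable M"
        using borel_measurable_continuous_onI[OF g(1)] measurable_cong_sets[OF M.events_eq_borel refl] by blast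
    qed (use g in auto)
    ultimately have "AE t in M. g t = 0"
      using g(3) by (subst (asm) integral_nonneg_eq_0_iff_AE) auto
    then show ?thesis
    proof eventually_elim
      case (elim t)
      then have "infdist t Z = 0" by (auto simp: g_def min_def split: if_splits)
      then show ?case using in_closed_iff_infdist_zero[OF Z Z_ne] by blast
    qed
  qed
  have dec_M: "dec \<in> M \<rightarrow>\<^sub>M borel_of E"
    using dec_meas measurable_cong_sets[OF M.events_eq_borel refl] by blast
  define \<rho>' where "\<rho>' = distr M (borel_of E) dec"
  show ?thesis
  proof (rule that[OF s, of \<rho>'])
    show "prob_space \<rho>'" unfolding \<rho>'_def by (rule M.prob_space_distr[OF dec_M])
    show "sets \<rho>' = sets (borel_of (eqrel_topology G))" by (simp add: \<rho>'_def E_def)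
    show "weakly_converges G (\<lambda>n. \<rho> (s n)) \<rho>'"
      unfolding weakly_converges_def
    proof (intro allI impI)
      fix f :: "('g \<times> 'g) set \<Rightarrow> real" assume f: "continuous_map (eqrel_topology G) euclideanreal f"
      then have fE: "continuous_map E euclideanreal f" by (simp add: E_def)
      have "compact (f ` eqrels G)"
        using image_compactin[OF E_compact[unfolded compact_space_def] fE] by (simp add: topE)
      then obtain B where B: "\<And>r. r \<in> eqrels G \<Longrightarrow> \<bar>f r\<bar> \<le> B"
        using compact_imp_bounded bounded_real by (metis (no_types, lifting) image_eqI)
      \<comment> \<open>Weak convergence on the line tests functions continuous on all of it, while
        \<open>f (dec t)\<close> is known to be continuous on \<open>Z\<close> only; Tietze's
        theorem extends it with the same bound.\<close>
      have "continuous_on Z (\<lambda>t. f (dec t))"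
        unfolding continuous_on_closed_vimage[OF Z]
      proof (intro allI impI)
        fix C :: "real set" assume "closed C"
        then have "closedin E {r \<in> topspace E. f r \<in> C}"
          by (intro closedin_continuous_map_preimage[OF fE]) simp
        then have "closed (code ` {r \<in> topspace E. f r \<in> C})" by (rule image_closed)
        moreover have "code ` {r \<in> topspace E. f r \<in> C} = (\<lambda>t. f (dec t)) -` C \<inter> Z"
          unfolding Z_def topE using dec_code by auto
        ultimately show "closed ((\<lambda>t. f (dec t)) -` C \<inter> Z)" by simp
      qed
      moreover have "closedin (top_of_set UNIV) Z" using Z by simp
      moreover have "0 \<le> B" using B[OF r0] by linarith
      moreover have "norm (f (dec t)) \<le> B" for t using B[OF dec_in] by simp
      ultimately obtain g where g: "continuous_on UNIV g" "\<And>t. t \<in> Z \<Longrightarrow> g t = f (dec t)"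
        "\<And>t. norm (g t) \<le> B"
        using Tietze[of Z "\<lambda>t. f (dec t)" UNIV B] by auto
      have f_meas: "f \<in> borel_measurable (borel_of E)"
        unfolding E_def by (rule continuous_map_borel_eqrel[OF f])
      have "(\<integral>r. f r \<partial>\<rho>') = (\<integral>t. f (dec t) \<partial>M)"
        unfolding \<rho>'_def by (rule integral_distr[OF dec_M f_meas])
      also have "\<dots> = (\<integral>t. g t \<partial>M)"
      proof (rule integral_cong_AE)
        show "(\<lambda>t. f (dec t)) \<in> borel_measurable M" using measurable_compose[OF dec_M f_meas] .
        show "g \<in> borel_measurable M"
          using borel_measurable_continuous_onI[OF g(1)] measurable_cong_sets[OF M.events_eq_borel refl] by blast
        show "AE t in M. f (dec t) = g t" using AE_Z by eventually_elim (simp add: g(2))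
      qed
      finally have lim: "(\<integral>r. f r \<partial>\<rho>') = (\<integral>t. g t \<partial>M)" .
      have "(\<integral>r. g (code r) \<partial>\<rho> n) = (\<integral>r. f r \<partial>\<rho> n)" for n
        by (rule Bochner_Integration.integral_cong)
           (use g(2) dec_code in \<open>auto simp: space_\<rho> Z_def\<close>)
      then show "(\<lambda>n. \<integral>r. f r \<partial>\<rho> (s n)) \<longlonglongrightarrow> (\<integral>r. f r \<partial>\<rho>')"
        using conv_int[OF g(1,3)] by (simp add: lim)
    qed
  qed
qed

section \<open>Shifts and local kernels\<close>

context group
begin

lemma shift_mem:
  assumes "g \<in> carrier G" "a \<in> carrier G" "b \<in> carrier G"
  shows "(a, b) \<in> shift G g r \<longleftrightarrow> (inv g \<otimes> a, inv g \<otimes> b) \<in> r"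
  using assms by (simp add: shift_def)

lemma shift_shift:
  assumes "g \<in> carrier G" "h \<in> carrier G"
  shows "shift G g (shift G h r) = shift G (g \<otimes> h) r"
  using assms by (auto simp: shift_def inv_mult_group m_assoc)

lemma local_shift:
  assumes g: "g \<in> carrier G" and f: "local_map G f"
  shows "local_map G (\<lambda>r. f (shift G g r))"
proof -
  obtain W where W: "finite W" "W \<subseteq> carrier G \<times> carrier G" "determined_by G W f"
    by (rule local_mapE[OF f]) blast
  define W' where "W' = (\<lambda>(a, b). (inv g \<otimes> a, inv g \<otimes> b)) ` W"
  show ?thesis
  proof (rule local_mapI[of W'])
    show "W' \<subseteq> carrier G \<times> carrier G" using W(2) g by (auto simp: W'_def)
    fix r r' assume r: "r \<in> eqrels G" "r' \<in> eqrels G" "r \<inter> W' = r' \<inter> W'"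
    have "(a, b) \<in> shift G g r \<longleftrightarrow> (a, b) \<in> shift G g r'" if ab: "(a, b) \<in> W" for a b
    proof -
      have "(inv g \<otimes> a, inv g \<otimes> b) \<in> W'" using ab by (force simp: W'_def)
      then have "(inv g \<otimes> a, inv g \<otimes> b) \<in> r \<longleftrightarrow> (inv g \<otimes> a, inv g \<otimes> b) \<in> r'" using r(3) by blast
      then show ?thesis using ab W(2) by (auto simp: shift_def)
    qed
    then have "shift G g r \<inter> W = shift G g r' \<inter> W" by auto
    then show "f (shift G g r) = f (shift G g r')"
      by (rule determined_byD[OF W(3) shift_eqrels[OF is_group g r(1)] shift_eqrels[OF is_group g r(2)]])
  qed (use W in \<open>simp add: W'_def\<close>)
qed

lemma shift_measurable:
  assumes "countable (carrier G)" "g \<in> carrier G"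
  shows "shift G g \<in> borel_of (eqrel_topology G) \<rightarrow>\<^sub>M borel_of (eqrel_topology G)"
proof (rule measurable_sigma_sets[OF sets_borel_eqrel[OF assms(1)] local_sets_sub])
  show "shift G g \<in> space (borel_of (eqrel_topology G)) \<rightarrow> eqrels G"
    using shift_eqrels[OF is_group assms(2)] by (simp add: space_borel_eqrel)
  fix B assume "B \<in> local_sets G"
  then have "local_map G (\<lambda>r. shift G g r \<in> B)"
    using local_shift[OF assms(2), of "\<lambda>r. r \<in> B"] by (simp add: local_sets_def)
  then have "{r \<in> eqrels G. shift G g r \<in> B} \<in> local_sets G" by (rule local_setsI)
  moreover have "shift G g -` B \<inter> space (borel_of (eqrel_topology G)) = {r \<in> eqrels G. shift G g r \<in> B}"
    by (auto simp: space_borel_eqrel)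
  ultimately show "shift G g -` B \<inter> space (borel_of (eqrel_topology G)) \<in> sets (borel_of (eqrel_topology G))"
    by (simp add: sets_borel_eqrel[OF assms(1)] sigma_sets.Basic)
qed

lemma IRE_integral_shift:
  fixes f :: "('a \<times> 'a) set \<Rightarrow> real"
  assumes "countable (carrier G)" "IRE G \<rho>" "g \<in> carrier G" "f \<in> borel_measurable \<rho>"
  shows "(\<integral>r. f (shift G g r) \<partial>\<rho>) = (\<integral>r. f r \<partial>\<rho>)"
proof -
  have s: "sets \<rho> = sets (borel_of (eqrel_topology G))" and inv: "distr \<rho> \<rho> (shift G g) = \<rho>"
    using assms(2,3) by (auto simp: IRE_def)
  have "shift G g \<in> \<rho> \<rightarrow>\<^sub>M \<rho>"
    using shift_measurable[OF assms(1,3)] measurable_cong_sets[OF s s] by blast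
  then have "(\<integral>r. f r \<partial>distr \<rho> \<rho> (shift G g)) = (\<integral>r. f (shift G g r) \<partial>\<rho>)"
    by (rule integral_distr) (rule assms(4))
  then show ?thesis by (simp add: inv)
qed

text \<open>Indicators of local sets are continuous, and so are their shifts; invariance therefore
  passes to the limit on local sets, and these determine the measure.\<close>

lemma IRE_weak_limit:
  assumes "countable (carrier G)" "\<And>n. IRE G (\<rho> n)" "prob_space \<rho>'"
    "sets \<rho>' = sets (borel_of (eqrel_topology G))" "weakly_converges G \<rho> \<rho>'"
  shows "IRE G \<rho>'"
  unfolding IRE_def
proof (intro conjI ballI assms(3,4))
  interpret prob_space \<rho>' by fact
  fix g assume g: "g \<in> carrier G"
  have meas: "shift G g \<in> \<rho>' \<rightarrow>\<^sub>M \<rho>'"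
    using shift_measurable[OF assms(1) g] measurable_cong_sets[OF assms(4,4)] by blast
  have gen: "sets \<rho>' = sigma_sets (eqrels G) (local_sets G)"
    by (simp add: assms(4) sets_borel_eqrel[OF assms(1)])
  have sp: "space \<rho>' = eqrels G"
    using sets_eq_imp_space_eq[OF assms(4)] by (simp add: space_borel_eqrel)
  show "distr \<rho>' \<rho>' (shift G g) = \<rho>'"
  proof (rule measure_eqI_generator_eq[OF local_sets_Int_stable[of G] local_sets_sub[of G], where A = "\<lambda>_. eqrels G"])
    fix B assume B: "B \<in> local_sets G"
    define f where "f = (\<lambda>r. indicator B r :: real)"
    have floc: "local_map G f"
      unfolding f_def indicator_def
      by (rule local_compose[of G "\<lambda>r. r \<in> B" of_bool]) (use B in \<open>simp add: local_sets_def\<close>)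
    have fmeas: "f \<in> borel_measurable (\<rho> n)" for n
      using continuous_map_borel_eqrel[OF local_continuous[OF floc]] assms(2)[of n]
        measurable_cong_sets[of "\<rho> n" "borel_of (eqrel_topology G)" borel borel] unfolding IRE_def by blast
    have "(\<lambda>n. \<integral>r. f (shift G g r) \<partial>\<rho> n) \<longlonglongrightarrow> (\<integral>r. f (shift G g r) \<partial>\<rho>')"
      using assms(5) local_continuous[OF local_shift[OF g floc]] unfolding weakly_converges_def by blast
    then have "(\<lambda>n. \<integral>r. f r \<partial>\<rho> n) \<longlonglongrightarrow> (\<integral>r. f (shift G g r) \<partial>\<rho>')"
      by (simp add: IRE_integral_shift[OF assms(1,2) g fmeas])
    moreover have "(\<lambda>n. \<integral>r. f r \<partial>\<rho> n) \<longlonglongrightarrow> (\<integral>r. f r \<partial>\<rho>')"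
      using assms(5) local_continuous[OF floc] unfolding weakly_converges_def by blast
    ultimately have eq: "(\<integral>r. f (shift G g r) \<partial>\<rho>') = (\<integral>r. f r \<partial>\<rho>')"
      by (rule LIMSEQ_unique)
    have Bs: "B \<in> sets \<rho>'" using B gen by (simp add: sigma_sets.Basic)
    have "(\<integral>r. f (shift G g r) \<partial>\<rho>') = measure \<rho>' (shift G g -` B \<inter> space \<rho>')"
    proof -
      have "(\<integral>r. f (shift G g r) \<partial>\<rho>') = (\<integral>r. indicator (shift G g -` B \<inter> space \<rho>') r \<partial>\<rho>')"
        by (rule Bochner_Integration.integral_cong) (auto simp: f_def indicator_def)
      then show ?thesis using measurable_sets[OF meas Bs] by simp
    qed
    moreover have "(\<integral>r. f r \<partial>\<rho>') = measure \<rho>' B"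
      using Bs by (simp add: f_def)
    ultimately show "emeasure (distr \<rho>' \<rho>' (shift G g)) B = emeasure \<rho>' B"
      using eq by (simp add: emeasure_distr[OF meas Bs] emeasure_eq_measure)
  next
    show "range (\<lambda>_. eqrels G) \<subseteq> local_sets G"
      using local_setsI[OF local_const[of G True]] by simp
    have "shift G g -` eqrels G \<inter> space \<rho>' = space \<rho>'"
      using measurable_space[OF meas] sp by auto
    then show "emeasure (distr \<rho>' \<rho>' (shift G g)) (eqrels G) \<noteq> \<infinity>"
      using sets.top[of \<rho>'] by (subst emeasure_distr[OF meas]) (simp_all add: sp)
  qed (simp_all add: gen)
qed

text \<open>Each summand is the norm from the definition of amenability with both measures
  translated by \<open>s\<close>. The integral of this sum is the quantity compared in the end:
  bounded below for packings, small for suitable kernels on an amenable relation.\<close>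

definition drift :: "'a set \<Rightarrow> (('a \<times> 'a) set \<Rightarrow> 'a \<Rightarrow> real) \<Rightarrow> ('a \<times> 'a) set \<Rightarrow> real" where
  "drift S \<Lambda> r = (\<Sum>s\<in>S. if (\<one>, s) \<in> r
     then l1_dist G (\<Lambda> r) (translate G s (\<Lambda> (shift G (inv s) r))) else 0)"

text \<open>Locality is asked of each value \<open>\<Lambda> r h\<close> separately; together with
  the common support \<open>K\<close>, when finite, it makes the whole measure, and hence the drift,
  local.\<close>

definition local_kernel :: "'a set \<Rightarrow> (('a \<times> 'a) set \<Rightarrow> 'a \<Rightarrow> real) \<Rightarrow> bool" where
  "local_kernel K \<Lambda> \<longleftrightarrow> (\<forall>h. local_map G (\<lambda>r. \<Lambda> r h)) \<and>
     (\<forall>r\<in>eqrels G. \<Lambda> r \<in> Prob G \<and> (\<forall>h. h \<notin> K \<longrightarrow> \<Lambda> r h = 0))"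

lemma drift_nonneg: "0 \<le> drift S \<Lambda> r"
  unfolding drift_def by (intro sum_nonneg) (simp add: l1_dist_nonneg)

lemma drift_le:
  assumes "\<And>r. r \<in> eqrels G \<Longrightarrow> \<Lambda> r \<in> Prob G" "S \<subseteq> carrier G" "r \<in> eqrels G"
  shows "drift S \<Lambda> r \<le> 2 * real (card S)"
proof -
  have "drift S \<Lambda> r \<le> (\<Sum>s\<in>S. 2)"
    unfolding drift_def
  proof (rule sum_mono)
    fix s assume "s \<in> S"
    then have s: "s \<in> carrier G" using assms(2) by auto
    have "l1_dist G (\<Lambda> r) (translate G s (\<Lambda> (shift G (inv s) r))) \<le> 2"
      by (intro l1_dist_le_2 translate_Prob[OF is_group] assms shift_eqrels[OF is_group] inv_closed s)
    then show "(if (\<one>, s) \<in> r then l1_dist G (\<Lambda> r) (translate G s (\<Lambda> (shift G (inv s) r))) else 0) \<le> 2"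
      by simp
  qed
  then show ?thesis by simp
qed

lemma kernel_l1_dist:
  assumes "local_kernel K \<Lambda>" "finite K" "K \<subseteq> carrier G" "s \<in> carrier G" "r \<in> eqrels G"
  shows "l1_dist G (\<Lambda> r) (translate G s (\<Lambda> (shift G (inv s) r))) =
    (\<Sum>h\<in>K \<union> (\<lambda>k. s \<otimes> k) ` K. \<bar>\<Lambda> r h - \<Lambda> (shift G (inv s) r) (inv s \<otimes> h)\<bar>)"
proof -
  define Q where "Q = K \<union> (\<lambda>k. s \<otimes> k) ` K"
  have Q: "finite Q" "Q \<subseteq> carrier G" using assms(2-4) by (auto simp: Q_def)
  have r': "shift G (inv s) r \<in> eqrels G" by (intro shift_eqrels[OF is_group] inv_closed assms)
  have "l1_dist G (\<Lambda> r) (translate G s (\<Lambda> (shift G (inv s) r))) =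
      (\<Sum>h\<in>Q. \<bar>\<Lambda> r h - translate G s (\<Lambda> (shift G (inv s) r)) h\<bar>)"
  proof (rule l1_dist_finite[OF Q])
    fix h assume h: "h \<in> carrier G - Q"
    then have "h = s \<otimes> (inv s \<otimes> h)" using assms(4) by (simp add: m_assoc[symmetric])
    then have "inv s \<otimes> h \<notin> K" using h unfolding Q_def by blast
    then show "\<Lambda> r h = translate G s (\<Lambda> (shift G (inv s) r)) h"
      using assms(1,5) r' h by (simp add: local_kernel_def translate_def Q_def)
  qed
  also have "\<dots> = (\<Sum>h\<in>Q. \<bar>\<Lambda> r h - \<Lambda> (shift G (inv s) r) (inv s \<otimes> h)\<bar>)"
    by (rule sum.cong) (use Q(2) in \<open>auto simp: translate_def\<close>)
  finally show ?thesis by (simp add: Q_def)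
qed

lemma local_cong:
  assumes "local_map G f" "\<And>r. r \<in> eqrels G \<Longrightarrow> f r = f' r"
  shows "local_map G f'"
proof -
  obtain W where W: "finite W" "W \<subseteq> carrier G \<times> carrier G" "determined_by G W f"
    by (rule local_mapE[OF assms(1)]) blast
  show ?thesis
    by (rule local_mapI[OF W(1,2)]) (metis assms(2) determined_byD[OF W(3)])
qed

text \<open>Local functions are continuous, so the integral of the drift passes to weak limits. The
  norm reduces to a finite sum only at equivalence relations, hence the detour through
  \<open>local_cong\<close>.\<close>

lemma local_drift:
  assumes "local_kernel K \<Lambda>" "finite K" "K \<subseteq> carrier G" "finite S" "S \<subseteq> carrier G"
  shows "local_map G (drift S \<Lambda>)"
proof (rule local_cong)
  have \<Lambda>: "local_map G (\<lambda>r. \<Lambda> r h)" for h using assms(1) by (simp add: local_kernel_def)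
  show "local_map G (\<lambda>r. \<Sum>s\<in>S. if (\<one>, s) \<in> r
     then (\<Sum>h\<in>K \<union> (\<lambda>k. s \<otimes> k) ` K. \<bar>\<Lambda> r h - \<Lambda> (shift G (inv s) r) (inv s \<otimes> h)\<bar>) else 0)"
  proof (rule local_sum[OF assms(4)])
    fix s assume "s \<in> S"
    then have s: "s \<in> carrier G" using assms(5) by auto
    have "local_map G (\<lambda>r. \<Sum>h\<in>K \<union> (\<lambda>k. s \<otimes> k) ` K. \<bar>\<Lambda> r h - \<Lambda> (shift G (inv s) r) (inv s \<otimes> h)\<bar>)"
    proof (rule local_sum)
      fix h
      show "local_map G (\<lambda>r. \<bar>\<Lambda> r h - \<Lambda> (shift G (inv s) r) (inv s \<otimes> h)\<bar>)"
        by (rule local_compose2[of G "\<lambda>r. \<Lambda> r h" "\<lambda>r. \<Lambda> (shift G (inv s) r) (inv s \<otimes> h)" "\<lambda>u v. \<bar>u - v\<bar>"])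
           (use \<Lambda> local_shift[OF inv_closed[OF s] \<Lambda>] in auto)
    qed (use assms(2) in simp)
    then show "local_map G (\<lambda>r. if (\<one>, s) \<in> r
     then (\<Sum>h\<in>K \<union> (\<lambda>k. s \<otimes> k) ` K. \<bar>\<Lambda> r h - \<Lambda> (shift G (inv s) r) (inv s \<otimes> h)\<bar>) else 0)"
      by (rule local_compose2[OF local_mem[OF one_closed s], of _ "\<lambda>b u. if b then u else 0"])
  qed
  fix r assume "r \<in> eqrels G"
  then show "(\<Sum>s\<in>S. if (\<one>, s) \<in> r
     then (\<Sum>h\<in>K \<union> (\<lambda>k. s \<otimes> k) ` K. \<bar>\<Lambda> r h - \<Lambda> (shift G (inv s) r) (inv s \<otimes> h)\<bar>) else 0) = drift S \<Lambda> r"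
    unfolding drift_def using assms by (intro sum.cong) (auto simp: kernel_l1_dist)
qed

end

section \<open>Random packings\<close>

context group
begin

text \<open>A configuration \<open>\<omega>\<close> marks the centres of the translates of \<open>F\<close>; \<open>near F g\<close> consists of the
  possible centres \<open>c\<close> with \<open>g \<in> c F\<close>. Points covered by one and the same single translate form a
  class; all other points are singletons.\<close>

definition near :: "'a set \<Rightarrow> 'a \<Rightarrow> 'a set" where
  "near F g = (\<lambda>f. g \<otimes> inv f) ` F"

definition covers :: "'a set \<Rightarrow> ('a \<Rightarrow> bool) \<Rightarrow> 'a \<Rightarrow> 'a \<Rightarrow> bool" where
  "covers F \<omega> c g \<longleftrightarrow> \<omega> c \<and> c \<in> near F g \<and> (\<forall>c'\<in>near F g. \<omega> c' \<longrightarrow> c' = c)"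

definition packing :: "'a set \<Rightarrow> ('a \<Rightarrow> bool) \<Rightarrow> ('a \<times> 'a) set" where
  "packing F \<omega> = {(g, h) \<in> carrier G \<times> carrier G.
     g = h \<or> (\<exists>c\<in>near F g. covers F \<omega> c g \<and> covers F \<omega> c h)}"

lemma near_closed: "F \<subseteq> carrier G \<Longrightarrow> g \<in> carrier G \<Longrightarrow> near F g \<subseteq> carrier G"
  by (auto simp: near_def)

lemma finite_near: "finite F \<Longrightarrow> finite (near F g)"
  by (simp add: near_def)

lemma covers_unique: "covers F \<omega> c g \<Longrightarrow> covers F \<omega> c' g \<Longrightarrow> c = c'"
  unfolding covers_def by blast

lemma covers_near: "covers F \<omega> c g \<Longrightarrow> c \<in> near F g"
  unfolding covers_def by blast

lemma packing_eqrels: "packing F \<omega> \<in> eqrels G"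
proof -
  have "equiv (carrier G) (packing F \<omega>)"
  proof (rule equivI)
    show "refl_on (carrier G) (packing F \<omega>)" by (auto simp: refl_on_def packing_def)
    show "sym (packing F \<omega>)"
      unfolding sym_def packing_def using covers_near by blast
    show "trans (packing F \<omega>)"
    proof (rule transI)
      fix a b c assume ab: "(a, b) \<in> packing F \<omega>" and bc: "(b, c) \<in> packing F \<omega>"
      show "(a, c) \<in> packing F \<omega>"
      proof (cases "a = b \<or> b = c")
        case False
        then obtain d d' where "covers F \<omega> d a" "covers F \<omega> d b" "covers F \<omega> d' b" "covers F \<omega> d' c"
          using ab bc unfolding packing_def by blast
        moreover from this have "d = d'" using covers_unique by blast
        ultimately show ?thesis using ab bc covers_near unfolding packing_def by blast
      qed (use ab bc in auto)
    qed
  qed (auto simp: packing_def)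
  then show ?thesis by (simp add: eqrels_def)
qed

lemma near_shift:
  assumes "F \<subseteq> carrier G" "x \<in> carrier G" "g \<in> carrier G"
  shows "near F (x \<otimes> g) = (\<lambda>c. x \<otimes> c) ` near F g"
  unfolding near_def image_image
  by (rule image_cong) (use assms in \<open>auto simp: m_assoc subset_iff\<close>)

lemma covers_shift:
  assumes F: "F \<subseteq> carrier G" and x: "x \<in> carrier G" and g: "g \<in> carrier G" and c: "c \<in> carrier G"
    and \<omega>': "\<And>g. g \<in> carrier G \<Longrightarrow> \<omega>' g = \<omega> (x \<otimes> g)"
  shows "covers F \<omega> (x \<otimes> c) (x \<otimes> g) \<longleftrightarrow> covers F \<omega>' c g"
proof -
  have inj: "x \<otimes> a = x \<otimes> b \<longleftrightarrow> a = b" if "a \<in> carrier G" "b \<in> carrier G" for a b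
    using inj_onD[OF bij_betw_imp_inj_on[OF bij_betw_mult_left[OF x]], of a b] that by blast
  have near: "c' \<in> carrier G" if "c' \<in> near F g" for c' using near_closed[OF F g] that by blast
  have 1: "x \<otimes> c \<in> (\<lambda>c. x \<otimes> c) ` near F g \<longleftrightarrow> c \<in> near F g"
    using inj[OF c near] by auto
  have 2: "(\<forall>c'\<in>near F g. \<omega> (x \<otimes> c') \<longrightarrow> x \<otimes> c' = x \<otimes> c) \<longleftrightarrow> (\<forall>c'\<in>near F g. \<omega>' c' \<longrightarrow> c' = c)"
    using \<omega>'[OF near] inj[OF near c] by auto
  show ?thesis
    unfolding covers_def near_shift[OF F x g] using 1 2 \<omega>'[OF c] by simp
qed

text \<open>Translates of \<open>F\<close> are formed by right multiplication, so left translation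
  of the centres moves the whole packing. The configurations are compared on the carrier only, since
  \<open>move\<close> produces extensional functions.\<close>

lemma packing_shift:
  assumes F: "F \<subseteq> carrier G" and x: "x \<in> carrier G"
    and \<omega>': "\<And>g. g \<in> carrier G \<Longrightarrow> \<omega>' g = \<omega> (inv x \<otimes> g)"
  shows "shift G x (packing F \<omega>) = packing F \<omega>'"
proof -
  have ix: "inv x \<in> carrier G" using x by simp
  have inj: "inv x \<otimes> a = inv x \<otimes> b \<longleftrightarrow> a = b" if "a \<in> carrier G" "b \<in> carrier G" for a b
    using inj_onD[OF bij_betw_imp_inj_on[OF bij_betw_mult_left[OF ix]], of a b] that by blast
  have "(a, b) \<in> shift G x (packing F \<omega>) \<longleftrightarrow> (a, b) \<in> packing F \<omega>'" for a b
  proof (cases "a \<in> carrier G \<and> b \<in> carrier G")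
    case True
    have "(a, b) \<in> shift G x (packing F \<omega>) \<longleftrightarrow> a = b \<or>
        (\<exists>c\<in>near F a. covers F \<omega> (inv x \<otimes> c) (inv x \<otimes> a) \<and> covers F \<omega> (inv x \<otimes> c) (inv x \<otimes> b))"
      using True x inj by (simp add: shift_def packing_def near_shift[OF F ix])
    also have "\<dots> \<longleftrightarrow> a = b \<or> (\<exists>c\<in>near F a. covers F \<omega>' c a \<and> covers F \<omega>' c b)"
    proof -
      have "covers F \<omega> (inv x \<otimes> c) (inv x \<otimes> d) \<longleftrightarrow> covers F \<omega>' c d"
        if "c \<in> near F a" "d \<in> carrier G" for c d
      proof (rule covers_shift[OF F ix that(2)])
        show "c \<in> carrier G" using that near_closed[OF F] True by blast
      qed (rule \<omega>')
      then show ?thesis using True by blast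
    qed
    also have "\<dots> \<longleftrightarrow> (a, b) \<in> packing F \<omega>'" using True by (simp add: packing_def)
    finally show ?thesis .
  qed (auto simp: shift_def packing_def)
  then show ?thesis by auto
qed

lemma packing_class:
  assumes F: "F \<subseteq> carrier G" and "(g, h) \<in> packing F \<omega>"
  shows "h \<in> insert g (\<Union>c\<in>near F g. (\<lambda>f. c \<otimes> f) ` F)"
proof (cases "g = h")
  case False
  then obtain c where c: "c \<in> near F g" "c \<in> near F h" and gh: "g \<in> carrier G" "h \<in> carrier G"
    using assms(2) covers_near unfolding packing_def by blast
  obtain f where f: "f \<in> F" "c = h \<otimes> inv f" using c(2) by (auto simp: near_def)
  have "f \<in> carrier G" using f F by blast
  then have "h = c \<otimes> f" unfolding f(2) using gh by (simp add: m_assoc)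
  then show ?thesis using c(1) f(1) by blast
qed simp

section \<open>Bernoulli configurations and the law of the packing\<close>

definition config :: "real \<Rightarrow> ('a \<Rightarrow> bool) measure" where
  "config p = PiM (carrier G) (\<lambda>_. measure_pmf (bernoulli_pmf p))"

definition packing_law :: "'a set \<Rightarrow> real \<Rightarrow> ('a \<times> 'a) set measure" where
  "packing_law F p = distr (config p) (borel_of (eqrel_topology G)) (packing F)"

lemma prob_space_config: "prob_space (config p)"
  unfolding config_def by (rule prob_space_PiM) (rule prob_space_measure_pmf)

lemma config_event:
  assumes "c \<in> carrier G"
  shows "{\<omega> \<in> space (config p). \<omega> c} \<in> sets (config p)"
  unfolding config_def by (rule sets_Collect_single'[OF assms]) simp

lemma config_prob:
  assumes "0 \<le> p" "p \<le> 1" "J \<subseteq> carrier G" "finite J"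
  shows "measure (config p) {\<omega> \<in> space (config p). \<forall>c\<in>J. \<omega> c} = p ^ card J"
proof -
  interpret product_prob_space "\<lambda>_. measure_pmf (bernoulli_pmf p)" "carrier G"
    by unfold_locales
  have "emeasure (config p) {\<omega> \<in> space (config p). \<forall>c\<in>J. \<omega> c \<in> {True}} =
      (\<Prod>c\<in>J. emeasure (measure_pmf (bernoulli_pmf p)) {True})"
    unfolding config_def by (rule emeasure_PiM_Collect) (use assms in auto)
  also have "\<dots> = ennreal (p ^ card J)"
    using assms(1,2) by (simp add: emeasure_pmf_single ennreal_power)
  finally show ?thesis using assms(1) by (simp add: measure_def)
qed

lemma covers_event:
  assumes F: "finite F" "F \<subseteq> carrier G" and "g \<in> carrier G" "c \<in> carrier G"
  shows "{\<omega> \<in> space (config p). covers F \<omega> c g} \<in> sets (config p)"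
  unfolding covers_def
  by (intro sets.sets_Collect_conj sets.sets_Collect_finite_All sets.sets_Collect_imp
      sets.sets_Collect_const config_event finite_near)
     (use assms near_closed in \<open>auto\<close>)

lemma packing_event:
  assumes F: "finite F" "F \<subseteq> carrier G" and "g \<in> carrier G" "h \<in> carrier G"
  shows "{\<omega> \<in> space (config p). (g, h) \<in> packing F \<omega>} \<in> sets (config p)"
proof -
  have "{\<omega> \<in> space (config p). g = h \<or> (\<exists>c\<in>near F g. covers F \<omega> c g \<and> covers F \<omega> c h)} \<in> sets (config p)"
    by (intro sets.sets_Collect_disj sets.sets_Collect_conj sets.sets_Collect_finite_Ex
        sets.sets_Collect_const covers_event finite_near F assms(3,4))
       (use near_closed[OF F(2) assms(3)] in auto)
  then show ?thesis using assms(3,4) by (simp add: packing_def)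
qed

text \<open>Membership in a local set is decided by the trace of the packing on a finite window,
  which has finitely many possible values.\<close>

lemma packing_measurable:
  assumes "countable (carrier G)" and F: "finite F" "F \<subseteq> carrier G"
  shows "packing F \<in> config p \<rightarrow>\<^sub>M borel_of (eqrel_topology G)"
proof (rule measurable_sigma_sets[OF sets_borel_eqrel[OF assms(1)] local_sets_sub])
  show "packing F \<in> space (config p) \<rightarrow> eqrels G" using packing_eqrels by blast
  fix B assume B: "B \<in> local_sets G"
  then have Bl: "local_map G (\<lambda>r. r \<in> B)" and Bs: "B \<subseteq> eqrels G" by (auto simp: local_sets_def)
  obtain W where W: "finite W" "W \<subseteq> carrier G \<times> carrier G" "determined_by G W (\<lambda>r. r \<in> B)"
    by (rule local_mapE[OF Bl]) blast
  define VV where "VV = (\<lambda>r. r \<inter> W) ` B"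
  have VV: "finite VV" by (rule finite_subset[of _ "Pow W"]) (use W in \<open>auto simp: VV_def\<close>)
  have "packing F \<omega> \<in> B \<longleftrightarrow> (\<exists>V\<in>VV. \<forall>w\<in>W. w \<in> packing F \<omega> \<longleftrightarrow> w \<in> V)" for \<omega>
  proof
    assume "packing F \<omega> \<in> B"
    then show "\<exists>V\<in>VV. \<forall>w\<in>W. w \<in> packing F \<omega> \<longleftrightarrow> w \<in> V"
      by (intro bexI[of _ "packing F \<omega> \<inter> W"]) (auto simp: VV_def)
  next
    assume "\<exists>V\<in>VV. \<forall>w\<in>W. w \<in> packing F \<omega> \<longleftrightarrow> w \<in> V"
    then obtain r where r: "r \<in> B" "\<forall>w\<in>W. w \<in> packing F \<omega> \<longleftrightarrow> w \<in> r \<inter> W" by (auto simp: VV_def)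
    then have "packing F \<omega> \<inter> W = r \<inter> W" by blast
    then show "packing F \<omega> \<in> B"
      using determined_byD[OF W(3) packing_eqrels, of r F \<omega>] r(1) Bs by blast
  qed
  then have "packing F -` B \<inter> space (config p) =
      {\<omega> \<in> space (config p). \<exists>V\<in>VV. \<forall>w\<in>W. w \<in> packing F \<omega> \<longleftrightarrow> w \<in> V}" by auto
  also have "\<dots> \<in> sets (config p)"
  proof (intro sets.sets_Collect_finite_Ex sets.sets_Collect_finite_All VV W(1))
    fix V w assume w: "w \<in> W"
    obtain g h where gh: "w = (g, h)" "g \<in> carrier G" "h \<in> carrier G" using w W(2) by auto
    have "{\<omega> \<in> space (config p). (g, h) \<in> packing F \<omega>} \<in> sets (config p)"
      by (rule packing_event[OF F gh(2,3)])
    then show "{\<omega> \<in> space (config p). w \<in> packing F \<omega> \<longleftrightarrow> w \<in> V} \<in> sets (config p)"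
      unfolding gh(1) by (cases "(g, h) \<in> V") (auto intro: sets.sets_Collect_neg)
  qed
  finally show "packing F -` B \<inter> space (config p) \<in> sets (config p)" .
qed

definition move :: "'a \<Rightarrow> ('a \<Rightarrow> bool) \<Rightarrow> 'a \<Rightarrow> bool" where
  "move x \<omega> = (\<lambda>g\<in>carrier G. \<omega> (inv x \<otimes> g))"

lemma distr_move:
  assumes "x \<in> carrier G"
  shows "distr (config p) (config p) (move x) = config p"
proof -
  have ix: "inv x \<in> carrier G" using assms by simp
  show ?thesis
    unfolding config_def move_def
    by (rule distr_PiM_reindex[where M = "\<lambda>_. measure_pmf (bernoulli_pmf p)"])
       (use bij_betw_mult_left[OF ix] in \<open>auto simp: bij_betw_def prob_space_measure_pmf\<close>)
qed

lemma move_measurable: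
  assumes "x \<in> carrier G"
  shows "move x \<in> config p \<rightarrow>\<^sub>M config p"
  unfolding config_def move_def
  by (rule measurable_restrict) (use assms in \<open>auto intro!: measurable_component_singleton\<close>)

lemma packing_move:
  assumes "F \<subseteq> carrier G" "x \<in> carrier G"
  shows "packing F (move x \<omega>) = shift G x (packing F \<omega>)"
  by (rule packing_shift[OF assms, symmetric]) (simp add: move_def)

text \<open>The product measure is preserved by \<open>move\<close>, and \<open>packing\<close>
  intertwines \<open>move\<close> with \<open>shift\<close>; this gives invariance. A class lies in
  the finite union of a point and all translates that can contain it.\<close>

lemma finite_IRE_packing_law:
  assumes "countable (carrier G)" and F: "finite F" "F \<subseteq> carrier G"
  shows "finite_IRE G (packing_law F p)"
proof -
  note meas = packing_measurable[OF assms, of p]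
  interpret C: prob_space "config p" by (rule prob_space_config)
  have s: "sets (packing_law F p) = sets (borel_of (eqrel_topology G))" by (simp add: packing_law_def)
  have "distr (packing_law F p) (packing_law F p) (shift G x) = packing_law F p" if x: "x \<in> carrier G" for x
  proof -
    have "distr (packing_law F p) (packing_law F p) (shift G x) =
        distr (packing_law F p) (borel_of (eqrel_topology G)) (shift G x)"
      by (rule distr_cong) (simp_all add: s)
    also have "\<dots> = distr (config p) (borel_of (eqrel_topology G)) (shift G x \<circ> packing F)"
      unfolding packing_law_def by (rule distr_distr[OF shift_measurable[OF assms(1) x] meas])
    also have "shift G x \<circ> packing F = packing F \<circ> move x"
      using packing_move[OF F(2) x] by auto
    also have "distr (config p) (borel_of (eqrel_topology G)) (packing F \<circ> move x) =
        distr (distr (config p) (config p) (move x)) (borel_of (eqrel_topology G)) (packing F)"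
      by (rule distr_distr[OF meas move_measurable[OF x], symmetric])
    finally show ?thesis by (simp add: distr_move[OF x] packing_law_def)
  qed
  then have IRE: "IRE G (packing_law F p)"
    using s C.prob_space_distr[OF meas] by (simp add: IRE_def packing_law_def)
  define Q where "Q = (\<lambda>g. insert g (\<Union>c\<in>near F g. (\<lambda>f. c \<otimes> f) ` F))"
  \<comment> \<open>A stronger condition than finiteness of classes, but visibly measurable: a
    countable intersection of events about single pairs.\<close>
  define D where "D = {r \<in> eqrels G. \<forall>g\<in>carrier G. \<forall>h\<in>carrier G. h \<notin> Q g \<longrightarrow> (g, h) \<notin> r}"
  have "D \<in> sets (borel_of (eqrel_topology G))"
  proof -
    have "{r \<in> space (borel_of (eqrel_topology G)). (g, h) \<in> r} \<in> sets (borel_of (eqrel_topology G))"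
      if "g \<in> carrier G" "h \<in> carrier G" for g h
      using local_setsI[OF local_mem[OF that]]
      by (simp add: space_borel_eqrel sets_borel_eqrel[OF assms(1)] sigma_sets.Basic)
    then have "{r \<in> space (borel_of (eqrel_topology G)). \<forall>g\<in>carrier G. \<forall>h\<in>carrier G. h \<notin> Q g \<longrightarrow> (g, h) \<notin> r}
        \<in> sets (borel_of (eqrel_topology G))"
      by (intro sets.sets_Collect_countable_All' sets.sets_Collect_imp sets.sets_Collect_const
          sets.sets_Collect_neg assms(1)) auto
    then show ?thesis by (simp add: D_def space_borel_eqrel)
  qed
  moreover have "packing F \<omega> \<in> D" for \<omega>
    unfolding D_def
  proof (intro CollectI conjI packing_eqrels ballI impI notI)
    fix g h assume gh: "h \<notin> Q g" "(g, h) \<in> packing F \<omega>"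
    from gh(1) packing_class[OF F(2) gh(2)] show False unfolding Q_def by (rule notE)
  qed
  ultimately have "AE r in packing_law F p. r \<in> D"
    unfolding packing_law_def by (subst AE_distr_iff[OF meas]) (auto simp: space_borel_eqrel D_def)
  moreover have "finite (r `` {g})" if r: "r \<in> D" and g: "g \<in> carrier G" for r g
  proof (rule finite_subset)
    have "r \<subseteq> carrier G \<times> carrier G" using r by (auto simp: D_def eqrels_def equiv_def refl_on_def)
    then show "r `` {g} \<subseteq> Q g" using r g by (auto simp: D_def)
    show "finite (Q g)" using F(1) finite_near by (simp add: Q_def)
  qed
  ultimately show ?thesis
    unfolding finite_IRE_def using IRE by (auto elim!: eventually_mono)
qed

text \<open>Read \<open>\<Lambda>\<close> along the translate centred at \<one>:
  \<open>\<xi> x\<close> is \<open>\<Lambda>\<close> of the relation seen from \<open>x\<close>,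
  moved back to \<open>x\<close>. It is a field, so its variation on \<open>F\<close> is large.
  Covered points are equivalent, so the variation among them is bounded by drift. Every uncovered
  point spoils at most \<open>card S\<close> pairs starting at it and \<open>card S\<close> pairs
  ending at it, each worth at most 2; hence the factor \<open>4 * card S\<close>.\<close>

lemma drift_packing_sum:
  assumes F: "finite F" "F \<subseteq> carrier G" and \<Lambda>: "local_kernel K \<Lambda>"
    and S: "finite S" "S \<subseteq> carrier G"
    and bad: "\<And>\<xi>. \<xi> \<in> prob_fields K \<Longrightarrow> \<epsilon> * real (card F) \<le> (\<Sum>x\<in>F. site_cost {s\<in>S. x \<otimes> s \<in> F} \<xi> x)"
  shows "\<epsilon> * real (card F) - 4 * real (card S) * real (card {f\<in>F. \<not> covers F \<omega> \<one> f}) \<le>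
    (\<Sum>f\<in>F. if covers F \<omega> \<one> f then drift S \<Lambda> (shift G (inv f) (packing F \<omega>)) else 0)"
proof -
  define r where "r = packing F \<omega>"
  define N where "N = real (card S)"
  define U where "U = {f\<in>F. covers F \<omega> \<one> f}"
  define \<xi> where "\<xi> = (\<lambda>x. translate G x (\<Lambda> (shift G (inv x) r)))"
  have U: "finite U" "U \<subseteq> F" using F by (auto simp: U_def)
  have r: "r \<in> eqrels G" unfolding r_def by (rule packing_eqrels)
  have \<xi>: "\<xi> \<in> prob_fields K"
    unfolding prob_fields_def
  proof safe
    fix x assume x: "x \<in> carrier G"
    have s: "shift G (inv x) r \<in> eqrels G" using shift_eqrels[OF is_group inv_closed[OF x] r] .
    show "\<xi> x \<in> Prob G"
      unfolding \<xi>_def by (rule translate_Prob[OF is_group x]) (use \<Lambda> s in \<open>simp add: local_kernel_def\<close>)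
    fix h assume "h \<in> carrier G" "\<xi> x h \<noteq> 0"
    then show "inv x \<otimes> h \<in> K" using \<Lambda> s unfolding \<xi>_def translate_def local_kernel_def by auto
  qed
  have drift: "site_cost {s\<in>S. f \<otimes> s \<in> U} \<xi> f \<le> drift S \<Lambda> (shift G (inv f) r)" if f: "f \<in> U" for f
  proof -
    have fc: "f \<in> carrier G" using f U F by blast
    have eq: "l1_dist G (\<Lambda> (shift G (inv f) r)) (translate G s (\<Lambda> (shift G (inv s) (shift G (inv f) r)))) =
        l1_dist G (\<xi> f) (\<xi> (f \<otimes> s))" if s: "s \<in> carrier G" for s
    proof -
      have "shift G (inv s) (shift G (inv f) r) = shift G (inv (f \<otimes> s)) r"
        using s fc by (simp add: shift_shift inv_mult_group)
      then have "\<xi> (f \<otimes> s) = translate G f (translate G s (\<Lambda> (shift G (inv s) (shift G (inv f) r))))"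
        unfolding \<xi>_def using s fc by (simp add: translate_translate)
      then show ?thesis by (simp add: \<xi>_def l1_dist_translate[OF fc])
    qed
    have mem: "(\<one>, s) \<in> shift G (inv f) r" if s: "s \<in> S" "f \<otimes> s \<in> U" for s
    proof -
      have sc: "s \<in> carrier G" using s S by blast
      have "covers F \<omega> \<one> f" "covers F \<omega> \<one> (f \<otimes> s)" using f s by (auto simp: U_def)
      then have "(f, f \<otimes> s) \<in> r" unfolding r_def packing_def using covers_near fc sc by auto
      then show ?thesis using shift_mem[OF inv_closed[OF fc] one_closed sc] fc sc by simp
    qed
    have "site_cost {s\<in>S. f \<otimes> s \<in> U} \<xi> f = (\<Sum>s\<in>S. if f \<otimes> s \<in> U then l1_dist G (\<xi> f) (\<xi> (f \<otimes> s)) else 0)"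
      unfolding site_cost_def using S(1) by (simp add: sum.inter_filter)
    also have "\<dots> \<le> drift S \<Lambda> (shift G (inv f) r)"
      unfolding drift_def
    proof (rule sum_mono)
      fix s assume s: "s \<in> S"
      then show "(if f \<otimes> s \<in> U then l1_dist G (\<xi> f) (\<xi> (f \<otimes> s)) else 0) \<le> (if (\<one>, s) \<in> shift G (inv f) r then
          l1_dist G (\<Lambda> (shift G (inv f) r)) (translate G s (\<Lambda> (shift G (inv s) (shift G (inv f) r)))) else 0)"
        using mem eq[of s] S(2) by (auto simp: l1_dist_nonneg)
    qed
    finally show ?thesis .
  qed
  have site: "site_cost {s\<in>S. x \<otimes> s \<in> F} \<xi> x \<le>
      (if x \<in> U then site_cost {s\<in>S. x \<otimes> s \<in> U} \<xi> x else 0) + (if x \<in> F - U then 2 * N else 0) +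
      2 * (\<Sum>s\<in>S. if x \<otimes> s \<in> F - U then 1 else 0)" if x: "x \<in> F" for x
  proof -
    have xc: "x \<in> carrier G" using x F by blast
    have le2: "l1_dist G (\<xi> x) (\<xi> (x \<otimes> s)) \<le> 2" if "s \<in> S" for s
      by (intro l1_dist_le_2 prob_fieldsD[OF \<xi>] xc m_closed) (use that S in blast)
    have "site_cost {s\<in>S. x \<otimes> s \<in> F} \<xi> x = (\<Sum>s\<in>S. if x \<otimes> s \<in> F then l1_dist G (\<xi> x) (\<xi> (x \<otimes> s)) else 0)"
      unfolding site_cost_def using S(1) by (simp add: sum.inter_filter)
    also have "\<dots> \<le> (\<Sum>s\<in>S. (if x \<in> U then if x \<otimes> s \<in> U then l1_dist G (\<xi> x) (\<xi> (x \<otimes> s)) else 0 else 0) +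
        (if x \<in> F - U then 2 else 0) + 2 * (if x \<otimes> s \<in> F - U then 1 else 0))"
      by (rule sum_mono) (use x U(2) in \<open>auto simp: l1_dist_nonneg intro: order_trans[OF le2]\<close>)
    also have "\<dots> = (if x \<in> U then site_cost {s\<in>S. x \<otimes> s \<in> U} \<xi> x else 0) + (if x \<in> F - U then 2 * N else 0) +
        2 * (\<Sum>s\<in>S. if x \<otimes> s \<in> F - U then 1 else 0)"
      unfolding site_cost_def N_def using S(1)
      by (simp add: sum.distrib sum_distrib_left sum.inter_filter)
    finally show ?thesis .
  qed
  have cross: "(\<Sum>x\<in>F. \<Sum>s\<in>S. if x \<otimes> s \<in> F - U then 1 else 0 :: real) \<le> N * real (card (F - U))"
  proof -
    have "(\<Sum>x\<in>F. \<Sum>s\<in>S. if x \<otimes> s \<in> F - U then 1 else 0 :: real) = (\<Sum>s\<in>S. \<Sum>x\<in>F. if x \<otimes> s \<in> F - U then 1 else 0)"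
      by (rule sum.swap)
    also have "\<dots> \<le> (\<Sum>s\<in>S. real (card (F - U)))"
    proof (rule sum_mono)
      fix s assume s: "s \<in> S"
      have "card {x\<in>F. x \<otimes> s \<in> F - U} \<le> card (F - U)"
      proof (rule card_inj_on_le)
        show "inj_on (\<lambda>x. x \<otimes> s) {x\<in>F. x \<otimes> s \<in> F - U}"
          using s S F by (intro inj_onI) (metis (no_types, lifting) mem_Collect_eq right_cancel subsetD)
      qed (use F in auto)
      then show "(\<Sum>x\<in>F. if x \<otimes> s \<in> F - U then 1 else 0) \<le> real (card (F - U))"
        using F(1) by (simp add: sum.inter_filter[symmetric])
    qed
    finally show ?thesis by (simp add: N_def)
  qed
  have "\<epsilon> * real (card F) \<le> (\<Sum>x\<in>F. site_cost {s\<in>S. x \<otimes> s \<in> F} \<xi> x)" by (rule bad[OF \<xi>])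
  also have "\<dots> \<le> (\<Sum>x\<in>F. (if x \<in> U then site_cost {s\<in>S. x \<otimes> s \<in> U} \<xi> x else 0) + (if x \<in> F - U then 2 * N else 0) +
      2 * (\<Sum>s\<in>S. if x \<otimes> s \<in> F - U then 1 else 0))"
    by (rule sum_mono) (rule site)
  also have "\<dots> = (\<Sum>x\<in>F. if x \<in> U then site_cost {s\<in>S. x \<otimes> s \<in> U} \<xi> x else 0) +
      (\<Sum>x\<in>F. if x \<in> F - U then 2 * N else 0) + 2 * (\<Sum>x\<in>F. \<Sum>s\<in>S. if x \<otimes> s \<in> F - U then 1 else 0)"
    by (simp add: sum.distrib sum_distrib_left)
  also have "(\<Sum>x\<in>F. if x \<in> F - U then 2 * N else 0) = 2 * N * real (card (F - U))"
  proof -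
    have "{x\<in>F. x \<in> F - U} = F - U" by auto
    then show ?thesis using F(1) by (simp add: sum.inter_filter[symmetric] del: Diff_iff)
  qed
  also have "(\<Sum>x\<in>F. if x \<in> U then site_cost {s\<in>S. x \<otimes> s \<in> U} \<xi> x else 0) \<le>
      (\<Sum>f\<in>F. if covers F \<omega> \<one> f then drift S \<Lambda> (shift G (inv f) r) else 0)"
  proof (rule sum_mono)
    fix x assume "x \<in> F"
    then show "(if x \<in> U then site_cost {s\<in>S. x \<otimes> s \<in> U} \<xi> x else 0) \<le>
        (if covers F \<omega> \<one> x then drift S \<Lambda> (shift G (inv x) r) else 0)"
      using drift[of x] by (auto simp: U_def)
  qed
  finally have "\<epsilon> * real (card F) \<le> (\<Sum>f\<in>F. if covers F \<omega> \<one> f then drift S \<Lambda> (shift G (inv f) r) else 0) +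
      2 * N * real (card (F - U)) + 2 * (N * real (card (F - U)))"
    using cross by linarith
  moreover have "F - U = {f\<in>F. \<not> covers F \<omega> \<one> f}" by (auto simp: U_def)
  ultimately show ?thesis unfolding N_def r_def by simp
qed

text \<open>When \<one> is marked, a point \<open>f\<close> is lost only to another marked centre
  \<open>f \<otimes> inv f'\<close> with \<open>f' \<noteq> f\<close>: a union bound. The conjunct
  \<open>\<omega> \<one>\<close> makes each summand the indicator of an event of probability
  \<open>p\<^sup>2\<close>.\<close>

lemma card_uncovered_le:
  assumes F: "finite F" "F \<subseteq> carrier G" and \<omega>: "\<omega> \<one>"
  shows "real (card {f\<in>F. \<not> covers F \<omega> \<one> f}) \<le>
    (\<Sum>f\<in>F. \<Sum>f'\<in>F - {f}. if \<omega> \<one> \<and> \<omega> (f \<otimes> inv f') then 1 else 0)"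
proof -
  have "real (card {f\<in>F. \<not> covers F \<omega> \<one> f}) = (\<Sum>f\<in>F. if \<not> covers F \<omega> \<one> f then 1 else 0)"
    using F(1) by (simp add: sum.inter_filter[symmetric])
  also have "\<dots> \<le> (\<Sum>f\<in>F. \<Sum>f'\<in>F - {f}. if \<omega> \<one> \<and> \<omega> (f \<otimes> inv f') then 1 else 0)"
  proof (rule sum_mono)
    fix f assume f: "f \<in> F"
    have fc: "f \<in> carrier G" using f F by blast
    show "(if \<not> covers F \<omega> \<one> f then 1 else 0 :: real) \<le> (\<Sum>f'\<in>F - {f}. if \<omega> \<one> \<and> \<omega> (f \<otimes> inv f') then 1 else 0)"
    proof (cases "covers F \<omega> \<one> f")
      case False
      have "\<one> \<in> near F f" unfolding near_def using f fc by (intro image_eqI[of _ _ f]) auto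
      then obtain c where c: "c \<in> near F f" "\<omega> c" "c \<noteq> \<one>" using False \<omega> by (auto simp: covers_def)
      then obtain f' where f': "f' \<in> F" "c = f \<otimes> inv f'" by (auto simp: near_def)
      have "f' \<in> F - {f}" using f' c(3) fc by auto
      then have "(if \<omega> \<one> \<and> \<omega> (f \<otimes> inv f') then 1 else 0 :: real) \<le> (\<Sum>f'\<in>F - {f}. if \<omega> \<one> \<and> \<omega> (f \<otimes> inv f') then 1 else 0)"
        by (intro member_le_sum) (use F in auto)
      then show ?thesis using False \<omega> c(2) f'(2) by simp
    next
      case True
      have "0 \<le> (\<Sum>f'\<in>F - {f}. if \<omega> \<one> \<and> \<omega> (f \<otimes> inv f') then 1 else 0 :: real)"
        by (rule sum_nonneg) simp
      then show ?thesis using True by simp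
    qed
  qed
  finally show ?thesis .
qed

text \<open>Mass transport. The drift at \<one> is split by the position \<open>f\<close> of \<one>
  in the translate covering it, uncovered configurations being dropped by nonnegativity. Invariance
  under \<open>move (inv f)\<close> turns this into a centre at \<one> covering \<open>f\<close>,
  with the drift seen from \<open>f\<close>, and \<open>drift_packing_sum\<close> applies to the sum
  over \<open>f\<close>. A centre at \<one> has probability \<open>p\<close>, and each of at most
  \<open>(card F)\<^sup>2\<close> ordered pairs of points contributes \<open>p\<^sup>2\<close> to
  the loss.\<close>

theorem packing_law_drift_ge:
  assumes cnt: "countable (carrier G)"
    and F: "finite F" "F \<subseteq> carrier G" and \<Lambda>: "local_kernel K \<Lambda>" and K: "finite K" "K \<subseteq> carrier G"
    and S: "finite S" "S \<subseteq> carrier G" and p: "0 \<le> p" "p \<le> 1"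
    and bad: "\<And>\<xi>. \<xi> \<in> prob_fields K \<Longrightarrow> \<epsilon> * real (card F) \<le> (\<Sum>x\<in>F. site_cost {s\<in>S. x \<otimes> s \<in> F} \<xi> x)"
  shows "\<epsilon> * (p * real (card F)) - 4 * real (card S) * (p * real (card F))\<^sup>2 \<le> (\<integral>r. drift S \<Lambda> r \<partial>packing_law F p)"
proof -
  interpret C: prob_space "config p" by (rule prob_space_config)
  note meas = packing_measurable[OF cnt F, of p]
  have drift_meas: "drift S \<Lambda> \<in> borel_measurable (borel_of (eqrel_topology G))"
    by (rule continuous_map_borel_eqrel[OF local_continuous[OF local_drift[OF \<Lambda> K S]]])
  define N where "N = real (card S)"
  define d where "d = (\<lambda>\<omega>. drift S \<Lambda> (packing F \<omega>))"
  have d_meas: "d \<in> borel_measurable (config p)"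
    unfolding d_def by (rule measurable_compose[OF meas drift_meas])
  have d0: "0 \<le> d \<omega>" for \<omega> unfolding d_def by (rule drift_nonneg)
  have d2: "d \<omega> \<le> 2 * N" for \<omega>
    unfolding d_def N_def by (rule drift_le) (use \<Lambda> S packing_eqrels in \<open>auto simp: local_kernel_def\<close>)
  have int_eq: "(\<integral>r. drift S \<Lambda> r \<partial>packing_law F p) = (\<integral>\<omega>. d \<omega> \<partial>config p)"
    unfolding packing_law_def d_def by (rule integral_distr[OF meas drift_meas])
  \<comment> \<open>Here \<one> sits at position \<open>f\<close> of the translate with centre
    \<open>inv f\<close>; the events are disjoint because the covering centre is unique.\<close>
  define A where "A = (\<lambda>f. {\<omega> \<in> space (config p). covers F \<omega> (inv f) \<one>})"
  have A: "A f \<in> sets (config p)" if "f \<in> F" for f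
    unfolding A_def by (rule covers_event[OF F]) (use that F in auto)
  have Ad_int: "integrable (config p) (\<lambda>\<omega>. indicator (A f) \<omega> * d \<omega>)" if "f \<in> F" for f
  proof (rule C.integrable_const_bound[of _ "2 * N"])
    show "(\<lambda>\<omega>. indicator (A f) \<omega> * d \<omega>) \<in> borel_measurable (config p)"
      using A[OF that] d_meas by measurable
  qed (use d0 d2 in \<open>auto simp: indicator_def N_def\<close>)
  have le: "(\<Sum>f\<in>F. indicator (A f) \<omega> * d \<omega>) \<le> d \<omega>" for \<omega>
  proof -
    have "(\<Sum>f\<in>F. indicator (A f) \<omega> :: real) \<le> 1"
    proof -
      have "f = f'" if "f \<in> F" "f' \<in> F" "\<omega> \<in> A f" "\<omega> \<in> A f'" for f f'
      proof -
        have "inv f = inv f'" using that covers_unique by (auto simp: A_def)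
        then show ?thesis using that F(2) by (metis inv_inv subsetD)
      qed
      then have "card {f\<in>F. \<omega> \<in> A f} \<le> Suc 0"
        by (subst card_le_Suc0_iff_eq) (use F in auto)
      then show ?thesis using F(1) by (simp add: indicator_def sum.inter_filter[symmetric] of_bool_def)
    qed
    then have "(\<Sum>f\<in>F. indicator (A f) \<omega> :: real) * d \<omega> \<le> 1 * d \<omega>"
      by (rule mult_right_mono) (rule d0)
    then show ?thesis by (simp add: sum_distrib_right)
  qed
  define h where "h = (\<lambda>f \<omega>. if covers F \<omega> \<one> f then drift S \<Lambda> (shift G (inv f) (packing F \<omega>)) else 0)"
  have moved: "indicator (A f) (move (inv f) \<omega>) * d (move (inv f) \<omega>) = h f \<omega>"
    if f: "f \<in> F" and \<omega>: "\<omega> \<in> space (config p)" for f \<omega>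
  proof -
    have fc: "f \<in> carrier G" using f F by blast
    have "covers F \<omega> (f \<otimes> inv f) (f \<otimes> \<one>) \<longleftrightarrow> covers F (move (inv f) \<omega>) (inv f) \<one>"
      by (rule covers_shift[OF F(2) fc]) (use fc in \<open>auto simp: move_def\<close>)
    then have "covers F (move (inv f) \<omega>) (inv f) \<one> \<longleftrightarrow> covers F \<omega> \<one> f" using fc by simp
    moreover have "move (inv f) \<omega> \<in> space (config p)"
      using measurable_space[OF move_measurable[OF inv_closed[OF fc]] \<omega>] .
    moreover have "packing F (move (inv f) \<omega>) = shift G (inv f) (packing F \<omega>)"
      by (rule packing_move[OF F(2) inv_closed[OF fc]])
    ultimately show ?thesis by (auto simp: h_def A_def d_def indicator_def)
  qed
  have h_int: "integrable (config p) (h f)" "(\<integral>\<omega>. indicator (A f) \<omega> * d \<omega> \<partial>config p) = (\<integral>\<omega>. h f \<omega> \<partial>config p)"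
    if f: "f \<in> F" for f
  proof -
    have fc: "inv f \<in> carrier G" using f F by blast
    have m: "(\<lambda>\<omega>. indicator (A f) \<omega> * d \<omega>) \<in> borel_measurable (config p)"
      using Ad_int[OF f] by (rule borel_measurable_integrable)
    have "integrable (config p) (\<lambda>\<omega>. indicator (A f) (move (inv f) \<omega>) * d (move (inv f) \<omega>))"
      using integrable_distr[OF move_measurable[OF fc], of p "\<lambda>\<omega>. indicator (A f) \<omega> * d \<omega>"] Ad_int[OF f]
      by (simp add: distr_move[OF fc])
    then show "integrable (config p) (h f)"
      by (rule Bochner_Integration.integrable_cong[THEN iffD1, rotated -1]) (simp_all add: moved f)
    have "(\<integral>\<omega>. indicator (A f) \<omega> * d \<omega> \<partial>config p) = (\<integral>\<omega>. indicator (A f) \<omega> * d \<omega> \<partial>distr (config p) (config p) (move (inv f)))"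
      by (simp add: distr_move[OF fc])
    also have "\<dots> = (\<integral>\<omega>. indicator (A f) (move (inv f) \<omega>) * d (move (inv f) \<omega>) \<partial>config p)"
      by (rule integral_distr[OF move_measurable[OF fc] m])
    also have "\<dots> = (\<integral>\<omega>. h f \<omega> \<partial>config p)"
      by (rule Bochner_Integration.integral_cong) (simp_all add: moved f)
    finally show "(\<integral>\<omega>. indicator (A f) \<omega> * d \<omega> \<partial>config p) = (\<integral>\<omega>. h f \<omega> \<partial>config p)" .
  qed
  define B1 where "B1 = {\<omega> \<in> space (config p). \<forall>c\<in>{\<one>}. \<omega> c}"
  define B2 where "B2 = (\<lambda>f f'. {\<omega> \<in> space (config p). \<forall>c\<in>{\<one>, f \<otimes> inv f'}. \<omega> c})"
  have B1: "B1 \<in> sets (config p)" "measure (config p) B1 = p"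
    unfolding B1_def using config_prob[OF p, of "{\<one>}"] config_event[OF one_closed] by auto
  \<comment> \<open>For \<open>f \<noteq> f'\<close> the two centres are different coordinates of
    the product, hence independent.\<close>
  have B2: "B2 f f' \<in> sets (config p)" "measure (config p) (B2 f f') = p\<^sup>2" if "f \<in> F" "f' \<in> F - {f}" for f f'
  proof -
    have c: "f \<in> carrier G" "f' \<in> carrier G" "f \<noteq> f'" using that F by auto
    then have ne: "f \<otimes> inv f' \<noteq> \<one>" using inv_equality[of f "inv f'"] by auto
    then show "measure (config p) (B2 f f') = p\<^sup>2"
      unfolding B2_def using config_prob[OF p, of "{\<one>, f \<otimes> inv f'}"] c by (simp add: numeral_2_eq_2)
    show "B2 f f' \<in> sets (config p)"
      unfolding B2_def
      by (intro sets.sets_Collect_finite_All config_event) (use c in auto)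
  qed
  define low where "low = (\<lambda>\<omega>. \<epsilon> * real (card F) * indicator B1 \<omega> - 4 * N * (\<Sum>f\<in>F. \<Sum>f'\<in>F - {f}. indicator (B2 f f') \<omega>))"
  have low_le: "low \<omega> \<le> (\<Sum>f\<in>F. h f \<omega>)" if \<omega>: "\<omega> \<in> space (config p)" for \<omega>
  proof (cases "\<omega> \<one>")
    case True
    have "low \<omega> = \<epsilon> * real (card F) - 4 * N * (\<Sum>f\<in>F. \<Sum>f'\<in>F - {f}. if \<omega> \<one> \<and> \<omega> (f \<otimes> inv f') then 1 else 0)"
      unfolding low_def using \<omega> True by (simp add: B1_def B2_def indicator_def of_bool_def)
    also have "\<dots> \<le> \<epsilon> * real (card F) - 4 * N * real (card {f\<in>F. \<not> covers F \<omega> \<one> f})"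
      using card_uncovered_le[OF F, of \<omega>] True by (intro diff_left_mono mult_left_mono) (auto simp: N_def)
    also have "\<dots> \<le> (\<Sum>f\<in>F. h f \<omega>)"
      unfolding h_def N_def by (rule drift_packing_sum[OF F \<Lambda> S bad])
    finally show ?thesis .
  next
    case False
    then have "low \<omega> = 0" by (simp add: low_def B1_def B2_def indicator_def)
    moreover have "0 \<le> (\<Sum>f\<in>F. h f \<omega>)" unfolding h_def by (intro sum_nonneg) (simp add: drift_nonneg)
    ultimately show ?thesis by simp
  qed
  have ind_int: "integrable (config p) (indicat_real B1)"
    "\<And>f f'. f \<in> F \<Longrightarrow> f' \<in> F - {f} \<Longrightarrow> integrable (config p) (indicat_real (B2 f f'))"
    using B1 B2 by (auto intro!: integrable_real_indicator simp: C.emeasure_eq_measure)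
  have low_int: "integrable (config p) low"
    unfolding low_def
    by (intro Bochner_Integration.integrable_diff integrable_mult_right Bochner_Integration.integrable_sum ind_int) auto
  have "(\<integral>\<omega>. low \<omega> \<partial>config p) = \<epsilon> * real (card F) * p - 4 * N * (\<Sum>f\<in>F. \<Sum>f'\<in>F - {f}. p\<^sup>2)"
  proof -
    have "(\<integral>\<omega>. (\<Sum>f\<in>F. \<Sum>f'\<in>F - {f}. indicat_real (B2 f f') \<omega>) \<partial>config p) = (\<Sum>f\<in>F. \<Sum>f'\<in>F - {f}. p\<^sup>2)"
    proof -
      have "(\<integral>\<omega>. (\<Sum>f\<in>F. \<Sum>f'\<in>F - {f}. indicat_real (B2 f f') \<omega>) \<partial>config p) =
          (\<Sum>f\<in>F. \<integral>\<omega>. (\<Sum>f'\<in>F - {f}. indicat_real (B2 f f') \<omega>) \<partial>config p)"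
        by (intro Bochner_Integration.integral_sum Bochner_Integration.integrable_sum ind_int)
      also have "\<dots> = (\<Sum>f\<in>F. \<Sum>f'\<in>F - {f}. \<integral>\<omega>. indicat_real (B2 f f') \<omega> \<partial>config p)"
        by (intro sum.cong refl Bochner_Integration.integral_sum ind_int)
      also have "\<dots> = (\<Sum>f\<in>F. \<Sum>f'\<in>F - {f}. p\<^sup>2)"
        by (intro sum.cong refl) (simp add: B2)
      finally show ?thesis .
    qed
    moreover have "(\<integral>\<omega>. indicat_real B1 \<omega> \<partial>config p) = p" using B1 by simp
    ultimately show ?thesis
      unfolding low_def
      by (subst Bochner_Integration.integral_diff)
         (auto intro!: integrable_mult_right Bochner_Integration.integrable_sum ind_int)
  qed
  moreover have "(\<Sum>f\<in>F. \<Sum>f'\<in>F - {f}. p\<^sup>2) \<le> (\<Sum>f\<in>F. \<Sum>f'\<in>F. p\<^sup>2)"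
    by (intro sum_mono sum_mono2) (use F in auto)
  then have "4 * N * (\<Sum>f\<in>F. \<Sum>f'\<in>F - {f}. p\<^sup>2) \<le> 4 * N * (p * real (card F))\<^sup>2"
    by (intro mult_left_mono) (auto simp: N_def power2_eq_square algebra_simps)
  ultimately have "\<epsilon> * (p * real (card F)) - 4 * N * (p * real (card F))\<^sup>2 \<le> (\<integral>\<omega>. low \<omega> \<partial>config p)"
    by (simp add: mult.commute mult.left_commute)
  also have "\<dots> \<le> (\<integral>\<omega>. (\<Sum>f\<in>F. h f \<omega>) \<partial>config p)"
    by (intro integral_mono low_int Bochner_Integration.integrable_sum h_int low_le)
  also have "\<dots> = (\<Sum>f\<in>F. \<integral>\<omega>. h f \<omega> \<partial>config p)"
    by (rule Bochner_Integration.integral_sum) (rule h_int)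
  also have "\<dots> = (\<Sum>f\<in>F. \<integral>\<omega>. indicator (A f) \<omega> * d \<omega> \<partial>config p)"
    by (simp add: h_int)
  also have "\<dots> = (\<integral>\<omega>. (\<Sum>f\<in>F. indicator (A f) \<omega> * d \<omega>) \<partial>config p)"
    by (rule Bochner_Integration.integral_sum[symmetric]) (rule Ad_int)
  also have "\<dots> \<le> (\<integral>\<omega>. d \<omega> \<partial>config p)"
  proof (rule integral_mono)
    show "integrable (config p) d"
      by (rule C.integrable_const_bound[of _ "2 * N"]) (use d0 d2 d_meas in auto)
  qed (auto intro: le Bochner_Integration.integrable_sum Ad_int)
  finally show ?thesis by (simp add: int_eq N_def)
qed

end

section \<open>Amenable invariant random equivalence relations\<close>

lemma filterlim_exhaustion:
  assumes "\<And>m. finite (B m)" "\<And>m. B m \<subseteq> A" "\<And>m n. m \<le> n \<Longrightarrow> B m \<subseteq> B n" "A \<subseteq> (\<Union>m::nat. B m)"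
  shows "filterlim B (finite_subsets_at_top A) sequentially"
  unfolding filterlim_finite_subsets_at_top
proof (intro allI impI)
  fix X assume X: "finite X \<and> X \<subseteq> A"
  have "eventually (\<lambda>m. x \<in> B m) sequentially" if x: "x \<in> X" for x
  proof -
    obtain m where "x \<in> B m" using x X assms(4) by blast
    then show ?thesis using assms(3) unfolding eventually_sequentially by blast
  qed
  then have "eventually (\<lambda>m. \<forall>x\<in>X. x \<in> B m) sequentially"
    using X by (simp add: eventually_ball_finite)
  then show "eventually (\<lambda>m. finite (B m) \<and> X \<subseteq> B m \<and> B m \<subseteq> A) sequentially"
    by eventually_elim (use assms(1,2) in auto)
qed

text \<open>The filter form serves two purposes: sums over the group become limits along
  \<open>B m\<close>, and every finite set is eventually contained in \<open>B m\<close>.\<close>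

lemma (in group) obtain_exhaustion:
  assumes "countable (carrier G)"
  obtains B :: "nat \<Rightarrow> 'a set" where "\<And>m. finite (B m)" "\<And>m. B m \<subseteq> carrier G" "\<And>m. \<one> \<in> B m"
    "filterlim B (finite_subsets_at_top (carrier G)) sequentially"
proof -
  define e where "e = from_nat_into (carrier G)"
  have e: "range e = carrier G"
    unfolding e_def by (rule range_from_nat_into) (use assms in auto)
  define B where "B = (\<lambda>m. insert \<one> (e ` {..<m::nat}))"
  have B: "finite (B m)" "B m \<subseteq> carrier G" "\<one> \<in> B m" for m using e by (auto simp: B_def)
  have "filterlim B (finite_subsets_at_top (carrier G)) sequentially"
  proof (rule filterlim_exhaustion[OF B(1,2)])
    show "B m \<subseteq> B n" if "m \<le> n" for m n using that by (auto simp: B_def)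
    show "carrier G \<subseteq> (\<Union>m. B m)" unfolding e[symmetric] B_def by blast
  qed
  with B show ?thesis by (rule that)
qed

text \<open>Approximations of the masses need not add up to 1 and may all vanish; the point mass at
  \<open>x\<close> is the fallback that avoids division by 0.\<close>

definition normalize_on :: "'g set \<Rightarrow> 'g \<Rightarrow> ('g \<Rightarrow> real) \<Rightarrow> 'g \<Rightarrow> real" where
  "normalize_on K x a h = (if h \<in> K then
     if 0 < (\<Sum>k\<in>K. a k) then a h / (\<Sum>k\<in>K. a k) else of_bool (h = x) else 0)"

lemma normalize_on_Prob:
  assumes "finite K" "K \<subseteq> carrier G" "x \<in> K" "\<And>k. k \<in> K \<Longrightarrow> 0 \<le> a k"
  shows "normalize_on K x a \<in> Prob G"
proof (rule Prob_finiteI[OF assms(1,2)])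
  show "(\<Sum>h\<in>K. normalize_on K x a h) = 1"
  proof (cases "0 < (\<Sum>k\<in>K. a k)")
    case True
    have "(\<Sum>h\<in>K. normalize_on K x a h) = (\<Sum>h\<in>K. a h / (\<Sum>k\<in>K. a k))"
      by (rule sum.cong) (use True in \<open>simp_all add: normalize_on_def\<close>)
    also have "\<dots> = (\<Sum>h\<in>K. a h) / (\<Sum>k\<in>K. a k)" by (rule sum_divide_distrib[symmetric])
    finally show ?thesis using True by simp
  next
    case False
    then have "(\<Sum>h\<in>K. normalize_on K x a h) = (\<Sum>h\<in>K. if h = x then 1 else 0)"
      by (intro sum.cong) (auto simp: normalize_on_def)
    then show ?thesis using assms(1,3) by simp
  qed
qed (use assms(4) in \<open>auto simp: normalize_on_def intro!: divide_nonneg_nonneg sum_nonneg\<close>)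

text \<open>Inside \<open>K\<close>, rescaling by the total \<open>m\<close> costs
  \<open>1 - m\<close> in absolute value, at most the tail of \<open>\<eta>\<close> plus the
  approximation error, and the error is paid once more; outside \<open>K\<close> the tail is paid
  again. The constants leave room for the fallback case, where tail and error add up to 1.\<close>

lemma normalize_on_dist:
  assumes K: "finite K" "K \<subseteq> carrier G" "x \<in> K" and a: "\<And>k. k \<in> K \<Longrightarrow> 0 \<le> a k" and \<eta>: "\<eta> \<in> Prob G"
    and Q: "finite Q" "Q \<subseteq> carrier G"
  shows "(\<Sum>h\<in>Q. \<bar>normalize_on K x a h - \<eta> h\<bar>) \<le>
    3 * (1 - (\<Sum>k\<in>K. \<eta> k)) + 2 * (\<Sum>k\<in>K. \<bar>a k - \<eta> k\<bar>)"
proof -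
  define t where "t = 1 - (\<Sum>k\<in>K. \<eta> k)"
  define d where "d = (\<Sum>k\<in>K. \<bar>a k - \<eta> k\<bar>)"
  define m where "m = (\<Sum>k\<in>K. a k)"
  have \<eta>0: "0 \<le> \<eta> h" for h using \<eta> by (cases "h \<in> carrier G") (auto simp: Prob_def)
  have t: "0 \<le> t" unfolding t_def using Prob_sum_le_1[OF \<eta> K(1,2)] by simp
  have d: "0 \<le> d" unfolding d_def by (intro sum_nonneg) simp
  have m0: "0 \<le> m" unfolding m_def by (intro sum_nonneg a)
  have inK: "(\<Sum>h\<in>K. \<bar>normalize_on K x a h - \<eta> h\<bar>) \<le> 2 * t + 2 * d"
  proof (cases "0 < m")
    case True
    have "(\<Sum>h\<in>K. \<bar>normalize_on K x a h - \<eta> h\<bar>) \<le> (\<Sum>h\<in>K. \<bar>a h / m - a h\<bar> + \<bar>a h - \<eta> h\<bar>)"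
      by (rule sum_mono) (use True in \<open>simp add: normalize_on_def m_def\<close>)
    also have "\<dots> = (\<Sum>h\<in>K. \<bar>a h / m - a h\<bar>) + d" by (simp add: sum.distrib d_def)
    also have "(\<Sum>h\<in>K. \<bar>a h / m - a h\<bar>) = (\<Sum>h\<in>K. a h * \<bar>1 / m - 1\<bar>)"
    proof (rule sum.cong[OF refl])
      fix h assume "h \<in> K"
      have "a h / m - a h = a h * (1 / m - 1)" by (simp add: algebra_simps)
      then show "\<bar>a h / m - a h\<bar> = a h * \<bar>1 / m - 1\<bar>" using a[OF \<open>h \<in> K\<close>] by (simp add: abs_mult)
    qed
    also have "\<dots> = m * \<bar>1 / m - 1\<bar>" by (simp add: sum_distrib_right m_def)
    also have "\<dots> = \<bar>m * (1 / m - 1)\<bar>" using True by (simp add: abs_mult)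
    also have "m * (1 / m - 1) = 1 - m" using True by (simp add: algebra_simps)
    also have "\<bar>1 - m\<bar> \<le> t + d"
    proof -
      have "\<bar>m - (\<Sum>k\<in>K. \<eta> k)\<bar> \<le> d"
        unfolding m_def d_def sum_subtractf[symmetric] by (rule sum_abs)
      then show ?thesis using t unfolding t_def by linarith
    qed
    finally show ?thesis using t by linarith
  next
    case False
    then have m: "m = 0" using m0 by simp
    then have a0: "a k = 0" if "k \<in> K" for k
      using sum_nonneg_eq_0_iff[of K a] K(1) a that unfolding m_def by blast
    have dt: "d = 1 - t" unfolding d_def t_def using a0 \<eta>0 by simp
    have "(\<Sum>h\<in>K. \<bar>normalize_on K x a h - \<eta> h\<bar>) \<le> (\<Sum>h\<in>K. (if h = x then 1 else 0) + \<eta> h)"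
    proof (rule sum_mono)
      fix h
      show "\<bar>normalize_on K x a h - \<eta> h\<bar> \<le> (if h = x then 1 else 0) + \<eta> h"
        using \<eta>0[of h] m by (auto simp: normalize_on_def m_def abs_le_iff)
    qed
    also have "\<dots> = 1 + (1 - t)" using K(1,3) by (simp add: sum.distrib t_def)
    finally show ?thesis using dt t by linarith
  qed
  have outK: "(\<Sum>h\<in>Q - K. \<bar>normalize_on K x a h - \<eta> h\<bar>) \<le> t"
  proof -
    have "(\<Sum>h\<in>Q - K. \<bar>normalize_on K x a h - \<eta> h\<bar>) = (\<Sum>h\<in>Q - K. \<eta> h)"
      by (rule sum.cong) (use \<eta>0 in \<open>auto simp: normalize_on_def\<close>)
    moreover have "(\<Sum>h\<in>Q - K. \<eta> h) + (\<Sum>h\<in>K. \<eta> h) = (\<Sum>h\<in>(Q - K) \<union> K. \<eta> h)"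
      by (rule sum.union_disjoint[symmetric]) (use K Q in auto)
    moreover have "(\<Sum>h\<in>(Q - K) \<union> K. \<eta> h) \<le> 1"
      by (rule Prob_sum_le_1[OF \<eta>]) (use K Q in auto)
    ultimately show ?thesis by (simp add: t_def)
  qed
  have "(\<Sum>h\<in>Q. \<bar>normalize_on K x a h - \<eta> h\<bar>) \<le> (\<Sum>h\<in>K \<union> (Q - K). \<bar>normalize_on K x a h - \<eta> h\<bar>)"
    by (rule sum_mono2) (use K Q in auto)
  also have "\<dots> = (\<Sum>h\<in>K. \<bar>normalize_on K x a h - \<eta> h\<bar>) + (\<Sum>h\<in>Q - K. \<bar>normalize_on K x a h - \<eta> h\<bar>)"
    by (rule sum.union_disjoint) (use K Q in auto)
  also have "\<dots> \<le> 3 * t + 2 * d" using inK outK by linarith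
  finally show ?thesis by (simp add: t_def d_def)
qed

text \<open>Evaluation at a point is 1-Lipschitz for the norm.\<close>

lemma eval_measurable:
  assumes h: "h \<in> carrier G"
  shows "(\<lambda>\<eta>. \<eta> h) \<in> borel_measurable (borel_of (Prob_topology G))"
proof (rule borel_measurableI)
  fix U :: "real set" assume U: "open U"
  interpret MS: Metric_space "Prob G" "l1_dist G" by (rule Metric_space_Prob)
  have "openin (Prob_topology G) {\<eta> \<in> Prob G. \<eta> h \<in> U}"
    unfolding Prob_topology_def MS.openin_mtopology
  proof (intro conjI allI impI)
    fix \<eta> assume \<eta>: "\<eta> \<in> {\<eta> \<in> Prob G. \<eta> h \<in> U}"
    then obtain e where e: "e > 0" "\<And>y. dist y (\<eta> h) < e \<Longrightarrow> y \<in> U"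
      using U unfolding open_dist by blast
    have "MS.mball \<eta> e \<subseteq> {\<eta> \<in> Prob G. \<eta> h \<in> U}"
    proof
      fix \<theta> assume "\<theta> \<in> MS.mball \<eta> e"
      then have \<theta>: "\<theta> \<in> Prob G" "l1_dist G \<eta> \<theta> < e" by auto
      have "\<bar>\<eta> h - \<theta> h\<bar> \<le> l1_dist G \<eta> \<theta>"
        using sum_abs_diff_le_l1_dist[of \<eta> G \<theta> "{h}"] \<eta> \<theta> h by simp
      then have "dist (\<theta> h) (\<eta> h) < e" using \<theta>(2) by (simp add: dist_real_def abs_minus_commute)
      then show "\<theta> \<in> {\<eta> \<in> Prob G. \<eta> h \<in> U}" using e(2) \<theta>(1) by simp
    qed
    then show "\<exists>r>0. MS.mball \<eta> r \<subseteq> {\<eta> \<in> Prob G. \<eta> h \<in> U}" using e(1) by blast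
  qed auto
  moreover have "(\<lambda>\<eta>. \<eta> h) -` U \<inter> space (borel_of (Prob_topology G)) = {\<eta> \<in> Prob G. \<eta> h \<in> U}"
    by (auto simp: space_borel_of topspace_Prob_topology)
  ultimately show "(\<lambda>\<eta>. \<eta> h) -` U \<inter> space (borel_of (Prob_topology G)) \<in> sets (borel_of (Prob_topology G))"
    by (simp add: sets_borel_of sigma_sets.Basic)
qed

context group
begin

text \<open>For large \<open>n\<close> the given Borel map \<open>l n\<close> has small drift in
  mean, by dominated convergence. It is cut off to a finite set carrying nearly all mass on average,
  its finitely many values are approximated in mean by local functions, and the result is
  renormalised. The error enters at \<open>r\<close> and at its shift; by invariance of
  \<open>\<rho>\<close> both have the same integral.\<close>

theorem amenable_IRE_local_kernel:
  assumes cnt: "countable (carrier G)" and am: "amenable_IRE G \<rho>"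
    and S: "finite S" "S \<subseteq> carrier G" and \<delta>: "\<delta> > 0"
  shows "\<exists>K \<Lambda>. finite K \<and> K \<subseteq> carrier G \<and> local_kernel K \<Lambda> \<and> (\<integral>r. drift S \<Lambda> r \<partial>\<rho>) < \<delta>"
proof -
  have IRE: "IRE G \<rho>" using am by (simp add: amenable_IRE_def)
  then have P: "prob_space \<rho>" and sets\<rho>: "sets \<rho> = sets (borel_of (eqrel_topology G))"
    by (auto simp: IRE_def)
  interpret prob_space \<rho> by (rule P)
  have sp: "space \<rho> = eqrels G" using sets_eq_imp_space_eq[OF sets\<rho>] by (simp add: space_borel_eqrel)
  obtain l :: "nat \<Rightarrow> ('a \<times> 'a) set \<Rightarrow> 'a \<Rightarrow> real" where
    l: "\<And>n. l n \<in> borel_of (eqrel_topology G) \<rightarrow>\<^sub>M borel_of (Prob_topology G)" and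
    conv: "AE r in \<rho>. \<forall>g \<in> r `` {\<one>}.
       (\<lambda>n. l1_dist G (translate G (inv g) (l n r)) (l n (shift G (inv g) r))) \<longlonglongrightarrow> 0"
    using am unfolding amenable_IRE_def by blast
  have lP: "l n r \<in> Prob G" if "r \<in> eqrels G" for n r
    using measurable_space[OF l] that by (simp add: space_borel_of topspace_eqrel_topology topspace_Prob_topology)
  have lm: "(\<lambda>r. l n r h) \<in> borel_measurable \<rho>" if "h \<in> carrier G" for n h
    using measurable_compose[OF l eval_measurable[OF that]] measurable_cong_sets[OF sets\<rho> refl] by blast
  have shift_m: "shift G g \<in> \<rho> \<rightarrow>\<^sub>M \<rho>" if "g \<in> carrier G" for g
    using shift_measurable[OF cnt that] measurable_cong_sets[OF sets\<rho> sets\<rho>] by blast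
  have shift_E: "shift G (inv s) r \<in> eqrels G" if "s \<in> carrier G" "r \<in> eqrels G" for s r
    by (rule shift_eqrels[OF is_group inv_closed]) (use that in auto)
  define N where "N = real (card S)"
  \<comment> \<open>The error has integral at most \<open>5 * \<delta>'\<close> and enters twice for
    each element of \<open>S\<close>, in total at most \<open>10 * N * \<delta>'\<close>, which is
    at most \<open>\<delta> / 2\<close>. The \<open>+ 1\<close> covers \<open>N = 0\<close>.\<close>
  define \<delta>' where "\<delta>' = \<delta> / (20 * (N + 1))"
  have N0: "0 \<le> N" by (simp add: N_def)
  have \<delta>': "\<delta>' > 0" using \<delta> N0 by (simp add: \<delta>'_def)
  obtain B :: "nat \<Rightarrow> 'a set" where B: "\<And>m. finite (B m)" "\<And>m. B m \<subseteq> carrier G" "\<And>m. \<one> \<in> B m"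
    "filterlim B (finite_subsets_at_top (carrier G)) sequentially"
    using obtain_exhaustion[OF cnt] by blast
  have l_sum: "0 \<le> (\<Sum>k\<in>K. l n r k) \<and> (\<Sum>k\<in>K. l n r k) \<le> 1"
    if "finite K" "K \<subseteq> carrier G" "r \<in> eqrels G" for K n r
    using Prob_sum_le_1[OF lP[OF that(3)] that(1,2)] lP[OF that(3), of n] that(2)
    by (auto simp: Prob_def intro!: sum_nonneg)
  have l_sum_int: "integrable \<rho> (\<lambda>r. \<Sum>k\<in>K. l n r k)" if "finite K" "K \<subseteq> carrier G" for K n
  proof (rule integrable_const_bound[of _ 1])
    show "(\<lambda>r. \<Sum>k\<in>K. l n r k) \<in> borel_measurable \<rho>"
      by (rule borel_measurable_sum) (use lm that in auto)
  qed (use l_sum[OF that] in \<open>auto simp: sp\<close>)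
  have "\<forall>n. \<exists>K. finite K \<and> K \<subseteq> carrier G \<and> \<one> \<in> K \<and> (\<integral>r. 1 - (\<Sum>k\<in>K. l n r k) \<partial>\<rho>) < \<delta>'"
  proof
    fix n
    have "(\<lambda>m. \<integral>r. (\<Sum>k\<in>B m. l n r k) \<partial>\<rho>) \<longlonglongrightarrow> (\<integral>r. 1 \<partial>\<rho>)"
    proof (rule integral_dominated_convergence[where w = "\<lambda>_. 1"])
      show "AE r in \<rho>. (\<lambda>m. \<Sum>k\<in>B m. l n r k) \<longlonglongrightarrow> 1"
      proof (rule AE_I2)
        fix r assume "r \<in> space \<rho>"
        then have "(l n r has_sum 1) (carrier G)" using lP[of r n] by (simp add: sp Prob_def)
        then show "(\<lambda>m. \<Sum>k\<in>B m. l n r k) \<longlonglongrightarrow> 1"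
          unfolding has_sum_def by (rule filterlim_compose[OF _ B(4)])
      qed
      show "(\<lambda>r. \<Sum>k\<in>B m. l n r k) \<in> borel_measurable \<rho>" for m
        using l_sum_int[OF B(1,2)] by (rule borel_measurable_integrable)
      show "AE r in \<rho>. norm (\<Sum>k\<in>B m. l n r k) \<le> 1" for m
        by (rule AE_I2) (use l_sum[OF B(1,2)] in \<open>auto simp: sp\<close>)
    qed auto
    then have "eventually (\<lambda>m. (\<integral>r. (\<Sum>k\<in>B m. l n r k) \<partial>\<rho>) > 1 - \<delta>') sequentially"
      using \<delta>' by (intro order_tendstoD) (auto simp: prob_space)
    then obtain m where "(\<integral>r. (\<Sum>k\<in>B m. l n r k) \<partial>\<rho>) > 1 - \<delta>'"
      by (auto simp: eventually_sequentially)
    then have "(\<integral>r. 1 - (\<Sum>k\<in>B m. l n r k) \<partial>\<rho>) < \<delta>'"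
      using l_sum_int[OF B(1,2), of n m] by (simp add: prob_space)
    then show "\<exists>K. finite K \<and> K \<subseteq> carrier G \<and> \<one> \<in> K \<and> (\<integral>r. 1 - (\<Sum>k\<in>K. l n r k) \<partial>\<rho>) < \<delta>'"
      by (intro exI[of _ "B m"] conjI B)
  qed
  from choice[OF this] obtain K where
    "\<forall>n. finite (K n) \<and> K n \<subseteq> carrier G \<and> \<one> \<in> K n \<and> (\<integral>r. 1 - (\<Sum>k\<in>K n. l n r k) \<partial>\<rho>) < \<delta>'" ..
  then have K: "\<And>n. finite (K n)" "\<And>n. K n \<subseteq> carrier G" "\<And>n. \<one> \<in> K n"
    and tail: "\<And>n. (\<integral>r. 1 - (\<Sum>k\<in>K n. l n r k) \<partial>\<rho>) < \<delta>'" by simp_all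
  define Q where "Q = (\<lambda>n s. K n \<union> (\<lambda>k. s \<otimes> k) ` K n)"
  have Q: "finite (Q n s)" "Q n s \<subseteq> carrier G" if "s \<in> carrier G" for n s
    using that K by (auto simp: Q_def)
  \<comment> \<open>The norm cut off to a finite set is a measurable finite sum. It is below the
    full norm whatever \<open>K n\<close> is, so its convergence is unaffected by the growth of
    \<open>K n\<close>.\<close>
  define D where "D = (\<lambda>n s r. \<Sum>h\<in>Q n s. \<bar>l n r h - l n (shift G (inv s) r) (inv s \<otimes> h)\<bar>)"
  have D0: "0 \<le> D n s r" for n s r unfolding D_def by (intro sum_nonneg) simp
  have D_le: "D n s r \<le> l1_dist G (translate G (inv s) (l n r)) (l n (shift G (inv s) r))"
    if s: "s \<in> carrier G" and r: "r \<in> eqrels G" for n s r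
  proof -
    have P2: "translate G s (l n (shift G (inv s) r)) \<in> Prob G"
      by (rule translate_Prob[OF is_group s lP[OF shift_E[OF s r]]])
    have "D n s r = (\<Sum>h\<in>Q n s. \<bar>l n r h - translate G s (l n (shift G (inv s) r)) h\<bar>)"
      unfolding D_def by (rule sum.cong) (use Q(2)[OF s, of n] in \<open>auto simp: translate_def\<close>)
    also have "\<dots> \<le> l1_dist G (l n r) (translate G s (l n (shift G (inv s) r)))"
      by (rule sum_abs_diff_le_l1_dist[OF lP[OF r] P2 Q[OF s]])
    also have "l n r = translate G s (translate G (inv s) (l n r))"
      using lP[OF r, of n] s by (simp add: translate_translate translate_one Prob_def)
    finally show ?thesis by (simp add: l1_dist_translate[OF s])
  qed
  have D_le2: "D n s r \<le> 2" if "s \<in> carrier G" "r \<in> eqrels G" for n s r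
    using D_le[OF that, of n] l1_dist_le_2[OF translate_Prob[OF is_group inv_closed[OF that(1)] lP[OF that(2)]] lP[OF shift_E[OF that]], of n n]
    by linarith
  have mem_sets: "{r \<in> space \<rho>. (\<one>, s) \<in> r} \<in> sets \<rho>" if "s \<in> carrier G" for s
    using local_setsI[OF local_mem[OF one_closed that]]
    by (simp add: sp sets\<rho> sets_borel_eqrel[OF cnt] sigma_sets.Basic)
  define T where "T = (\<lambda>n r. \<Sum>s\<in>S. if (\<one>, s) \<in> r then D n s r else 0)"
  have T_meas: "T n \<in> borel_measurable \<rho>" for n
    unfolding T_def
  proof (rule borel_measurable_sum)
    fix s assume "s \<in> S"
    then have s: "s \<in> carrier G" using S by blast
    have "D n s \<in> borel_measurable \<rho>"
      unfolding D_def
    proof (intro borel_measurable_sum borel_measurable_abs borel_measurable_diff)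
      fix h assume "h \<in> Q n s"
      then have h: "h \<in> carrier G" "inv s \<otimes> h \<in> carrier G" using Q(2)[OF s] s by auto
      show "(\<lambda>r. l n r h) \<in> borel_measurable \<rho>" by (rule lm[OF h(1)])
      show "(\<lambda>r. l n (shift G (inv s) r) (inv s \<otimes> h)) \<in> borel_measurable \<rho>"
        by (rule measurable_compose[OF shift_m[OF inv_closed[OF s]] lm[OF h(2)]])
    qed
    then show "(\<lambda>r. if (\<one>, s) \<in> r then D n s r else 0) \<in> borel_measurable \<rho>"
      by (intro measurable_If mem_sets s) auto
  qed
  have T_bounds: "0 \<le> T n r" "T n r \<le> 2 * N" if r: "r \<in> eqrels G" for n r
  proof -
    show "0 \<le> T n r" unfolding T_def by (intro sum_nonneg) (simp add: D0)
    have "T n r \<le> (\<Sum>s\<in>S. 2)" unfolding T_def by (rule sum_mono) (use D_le2[OF _ r] S in auto)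
    then show "T n r \<le> 2 * N" by (simp add: N_def)
  qed
  have "(\<lambda>n. \<integral>r. T n r \<partial>\<rho>) \<longlonglongrightarrow> (\<integral>r. 0 \<partial>\<rho>)"
  proof (rule integral_dominated_convergence[where w = "\<lambda>_. 2 * N"])
    show "AE r in \<rho>. (\<lambda>n. T n r) \<longlonglongrightarrow> 0"
      using conv AE_space
    proof eventually_elim
      case (elim r)
      then have r: "r \<in> eqrels G" by (simp add: sp)
      have "(\<lambda>n. if (\<one>, s) \<in> r then D n s r else 0) \<longlonglongrightarrow> 0" if s: "s \<in> S" for s
      proof (cases "(\<one>, s) \<in> r")
        case True
        have sc: "s \<in> carrier G" using s S by blast
        have "(\<lambda>n. l1_dist G (translate G (inv s) (l n r)) (l n (shift G (inv s) r))) \<longlonglongrightarrow> 0"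
          using elim(1) True by auto
        then have "(\<lambda>n. D n s r) \<longlonglongrightarrow> 0"
          by (rule tendsto_sandwich[OF _ _ tendsto_const, rotated -1])
             (use D0 D_le[OF sc r] in \<open>auto simp: always_eventually\<close>)
        then show ?thesis using True by simp
      qed simp
      then have "(\<lambda>n. T n r) \<longlonglongrightarrow> (\<Sum>s\<in>S. 0)" unfolding T_def by (intro tendsto_sum)
      then show ?case by simp
    qed
    show "AE r in \<rho>. norm (T n r) \<le> 2 * N" for n
      by (rule AE_I2) (use T_bounds in \<open>auto simp: sp\<close>)
  qed (use T_meas in auto)
  then have "eventually (\<lambda>n. (\<integral>r. T n r \<partial>\<rho>) < \<delta> / 2) sequentially"
    using \<delta> by (intro order_tendstoD) auto
  then obtain n where n: "(\<integral>r. T n r \<partial>\<rho>) < \<delta> / 2" by (auto simp: eventually_sequentially)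
  have cK: "real (card (K n)) > 0" using K(1,3)[of n] by (auto simp: card_gt_0_iff)
  \<comment> \<open>With this precision the coordinates in \<open>K n\<close> together have error at
    most \<open>\<delta>'\<close>.\<close>
  have "\<forall>k\<in>carrier G. \<exists>h. local_map G h \<and> (\<forall>r. 0 \<le> h r \<and> h r \<le> (1 :: real)) \<and>
      (\<integral>r. \<bar>l n r k - h r\<bar> \<partial>\<rho>) < \<delta>' / real (card (K n))"
  proof
    fix k assume k: "k \<in> carrier G"
    show "\<exists>h. local_map G h \<and> (\<forall>r. 0 \<le> h r \<and> h r \<le> (1 :: real)) \<and>
      (\<integral>r. \<bar>l n r k - h r\<bar> \<partial>\<rho>) < \<delta>' / real (card (K n))"
    proof (rule approx_local_function[OF cnt P sets\<rho> lm[OF k]])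
      show "0 \<le> l n r k \<and> l n r k \<le> 1" if "r \<in> space \<rho>" for r
        using l_sum[of "{k}" r n] that k by (simp add: sp)
      show "0 < \<delta>' / real (card (K n))" using \<delta>' cK by simp
    qed
  qed
  from bchoice[OF this] obtain a where
    "\<forall>k\<in>carrier G. local_map G (a k) \<and> (\<forall>r. 0 \<le> a k r \<and> a k r \<le> (1 :: real)) \<and>
      (\<integral>r. \<bar>l n r k - a k r\<bar> \<partial>\<rho>) < \<delta>' / real (card (K n))" ..
  then have a: "\<And>k. k \<in> carrier G \<Longrightarrow> local_map G (a k)"
    "\<And>k r. k \<in> carrier G \<Longrightarrow> 0 \<le> a k r \<and> a k r \<le> 1"
    "\<And>k. k \<in> carrier G \<Longrightarrow> (\<integral>r. \<bar>l n r k - a k r\<bar> \<partial>\<rho>) < \<delta>' / real (card (K n))" by blast+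
  have Kc: "k \<in> carrier G" if "k \<in> K n" for k using that K(2) by blast
  define \<Lambda> where "\<Lambda> = (\<lambda>r. normalize_on (K n) \<one> (\<lambda>k. a k r))"
  have kernel: "local_kernel (K n) \<Lambda>"
    unfolding local_kernel_def
  proof (intro conjI allI ballI impI)
    fix h
    \<comment> \<open>The normalisation reads only the values on \<open>K n\<close>, so it is a
      function of a finite tuple of local functions.\<close>
    have "local_map G (\<lambda>r. normalize_on (K n) \<one> (\<lambda>k\<in>K n. a k r) h)"
      by (rule local_compose[where F = "\<lambda>f. normalize_on (K n) \<one> f h", OF local_fun[OF K(1)]]) (rule a(1)[OF Kc])
    moreover have "normalize_on (K n) \<one> (\<lambda>k\<in>K n. a k r) h = \<Lambda> r h" for r
      unfolding \<Lambda>_def normalize_on_def by simp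
    ultimately show "local_map G (\<lambda>r. \<Lambda> r h)" by simp
    fix r
    show "\<Lambda> r \<in> Prob G"
      unfolding \<Lambda>_def by (rule normalize_on_Prob[OF K]) (use a(2) Kc in auto)
    show "\<Lambda> r h = 0" if "h \<notin> K n" using that by (simp add: \<Lambda>_def normalize_on_def)
  qed
  define err where "err = (\<lambda>r. 3 * (1 - (\<Sum>k\<in>K n. l n r k)) + 2 * (\<Sum>k\<in>K n. \<bar>a k r - l n r k\<bar>))"
  have err: "(\<Sum>h\<in>Q'. \<bar>\<Lambda> r h - l n r h\<bar>) \<le> err r" if "finite Q'" "Q' \<subseteq> carrier G" "r \<in> eqrels G" for Q' r
    unfolding \<Lambda>_def err_def by (rule normalize_on_dist[OF K _ lP[OF that(3)] that(1,2)]) (use a(2) Kc in auto)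
  have err0: "0 \<le> err r" if "r \<in> eqrels G" for r
    using err[of "{}" r] that by simp
  have am': "a k \<in> borel_measurable \<rho>" if "k \<in> carrier G" for k
    using continuous_map_borel_eqrel[OF local_continuous[OF a(1)[OF that]]] measurable_cong_sets[OF sets\<rho> refl] by blast
  have diff_int: "integrable \<rho> (\<lambda>r. \<bar>a k r - l n r k\<bar>)" if k: "k \<in> carrier G" for k
  proof (rule integrable_const_bound[of _ 1])
    show "(\<lambda>r. \<bar>a k r - l n r k\<bar>) \<in> borel_measurable \<rho>" using am'[OF k] lm[OF k] by measurable
    show "AE r in \<rho>. norm \<bar>a k r - l n r k\<bar> \<le> 1"
    proof (rule AE_I2)
      fix r assume "r \<in> space \<rho>"
      then have "0 \<le> l n r k" "l n r k \<le> 1" using l_sum[of "{k}" r n] k by (auto simp: sp)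
      then show "norm \<bar>a k r - l n r k\<bar> \<le> 1" using a(2)[OF k, of r] by auto
    qed
  qed
  have tail_int: "integrable \<rho> (\<lambda>r. 1 - (\<Sum>k\<in>K n. l n r k))"
    by (intro Bochner_Integration.integrable_diff l_sum_int K) simp
  have err_int: "integrable \<rho> err"
    unfolding err_def
    by (intro Bochner_Integration.integrable_add integrable_mult_right tail_int
        Bochner_Integration.integrable_sum diff_int Kc)
  have err_le: "(\<integral>r. err r \<partial>\<rho>) \<le> 5 * \<delta>'"
  proof -
    have "(\<integral>r. err r \<partial>\<rho>) = 3 * (\<integral>r. 1 - (\<Sum>k\<in>K n. l n r k) \<partial>\<rho>) + 2 * (\<Sum>k\<in>K n. \<integral>r. \<bar>a k r - l n r k\<bar> \<partial>\<rho>)"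
    proof -
      have v: "integrable \<rho> (\<lambda>r. \<Sum>k\<in>K n. \<bar>a k r - l n r k\<bar>)"
        by (intro Bochner_Integration.integrable_sum diff_int Kc)
      have "(\<integral>r. err r \<partial>\<rho>) = (\<integral>r. 3 * (1 - (\<Sum>k\<in>K n. l n r k)) \<partial>\<rho>) + (\<integral>r. 2 * (\<Sum>k\<in>K n. \<bar>a k r - l n r k\<bar>) \<partial>\<rho>)"
        unfolding err_def
        by (rule Bochner_Integration.integral_add[OF integrable_mult_right[OF tail_int] integrable_mult_right[OF v]])
      also have "\<dots> = 3 * (\<integral>r. 1 - (\<Sum>k\<in>K n. l n r k) \<partial>\<rho>) + 2 * (\<integral>r. (\<Sum>k\<in>K n. \<bar>a k r - l n r k\<bar>) \<partial>\<rho>)"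
        by (simp only: integral_mult_right_zero)
      also have "(\<integral>r. (\<Sum>k\<in>K n. \<bar>a k r - l n r k\<bar>) \<partial>\<rho>) = (\<Sum>k\<in>K n. \<integral>r. \<bar>a k r - l n r k\<bar> \<partial>\<rho>)"
        by (intro Bochner_Integration.integral_sum diff_int Kc)
      finally show ?thesis .
    qed
    moreover have "(\<Sum>k\<in>K n. \<integral>r. \<bar>a k r - l n r k\<bar> \<partial>\<rho>) \<le> (\<Sum>k\<in>K n. \<delta>' / real (card (K n)))"
      by (rule sum_mono) (use a(3)[OF Kc] in \<open>auto simp: abs_minus_commute intro: less_imp_le\<close>)
    moreover have "(\<Sum>k\<in>K n. \<delta>' / real (card (K n))) = \<delta>'" using cK by simp
    ultimately show ?thesis using tail[of n] by linarith
  qed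
  \<comment> \<open>Replacing \<open>\<Lambda>\<close> by \<open>l n\<close> in both arguments of
    the norm costs one error at \<open>r\<close> and one at the shifted relation; left
    multiplication by \<open>inv s\<close> only permutes the finite sum in the second.\<close>
  have drift_pt: "drift S \<Lambda> r \<le> T n r + (\<Sum>s\<in>S. err r + err (shift G (inv s) r))" if r: "r \<in> eqrels G" for r
    unfolding drift_def T_def sum.distrib[symmetric]
  proof (rule sum_mono)
    fix s assume "s \<in> S"
    then have s: "s \<in> carrier G" using S by blast
    define r' where "r' = shift G (inv s) r"
    have r': "r' \<in> eqrels G" unfolding r'_def by (rule shift_E[OF s r])
    have "l1_dist G (\<Lambda> r) (translate G s (\<Lambda> r')) = (\<Sum>h\<in>Q n s. \<bar>\<Lambda> r h - \<Lambda> r' (inv s \<otimes> h)\<bar>)"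
      unfolding Q_def r'_def by (rule kernel_l1_dist[OF kernel K(1,2) s r])
    also have "\<dots> \<le> (\<Sum>h\<in>Q n s. \<bar>l n r h - l n r' (inv s \<otimes> h)\<bar> + \<bar>\<Lambda> r h - l n r h\<bar> + \<bar>\<Lambda> r' (inv s \<otimes> h) - l n r' (inv s \<otimes> h)\<bar>)"
      by (rule sum_mono) linarith
    also have "\<dots> = D n s r + (\<Sum>h\<in>Q n s. \<bar>\<Lambda> r h - l n r h\<bar>) + (\<Sum>h\<in>Q n s. \<bar>\<Lambda> r' (inv s \<otimes> h) - l n r' (inv s \<otimes> h)\<bar>)"
      by (simp add: sum.distrib D_def r'_def)
    also have "(\<Sum>h\<in>Q n s. \<bar>\<Lambda> r' (inv s \<otimes> h) - l n r' (inv s \<otimes> h)\<bar>) = (\<Sum>h\<in>(\<lambda>h. inv s \<otimes> h) ` Q n s. \<bar>\<Lambda> r' h - l n r' h\<bar>)"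
      using inj_on_subset[OF bij_betw_imp_inj_on[OF bij_betw_mult_left[OF inv_closed[OF s]]] Q(2)[OF s]]
      by (simp add: sum.reindex)
    also have "\<dots> \<le> err r'" by (rule err[OF _ _ r']) (use Q[OF s] s in auto)
    also have "(\<Sum>h\<in>Q n s. \<bar>\<Lambda> r h - l n r h\<bar>) \<le> err r" by (rule err[OF Q[OF s] r])
    finally have "l1_dist G (\<Lambda> r) (translate G s (\<Lambda> r')) \<le> D n s r + (err r + err r')" by simp
    then show "(if (\<one>, s) \<in> r then l1_dist G (\<Lambda> r) (translate G s (\<Lambda> (shift G (inv s) r))) else 0)
        \<le> (if (\<one>, s) \<in> r then D n s r else 0) + (err r + err (shift G (inv s) r))"
      using err0[OF r] err0[OF r'] by (simp add: r'_def)
  qed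
  have T_int: "integrable \<rho> (T n)"
    by (rule integrable_const_bound[of _ "2 * N"]) (use T_bounds T_meas in \<open>auto simp: sp\<close>)
  have err_shift: "integrable \<rho> (\<lambda>r. err (shift G (inv s) r))"
    "(\<integral>r. err (shift G (inv s) r) \<partial>\<rho>) = (\<integral>r. err r \<partial>\<rho>)" if "s \<in> S" for s
  proof -
    have s: "inv s \<in> carrier G" using that S by blast
    have inv: "distr \<rho> \<rho> (shift G (inv s)) = \<rho>" using IRE s by (simp add: IRE_def)
    show "integrable \<rho> (\<lambda>r. err (shift G (inv s) r))"
      using integrable_distr[OF shift_m[OF s], of err] err_int by (simp add: inv)
    show "(\<integral>r. err (shift G (inv s) r) \<partial>\<rho>) = (\<integral>r. err r \<partial>\<rho>)"
      by (rule IRE_integral_shift[OF cnt IRE s borel_measurable_integrable[OF err_int]])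
  qed
  have sum_int: "integrable \<rho> (\<lambda>r. \<Sum>s\<in>S. err r + err (shift G (inv s) r))"
    by (intro Bochner_Integration.integrable_sum Bochner_Integration.integrable_add err_int err_shift)
  have drift_int: "integrable \<rho> (drift S \<Lambda>)"
  proof (rule integrable_const_bound[of _ "2 * N"])
    show "drift S \<Lambda> \<in> borel_measurable \<rho>"
      using continuous_map_borel_eqrel[OF local_continuous[OF local_drift[OF kernel K(1,2) S]]]
        measurable_cong_sets[OF sets\<rho> refl] by blast
    show "AE r in \<rho>. norm (drift S \<Lambda> r) \<le> 2 * N"
    proof (rule AE_I2)
      fix r assume "r \<in> space \<rho>"
      then show "norm (drift S \<Lambda> r) \<le> 2 * N"
        using drift_le[of \<Lambda> S r] drift_nonneg[of S \<Lambda> r] kernel S(2)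
        by (simp add: sp local_kernel_def N_def)
    qed
  qed
  have "(\<integral>r. drift S \<Lambda> r \<partial>\<rho>) \<le> (\<integral>r. T n r + (\<Sum>s\<in>S. err r + err (shift G (inv s) r)) \<partial>\<rho>)"
    by (rule integral_mono[OF drift_int Bochner_Integration.integrable_add[OF T_int sum_int]])
       (use drift_pt in \<open>simp add: sp\<close>)
  also have "\<dots> = (\<integral>r. T n r \<partial>\<rho>) + (\<integral>r. (\<Sum>s\<in>S. err r + err (shift G (inv s) r)) \<partial>\<rho>)"
    by (rule Bochner_Integration.integral_add[OF T_int sum_int])
  also have "(\<integral>r. (\<Sum>s\<in>S. err r + err (shift G (inv s) r)) \<partial>\<rho>) = (\<Sum>s\<in>S. \<integral>r. err r + err (shift G (inv s) r) \<partial>\<rho>)"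
    by (intro Bochner_Integration.integral_sum Bochner_Integration.integrable_add err_int err_shift)
  also have "\<dots> = (\<Sum>s\<in>S. 2 * (\<integral>r. err r \<partial>\<rho>))"
    by (rule sum.cong[OF refl]) (simp add: Bochner_Integration.integral_add[OF err_int err_shift(1)] err_shift(2))
  also have "\<dots> = 2 * N * (\<integral>r. err r \<partial>\<rho>)" by (simp add: N_def)
  also have "2 * N * (\<integral>r. err r \<partial>\<rho>) \<le> 2 * N * (5 * \<delta>')"
    by (rule mult_left_mono[OF err_le]) (use N0 in simp)
  also have "\<dots> \<le> \<delta> / 2" using N0 \<delta> by (simp add: \<delta>'_def field_simps)
  finally have "(\<integral>r. drift S \<Lambda> r \<partial>\<rho>) < \<delta>" using n by linarith
  then show ?thesis using kernel K by blast
qed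

end

theorem theorem1p1:
  fixes G :: "'g monoid"
  assumes "group G" and "countable (carrier G)"
    and "\<not> exact_group G"
  shows "\<exists>(\<rho> :: nat \<Rightarrow> ('g \<times> 'g) set measure) \<rho>'.
           (\<forall>n. finite_IRE G (\<rho> n)) \<and> IRE G \<rho>' \<and> weakly_converges G \<rho> \<rho>' \<and> \<not> amenable_IRE G \<rho>'"
proof -
  interpret group G by fact
  obtain S \<epsilon> where S: "finite S" "S \<subseteq> carrier G" "S \<noteq> {}" and \<epsilon>: "\<epsilon> > 0"
    and bad: "\<And>K. finite K \<Longrightarrow> K \<subseteq> carrier G \<Longrightarrow> \<not> averaged_bound S \<epsilon> K"
    using nonexact_imp_not_averaged[OF assms(2,3)] by blast
  obtain B :: "nat \<Rightarrow> 'g set" where B: "\<And>m. finite (B m)" "\<And>m. B m \<subseteq> carrier G" "\<And>m. \<one>\<^bsub>G\<^esub> \<in> B m"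
    "filterlim B (finite_subsets_at_top (carrier G)) sequentially"
    using obtain_exhaustion[OF assms(2)] by blast
  define N where "N = real (card S)"
  have N: "N \<ge> 1" using S by (simp add: N_def card_gt_0_iff Suc_leI)
  have "\<forall>n. \<exists>F. finite F \<and> F \<subseteq> carrier G \<and>
      (\<forall>\<xi>\<in>prob_fields (B n). \<epsilon> * real (card F) < (\<Sum>x\<in>F. site_cost {s\<in>S. x \<otimes>\<^bsub>G\<^esub> s \<in> F} \<xi> x))"
    using bad[OF B(1,2)] unfolding averaged_bound_def by (auto simp: not_le)
  from choice[OF this] obtain F where "\<forall>n. finite (F n) \<and> F n \<subseteq> carrier G \<and>
      (\<forall>\<xi>\<in>prob_fields (B n). \<epsilon> * real (card (F n)) < (\<Sum>x\<in>F n. site_cost {s\<in>S. x \<otimes>\<^bsub>G\<^esub> s \<in> F n} \<xi> x))" ..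
  then have F: "\<And>n. finite (F n)" "\<And>n. F n \<subseteq> carrier G"
    and F_bad: "\<And>n \<xi>. \<xi> \<in> prob_fields (B n) \<Longrightarrow>
      \<epsilon> * real (card (F n)) < (\<Sum>x\<in>F n. site_cost {s\<in>S. x \<otimes>\<^bsub>G\<^esub> s \<in> F n} \<xi> x)" by blast+
  have F_ne: "real (card (F n)) \<ge> 1" and \<epsilon>_less: "\<epsilon> < 2 * N" for n
  proof -
    \<comment> \<open>Testing the bound on the field of point masses shows that \<open>F n\<close>
      is nonempty and that \<open>\<epsilon>\<close> is below the trivial bound
      \<open>2 * N\<close>; the latter ensures \<open>t \<le> 1\<close>.\<close>
    define \<xi> :: "'g \<Rightarrow> 'g \<Rightarrow> real" where "\<xi> = (\<lambda>x h. if h = x then 1 else 0)"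
    have \<xi>: "\<xi> \<in> prob_fields (B n)" unfolding \<xi>_def by (rule prob_fields_nonempty[OF B(3)])
    have less: "\<epsilon> * real (card (F n)) < (\<Sum>x\<in>F n. site_cost {s\<in>S. x \<otimes>\<^bsub>G\<^esub> s \<in> F n} \<xi> x)" by (rule F_bad[OF \<xi>])
    then have "F n \<noteq> {}" by auto
    then show ne: "real (card (F n)) \<ge> 1" using F(1)[of n] by (simp add: card_gt_0_iff Suc_leI)
    have "(\<Sum>x\<in>F n. site_cost {s\<in>S. x \<otimes>\<^bsub>G\<^esub> s \<in> F n} \<xi> x) \<le> (\<Sum>x\<in>F n. 2 * N)"
    proof (rule sum_mono)
      fix x assume x: "x \<in> F n"
      have "site_cost {s\<in>S. x \<otimes>\<^bsub>G\<^esub> s \<in> F n} \<xi> x \<le> 2 * real (card {s\<in>S. x \<otimes>\<^bsub>G\<^esub> s \<in> F n})"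
        by (rule site_cost_bounds[OF \<xi>]) (use x F S in auto)
      also have "\<dots> \<le> 2 * N" unfolding N_def using S(1) by (simp add: card_mono)
      finally show "site_cost {s\<in>S. x \<otimes>\<^bsub>G\<^esub> s \<in> F n} \<xi> x \<le> 2 * N" .
    qed
    with less have "\<epsilon> * real (card (F n)) < 2 * N * real (card (F n))" by (simp add: mult.commute)
    then show "\<epsilon> < 2 * N" using ne by simp
  qed
  \<comment> \<open>This \<open>t\<close> maximises
    \<open>\<epsilon> * t - 4 * N * t\<^sup>2\<close>; the maximum is
    \<open>\<epsilon>\<^sup>2 / (16 * N)\<close>.\<close>
  define t where "t = \<epsilon> / (8 * N)"
  have t: "0 < t" "t \<le> 1" using \<epsilon> \<epsilon>_less N by (auto simp: t_def field_simps)
  define p where "p = (\<lambda>n. t / real (card (F n)))"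
  have pF: "p n * real (card (F n)) = t" for n using F_ne[of n] by (simp add: p_def)
  have p: "0 \<le> p n" "p n \<le> 1" for n
    using t F_ne[of n] by (auto simp: p_def divide_le_eq)
  define \<rho> where "\<rho> = (\<lambda>n. packing_law (F n) (p n))"
  have fin: "finite_IRE G (\<rho> n)" for n
    unfolding \<rho>_def by (rule finite_IRE_packing_law[OF assms(2) F])
  then have IRE: "IRE G (\<rho> n)" for n by (simp add: finite_IRE_def)
  then have \<rho>: "prob_space (\<rho> n)" "sets (\<rho> n) = sets (borel_of (eqrel_topology G))" for n
    by (auto simp: IRE_def)
  have ne: "carrier G \<noteq> {}" using one_closed by blast
  obtain s :: "nat \<Rightarrow> nat" and \<rho>' where s: "strict_mono s" and \<rho>': "prob_space \<rho>'"
    "sets \<rho>' = sets (borel_of (eqrel_topology G))" and lim: "weakly_converges G (\<lambda>n. \<rho> (s n)) \<rho>'"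
    by (rule weakly_convergent_subsequence[OF assms(2) ne \<rho>])
  have IRE': "IRE G \<rho>'" by (rule IRE_weak_limit[OF assms(2) IRE \<rho>' lim])
  have "\<not> amenable_IRE G \<rho>'"
  proof
    assume am: "amenable_IRE G \<rho>'"
    have "\<epsilon>\<^sup>2 / (16 * N) > 0" using \<epsilon> N by simp
    from amenable_IRE_local_kernel[OF assms(2) am S(1,2) this]
    obtain K \<Lambda> where K: "finite K" "K \<subseteq> carrier G" and \<Lambda>: "local_kernel K \<Lambda>"
      and small: "(\<integral>r. drift S \<Lambda> r \<partial>\<rho>') < \<epsilon>\<^sup>2 / (16 * N)" by blast
    have "(\<lambda>n. \<integral>r. drift S \<Lambda> r \<partial>\<rho> (s n)) \<longlonglongrightarrow> (\<integral>r. drift S \<Lambda> r \<partial>\<rho>')"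
      using lim local_continuous[OF local_drift[OF \<Lambda> K S(1,2)]] unfolding weakly_converges_def by blast
    \<comment> \<open>The kernel and its support \<open>K\<close> are chosen after the limit
      measure. The estimate for packings applies to them as soon as \<open>K\<close> is contained in
      \<open>B (s n)\<close>, and its constant depends on neither.\<close>
    moreover have "eventually (\<lambda>n. \<epsilon>\<^sup>2 / (16 * N) \<le> (\<integral>r. drift S \<Lambda> r \<partial>\<rho> (s n))) sequentially"
    proof -
      have "eventually (\<lambda>m. K \<subseteq> B m) sequentially"
        by (rule eventually_mono[OF B(4)[unfolded filterlim_finite_subsets_at_top, rule_format, OF conjI[OF K]]]) blast
      then have "eventually (\<lambda>n. K \<subseteq> B (s n)) sequentially"
        by (rule eventually_subseq[OF s])
      then show ?thesis
      proof eventually_elim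
        case (elim n)
        have "\<epsilon> * t - 4 * N * t\<^sup>2 \<le> (\<integral>r. drift S \<Lambda> r \<partial>\<rho> (s n))"
          using packing_law_drift_ge[OF assms(2) F \<Lambda> K S(1,2) p, of \<epsilon> "s n" "s n"]
            F_bad prob_fields_mono[OF elim] unfolding \<rho>_def pF N_def by (auto intro: less_imp_le)
        moreover have "\<epsilon> * t - 4 * N * t\<^sup>2 = \<epsilon>\<^sup>2 / (16 * N)"
          using N by (simp add: t_def power2_eq_square field_simps)
        ultimately show ?case by simp
      qed
    qed
    ultimately have "\<epsilon>\<^sup>2 / (16 * N) \<le> (\<integral>r. drift S \<Lambda> r \<partial>\<rho>')"
      by (intro tendsto_lowerbound) auto
    then show False using small by linarith
  qed
  then show ?thesis
    using fin IRE' lim by (intro exI[of _ "\<lambda>n. \<rho> (s n)"] exI[of _ \<rho>']) auto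
qed

end
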